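(* For $k=0$ or $k=1$ and every integer $n\geq 94$, \[M_k(n)^2\geq M_k(n-1)M_k(n+1).\] In particular, the sequences $\{M_0(n)\}_{n\geq 94}$ and $\{M_1(n)\}_{n\geq 93}$ are log-concave (i.e. satisfy the Turán inequalities).
   Context: For a partition $\lambda$ of a positive integer, let $\omega(\lambda)$ be the number of parts equal to $1$ and let $\nu(\lambda)$ be the number of parts of $\lambda$ strictly larger than $\omega(\lambda)$. The crank of $\lambda$ is its largest part if $\omega(\lambda)=0$, and $\nu(\lambda)-\omega(\lambda)$ if $\omega(\lambda)>0$. For $n\geq 0$, $M_0(n)$ (resp. $M_1(n)$) denotes the number of partitions of $n$ with even (resp. odd) crank. A sequence $\{a_n\}_{n\geq N}$ is log-concave if $a_n^2\geq a_{n-1}a_{n+1}$ for all $n\geq N+1$. *)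

theory Defs
  imports Complex_Main "HOL-Library.Multiset"
begin

definition partitions :: "nat \<Rightarrow> nat multiset set" where
  "partitions n = {L. 0 \<notin># L \<and> sum_mset L = n}"

definition num_ones :: "nat multiset \<Rightarrow> nat" where
  "num_ones L = count L 1"

(* Parts are counted with multiplicity. *)
definition num_parts_above_ones :: "nat multiset \<Rightarrow> nat" where
  "num_parts_above_ones L = size {# x \<in># L. x > num_ones L #}"

(* Max_mset is unspecified on the empty multiset; the empty partition gets crank 0,
   which only affects the counts for n = 0. *)
definition crank :: "nat multiset \<Rightarrow> int" where
  "crank L =
     (if L = {#} then 0
      else if num_ones L = 0 then int (Max_mset L)
      else int (num_parts_above_ones L) - int (num_ones L))"

definition M\<^sub>0 :: "nat \<Rightarrow> nat" where
  "M\<^sub>0 n = card {L \<in> partitions n. even (crank L)}"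

definition M\<^sub>1 :: "nat \<Rightarrow> nat" where
  "M\<^sub>1 n = card {L \<in> partitions n. odd (crank L)}"

(* The sequence a(N), a(N+1), ...; values of a below N are irrelevant. *)
definition log_concave_from :: "nat \<Rightarrow> (nat \<Rightarrow> 'a::linordered_semidom) \<Rightarrow> bool" where
  "log_concave_from N a \<longleftrightarrow> (\<forall>n \<ge> N + 1. (a n)\<^sup>2 \<ge> a (n - 1) * a (n + 1))"

(* Ensures that card in the definitions of the crank counts is the true cardinality. *)
lemma finite_partitions: "finite (partitions n)"
proof (rule finite_subset)
  have le: "size L \<le> sum_mset L" if "0 \<notin># L" for L :: "nat multiset"
    using that by (induction L) auto
  show "partitions n \<subseteq> mset ` {xs. set xs \<subseteq> {..n} \<and> length xs \<le> n}"
  proof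
    fix L assume L: "L \<in> partitions n"
    obtain xs where xs: "mset xs = L" using ex_mset by blast
    have "length xs \<le> n" using L le[of L] xs by (auto simp: partitions_def)
    moreover have "x \<le> n" if "x \<in> set xs" for x
      using that L xs member_le_sum_list[of x xs]
      by (auto simp: partitions_def sum_mset_sum_list)
    ultimately show "L \<in> mset ` {xs. set xs \<subseteq> {..n} \<and> length xs \<le> n}" using xs by blast
  qed
  show "finite (mset ` {xs. set xs \<subseteq> {..n} \<and> length xs \<le> n})"
    by (intro finite_imageI finite_lists_length_le) simp
qed

end

theory Submission
  imports Defs "HOL-Complex_Analysis.Complex_Analysis" "HOL-Probability.Distributions" "HOL-Real_Asymp.Real_Asymp"
begin

text \<open>Write \<open>p n\<close> for the number of partitions of \<open>n\<close> and \<open>a n = M\<^sub>0 n - M\<^sub>1 n\<close>, so that \<open>2 M\<^sub>k n = p n \<plusminus> a n\<close>.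
  Apart from its coefficient at 1, the generating function of \<open>a\<close> is
  \<open>\<Prod>(1 - q^n)/(1 + q^n)^2\<close>, and Gauss' identity turns it into the theta series
  \<open>\<Sum>(-1)^k q^(k^2)\<close> times \<open>\<Prod>(1 - q^(2n-1))\<close>; bounding the coefficients by the
  values at a positive radius shows that \<open>a\<close> is exponentially smaller than \<open>p\<close>. Applying the modular
  inversion of the partition series on the whole circle of integration gives \<open>p\<close> up to a small relative
  error, with an elementary main term since the remaining integrand has an explicit primitive.
  The main term is strictly log-concave, by a margin that absorbs both errors from \<open>n = 700\<close> on. Smaller \<open>n\<close>
  are settled by computing \<open>p\<close> and \<open>a\<close> from the pentagonal number recurrences and comparing leading binary digits.\<close>

section \<open>Shanks' identities\<close>

text \<open>The budget is tight. The concavity of the square root gains only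
  \<open>hr_alpha / (2 * (x * sqrt x))\<close> in the exponent, which has the same order as the
  relative error \<mu>^(-3) allowed for the main term, so explicit constants must be tracked
  throughout. The analytic error has exponent 5/8 \<mu> against \<mu>: on the line Re t = y through
  the saddle point one and the same inversion serves all arguments, since its correction factor
  costs at most a factor exp (\<mu> / 8) up to lower order even at the far ends of the circle. The
  crank difference has exponent 9/16 \<mu>. The threshold 700 guarantees \<mu> >= 66, which turns
  these gaps into the power of \<mu>. The inversion itself is elementary: for rational multiples of
  2 pi it is the exchange of a finite double sum with a symmetric kernel, and analytic continuation
  does the rest. Formal identities are congruences modulo powers of X over the integers, the form
  that the table of small values needs. One table serves both crank parities, because only p - |a|
  and p + |a| enter.\<close>

text \<open>Shanks' finite form of Euler's pentagonal number theorem; the exponents are k(3k-1)/2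
  and k(3k+1)/2. Every summand with s > 0 is divisible by q^(n+1), which leaves the product for s =
  0.\<close>

lemma shanks_pentagonal:
  fixes q :: "'a :: comm_ring_1"
  shows "(\<Sum>s\<le>n. (-1) ^ s * (\<Prod>k\<in>{s<..n}. 1 - q ^ k) * q ^ (s * n + triangle s)) =
         1 + (\<Sum>k=1..n. (-1) ^ k * (q ^ (k ^ 2 + triangle (k - 1)) + q ^ (k ^ 2 + triangle k)))"
proof (induction n)
  case 0
  show ?case by simp
next
  case (Suc n)
  define P where "P = (\<lambda>s n. \<Prod>k\<in>{s<..n}. 1 - q ^ k)"
  \<comment> \<open>Passing from n to \<open>Suc n\<close> multiplies summand s by
    \<open>q ^ s * (1 - q ^ Suc n)\<close>. For s > 0 the resulting change is
    \<open>u (s - 1) - u s\<close>, so the changes telescope.\<close>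
  define u where "u = (\<lambda>s. (-1) ^ s * P s n * q ^ (s * n + triangle s + s + Suc n))"
  have P_Suc: "P s (Suc n) = P s n * (1 - q ^ Suc n)" if "s \<le> n" for s
  proof -
    have "{s<..Suc n} = insert (Suc n) {s<..n}" using that by auto
    thus ?thesis by (simp add: P_def mult.commute)
  qed
  have P_rec: "P s n = P (Suc s) n * (1 - q ^ Suc s)" if "s < n" for s
  proof -
    have "{s<..n} = insert (Suc s) {Suc s<..n}" using that by auto
    thus ?thesis by (simp add: P_def mult.commute)
  qed
  have part: "(\<Sum>s\<le>m. (-1) ^ s * P s n * q ^ (s * n + triangle s) * (q ^ s * (1 - q ^ Suc n) - 1)) = - u m"
    if "m \<le> n" for m
    using that
  proof (induction m)
    case 0
    show ?case by (simp add: u_def)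
  next
    case (Suc m)
    have "(-1) ^ Suc m * P (Suc m) n * q ^ (Suc m * n + triangle (Suc m)) * (q ^ Suc m * (1 - q ^ Suc n) - 1)
          = u m - u (Suc m)"
      using Suc.prems by (simp add: u_def P_rec power_add algebra_simps)
    thus ?case using Suc by simp
  qed
  have "(\<Sum>s\<le>Suc n. (-1) ^ s * P s (Suc n) * q ^ (s * Suc n + triangle s)) =
        (\<Sum>s\<le>n. (-1) ^ s * P s (Suc n) * q ^ (s * Suc n + triangle s))
          + (-1) ^ Suc n * q ^ (Suc n * Suc n + triangle (Suc n))"
    by (simp add: P_def)
  also have "(\<Sum>s\<le>n. (-1) ^ s * P s (Suc n) * q ^ (s * Suc n + triangle s)) =
     (\<Sum>s\<le>n. (-1) ^ s * P s n * q ^ (s * n + triangle s) +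
         (-1) ^ s * P s n * q ^ (s * n + triangle s) * (q ^ s * (1 - q ^ Suc n) - 1))"
    by (intro sum.cong refl) (simp add: P_Suc power_add algebra_simps)
  also have "\<dots> = (\<Sum>s\<le>n. (-1) ^ s * P s n * q ^ (s * n + triangle s)) - u n"
    using part[of n] by (simp add: sum.distrib)
  also have "u n = - ((-1) ^ Suc n * q ^ (Suc n ^ 2 + triangle n))"
    by (simp add: u_def P_def power2_eq_square power_add algebra_simps)
  finally show ?case
    using Suc.IH by (simp add: P_def power2_eq_square algebra_simps)
qed

text \<open>A finite form of Gauss' theta identity, multiplied out so that it holds in every
  commutative ring. The correction sum is divisible by \<open>q ^ Suc n\<close>. The proof
  telescopes as for the pentagonal numbers.\<close>

lemma shanks_gauss:
  fixes q :: "'a :: comm_ring_1"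
  shows "(\<Prod>k=1..n. 1 + q ^ k) * (1 + 2 * (\<Sum>k=1..n. (-1) ^ k * q ^ (k ^ 2))) =
         (\<Prod>k=1..n. 1 - q ^ k) + 2 * (\<Sum>s=1..n. (-1) ^ s * q ^ (s * Suc n) *
            ((\<Prod>k\<in>{0<..<s}. 1 + q ^ k) * (\<Prod>k\<in>{s<..n}. 1 - q ^ k)))"
proof (induction n)
  case 0
  show ?case by simp
next
  case (Suc n)
  define B where "B = (\<lambda>s. \<Prod>k\<in>{0<..<s}. 1 + q ^ k)"
  define P where "P = (\<lambda>s n. \<Prod>k\<in>{s<..n}. 1 - q ^ k)"
  define u where "u = (\<lambda>s. (-1) ^ s * (B (Suc s) * P s n) * q ^ (Suc s * Suc n))"
  define T where "T = (\<lambda>n. 1 + 2 * (\<Sum>k=1..n. (-1) ^ k * q ^ (k ^ 2)))"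
  define S where "S = (\<lambda>n. \<Sum>s=1..n. (-1) ^ s * q ^ (s * Suc n) * (B s * P s n))"
  have B_Suc: "B (Suc s) = B s * (1 + q ^ s)" if "s > 0" for s
  proof -
    have "{0<..<Suc s} = insert s {0<..<s}" using that by auto
    thus ?thesis by (simp add: B_def mult.commute)
  qed
  have P_Suc: "P s (Suc n) = P s n * (1 - q ^ Suc n)" if "s \<le> n" for s
  proof -
    have "{s<..Suc n} = insert (Suc n) {s<..n}" using that by auto
    thus ?thesis by (simp add: P_def mult.commute)
  qed
  have P_rec: "P s n = P (Suc s) n * (1 - q ^ Suc s)" if "s < n" for s
  proof -
    have "{s<..n} = insert (Suc s) {Suc s<..n}" using that by auto
    thus ?thesis by (simp add: P_def mult.commute)
  qed
  have B_eq: "(\<Prod>k=1..m. 1 + q ^ k) = B (Suc m)" for m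
    unfolding B_def by (intro prod.cong) auto
  have P_eq: "(\<Prod>k=1..m. 1 - q ^ k) = P 0 m" for m
    unfolding P_def by (intro prod.cong) auto
  \<comment> \<open>The left-hand side grows by the factor \<open>1 + q ^ Suc n\<close>, so the
    change of each summand is measured against that factor. A boundary term remains at either
    end.\<close>
  have part: "(\<Sum>s=1..m. (-1) ^ s * q ^ (s * Suc n) * (B s * P s n) * (q ^ s * (1 - q ^ Suc n) - (1 + q ^ Suc n)))
      = u 0 - u m" if "m \<le> n" for m
    using that
  proof (induction m)
    case (Suc m)
    have "(-1) ^ Suc m * q ^ (Suc m * Suc n) * (B (Suc m) * P (Suc m) n)
            * (q ^ Suc m * (1 - q ^ Suc n) - (1 + q ^ Suc n)) = u m - u (Suc m)"
      using Suc.prems by (simp add: u_def P_rec B_Suc power_add algebra_simps)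
    thus ?case using Suc by simp
  qed simp
  have "S (Suc n) = (\<Sum>s=1..n. (-1) ^ s * q ^ (s * Suc (Suc n)) * (B s * P s (Suc n)))
      + (-1) ^ Suc n * q ^ (Suc n * Suc (Suc n)) * B (Suc n)"
    by (simp add: S_def P_def)
  also have "(\<Sum>s=1..n. (-1) ^ s * q ^ (s * Suc (Suc n)) * (B s * P s (Suc n))) =
     (\<Sum>s=1..n. (1 + q ^ Suc n) * ((-1) ^ s * q ^ (s * Suc n) * (B s * P s n)) +
         (-1) ^ s * q ^ (s * Suc n) * (B s * P s n) * (q ^ s * (1 - q ^ Suc n) - (1 + q ^ Suc n)))"
    by (intro sum.cong refl) (simp add: P_Suc power_add algebra_simps)
  also have "\<dots> = (1 + q ^ Suc n) * S n + (u 0 - u n)"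
    using part[of n] by (simp add: sum.distrib S_def sum_distrib_left)
  finally have S_Suc: "S (Suc n) = (1 + q ^ Suc n) * S n + u 0 - u n
      + (-1) ^ Suc n * q ^ (Suc n * Suc (Suc n)) * B (Suc n)" by simp
  have u0: "u 0 = P 0 n * q ^ Suc n"
  proof -
    have "{0<..<Suc 0} = {}" by auto
    thus ?thesis by (simp add: u_def B_def)
  qed
  have un: "u n = (-1) ^ n * B (Suc n) * q ^ (Suc n * Suc n)" by (simp add: u_def P_def)
  have IH: "B (Suc n) * T n = P 0 n + 2 * S n"
    using Suc.IH unfolding B_eq P_eq S_def T_def by (simp add: B_def P_def)
  have T_Suc: "T (Suc n) = T n + 2 * ((-1) ^ Suc n * q ^ (Suc n * Suc n))"
    by (simp add: T_def power2_eq_square algebra_simps)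
  have "B (Suc (Suc n)) * T (Suc n) =
      (1 + q ^ Suc n) * (B (Suc n) * T n) + 2 * (B (Suc n) * (1 + q ^ Suc n)) * ((-1) ^ Suc n * q ^ (Suc n * Suc n))"
    unfolding T_Suc B_Suc[OF zero_less_Suc] by (simp only: algebra_simps)
  also have "\<dots> = P 0 (Suc n) + 2 * S (Suc n)"
    unfolding IH S_Suc u0 un P_Suc[OF le0] by (simp add: power_add algebra_simps)
  finally show ?case
    unfolding B_eq P_eq S_def T_def by (simp only: B_def P_def)
qed

section \<open>The generating function of the crank parity difference\<close>

text \<open>Congruence modulo X^(N+1) lets finite products stand for infinite ones, so no limits of
  formal series are taken.\<close>

definition fps_eq_upto :: "nat \<Rightarrow> 'a :: comm_ring_1 fps \<Rightarrow> 'a fps \<Rightarrow> bool" where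
  "fps_eq_upto N f g \<longleftrightarrow> (\<forall>i\<le>N. fps_nth f i = fps_nth g i)"

lemma fps_eq_upto_refl [simp, intro]: "fps_eq_upto N f f"
  by (simp add: fps_eq_upto_def)

lemma fps_eq_upto_sym: "fps_eq_upto N f g \<Longrightarrow> fps_eq_upto N g f"
  by (simp add: fps_eq_upto_def)

lemma fps_eq_upto_trans [trans]: "fps_eq_upto N f g \<Longrightarrow> fps_eq_upto N g h \<Longrightarrow> fps_eq_upto N f h"
  by (simp add: fps_eq_upto_def)

lemma fps_eq_upto_add: "fps_eq_upto N f g \<Longrightarrow> fps_eq_upto N f' g' \<Longrightarrow> fps_eq_upto N (f + f') (g + g')"
  by (simp add: fps_eq_upto_def)

lemma fps_eq_upto_diff: "fps_eq_upto N f g \<Longrightarrow> fps_eq_upto N f' g' \<Longrightarrow> fps_eq_upto N (f - f') (g - g')"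
  by (simp add: fps_eq_upto_def)

lemma fps_eq_upto_mult: "fps_eq_upto N f g \<Longrightarrow> fps_eq_upto N f' g' \<Longrightarrow> fps_eq_upto N (f * f') (g * g')"
  by (auto simp: fps_eq_upto_def fps_mult_nth intro!: sum.cong)

lemma fps_eq_upto_sum:
  "(\<And>x. x \<in> A \<Longrightarrow> fps_eq_upto N (f x) (g x)) \<Longrightarrow> fps_eq_upto N (\<Sum>x\<in>A. f x) (\<Sum>x\<in>A. g x)"
  by (auto simp: fps_eq_upto_def fps_sum_nth intro!: sum.cong)

lemma fps_eq_upto_prod:
  "(\<And>x. x \<in> A \<Longrightarrow> fps_eq_upto N (f x) (g x)) \<Longrightarrow> fps_eq_upto N (\<Prod>x\<in>A. f x) (\<Prod>x\<in>A. g x)"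
  by (induction A rule: infinite_finite_induct) (auto intro!: fps_eq_upto_mult)

lemma fps_eq_upto_X_power: "N < k \<Longrightarrow> fps_eq_upto N (fps_X ^ k * f) 0"
  by (simp add: fps_eq_upto_def fps_X_power_mult_nth)

text \<open>A factor with constant coefficient 1 determines the coefficients of the other factor one
  after the other, so cancellation works over the integers.\<close>

lemma fps_eq_upto_cancel:
  assumes "fps_eq_upto N (h * f) (h * g)" "fps_nth h 0 = 1"
  shows   "fps_eq_upto N f g"
proof -
  have "fps_nth f i = fps_nth g i" if "i \<le> N" for i
    using that
  proof (induction i rule: less_induct)
    case (less i)
    have split: "fps_nth (h * f') i = fps_nth f' i + (\<Sum>j=1..i. fps_nth h j * fps_nth f' (i - j))" for f'
      using assms(2) by (simp add: fps_mult_nth sum.atLeast_Suc_atMost)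
    have "(\<Sum>j=1..i. fps_nth h j * fps_nth f (i - j)) = (\<Sum>j=1..i. fps_nth h j * fps_nth g (i - j))"
      using less by (intro sum.cong) auto
    moreover have "fps_nth (h * f) i = fps_nth (h * g) i"
      using assms(1) less.prems by (auto simp: fps_eq_upto_def)
    ultimately show ?case by (simp add: split)
  qed
  thus ?thesis by (simp add: fps_eq_upto_def)
qed

section \<open>Partitions with parts in a given set and their weighted generating functions\<close>

definition parts_in :: "nat set \<Rightarrow> nat \<Rightarrow> nat multiset set" where
  "parts_in S n = {L. set_mset L \<subseteq> S \<and> sum_mset L = n}"

lemma parts_in_subset_partitions: "0 \<notin> S \<Longrightarrow> parts_in S n \<subseteq> partitions n"
  by (auto simp: parts_in_def partitions_def)

lemma finite_parts_in: "0 \<notin> S \<Longrightarrow> finite (parts_in S n)"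
  by (rule finite_subset[OF parts_in_subset_partitions finite_partitions])

lemma part_le_sum_mset: "x \<in># L \<Longrightarrow> x \<le> sum_mset L" for x :: nat
proof -
  assume "x \<in># L"
  then obtain L' where "L = add_mset x L'" by (metis multi_member_split)
  thus ?thesis by simp
qed

lemma partitions_eq_parts_in:
  assumes "n \<le> N"
  shows "partitions n = parts_in {1..N} n"
proof -
  have "0 \<notin># L \<longleftrightarrow> set_mset L \<subseteq> {1..N}" if "sum_mset L = n" for L
  proof -
    have "x \<le> N" if "x \<in># L" for x
      using part_le_sum_mset[OF that] \<open>sum_mset L = n\<close> assms by simp
    thus ?thesis by (auto simp: Suc_le_eq intro: gr0I)
  qed
  thus ?thesis by (auto simp: partitions_def parts_in_def)
qed

lemma parts_in_insert:
  assumes "k > 0"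
  shows "parts_in (insert k S) n =
           parts_in (S - {k}) n \<union> (if k \<le> n then add_mset k ` parts_in (insert k S) (n - k) else {})"
    (is "?P = ?Q \<union> (if k \<le> n then ?I else {})")
proof -
  have 1: "L \<in> ?I \<and> k \<le> n" if "L \<in> ?P" "k \<in># L" for L
  proof -
    obtain L' where L': "L = add_mset k L'" using \<open>k \<in># L\<close> by (metis multi_member_split)
    with that have "L' \<in> parts_in (insert k S) (n - k)" "k \<le> n" by (auto simp: parts_in_def)
    thus ?thesis using L' by blast
  qed
  have 2: "L \<in> ?Q" if "L \<in> ?P" "k \<notin># L" for L
    using that by (auto simp: parts_in_def)
  have 3: "add_mset k L \<in> ?P" if "L \<in> parts_in (insert k S) (n - k)" "k \<le> n" for L
    using that by (simp add: parts_in_def)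
  have 4: "?Q \<subseteq> ?P"
    by (auto simp: parts_in_def)
  show ?thesis
  proof (cases "k \<le> n")
    case True
    have "?P = ?Q \<union> ?I" using 1 2 3[OF _ True] 4 by blast
    thus ?thesis using True by simp
  next
    case False
    have "?P = ?Q" using 1 2 4 False by blast
    thus ?thesis using False by simp
  qed
qed

text \<open>The weights are multiplicative over the parts. This suffices to encode the sign of the
  crank and still gives a product formula.\<close>

definition parts_gf :: "(nat \<Rightarrow> int) \<Rightarrow> nat set \<Rightarrow> int fps" where
  "parts_gf w S = Abs_fps (\<lambda>n. \<Sum>L\<in>parts_in S n. \<Prod>x\<in>#L. w x)"

lemma sum_parts_in_insert:
  fixes f :: "nat multiset \<Rightarrow> 'a :: comm_monoid_add"
  assumes "k > 0" "0 \<notin> S" "k \<notin> S"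
  shows "(\<Sum>L\<in>parts_in (insert k S) n. f L) =
         (\<Sum>L\<in>parts_in S n. f L) + (if k \<le> n then \<Sum>L\<in>parts_in (insert k S) (n - k). f (add_mset k L) else 0)"
proof -
  let ?I = "add_mset k ` parts_in (insert k S) (n - k)"
  have disj: "parts_in S n \<inter> ?I = {}"
  proof -
    have "k \<notin># L" if "L \<in> parts_in S n" for L
      using that assms(3) unfolding parts_in_def by blast
    thus ?thesis by fastforce
  qed
  have fin: "finite (parts_in S n)" "finite ?I"
    using assms by (simp_all add: finite_parts_in)
  have S: "S - {k} = S" using assms(3) by simp
  have eq: "(\<Sum>L\<in>?I. f L) = (\<Sum>L\<in>parts_in (insert k S) (n - k). f (add_mset k L))"
    by (subst sum.reindex) (simp_all add: inj_on_def o_def)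
  show ?thesis
  proof (cases "k \<le> n")
    case True
    hence "parts_in (insert k S) n = parts_in S n \<union> ?I"
      using parts_in_insert[OF assms(1), of S n] S by simp
    thus ?thesis using True sum.union_disjoint[OF fin disj, of f] eq by simp
  next
    case False
    hence "parts_in (insert k S) n = parts_in S n"
      using parts_in_insert[OF assms(1), of S n] S by simp
    thus ?thesis using False by simp
  qed
qed

text \<open>A partition either avoids k or arises by adding one copy of k, so the new series G' and
  the old one G satisfy G' = G + w(k) X^k G'.\<close>

lemma parts_gf_insert:
  assumes "k > 0" "0 \<notin> S" "k \<notin> S"
  shows "parts_gf w (insert k S) * (1 - fps_const (w k) * fps_X ^ k) = parts_gf w S"
proof (rule fps_ext)
  fix n
  have "fps_nth (parts_gf w (insert k S)) n = fps_nth (parts_gf w S) n +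
          (if k \<le> n then w k * fps_nth (parts_gf w (insert k S)) (n - k) else 0)"
    using sum_parts_in_insert[OF assms, of "\<lambda>L. \<Prod>x\<in>#L. w x" n]
    by (simp add: parts_gf_def sum_distrib_left)
  moreover have "parts_gf w (insert k S) * (1 - fps_const (w k) * fps_X ^ k) =
      parts_gf w (insert k S) - fps_const (w k) * (fps_X ^ k * parts_gf w (insert k S))"
    by (simp add: algebra_simps)
  ultimately show "fps_nth (parts_gf w (insert k S) * (1 - fps_const (w k) * fps_X ^ k)) n = fps_nth (parts_gf w S) n"
    by (simp add: fps_X_power_mult_nth)
qed

text \<open>Stating the product formula as an equation with 1 keeps inverses of power series out of
  the development.\<close>

lemma parts_gf_mult_prod:
  assumes "finite S" "0 \<notin> S"
  shows "parts_gf w S * (\<Prod>k\<in>S. 1 - fps_const (w k) * fps_X ^ k) = 1"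
  using assms
proof (induction S)
  case empty
  have "parts_in {} n = (if n = 0 then {{#}} else {})" for n
    by (auto simp: parts_in_def)
  thus ?case by (auto simp: parts_gf_def fps_eq_iff)
next
  case (insert k S)
  have "parts_gf w (insert k S) * (\<Prod>k\<in>insert k S. 1 - fps_const (w k) * fps_X ^ k) =
      (parts_gf w (insert k S) * (1 - fps_const (w k) * fps_X ^ k)) * (\<Prod>k\<in>S. 1 - fps_const (w k) * fps_X ^ k)"
    using insert.hyps by (simp add: mult.assoc)
  also have "\<dots> = 1"
    using insert parts_gf_insert[of k S w] by (simp only: insert_iff) (auto intro: gr0I)
  finally show ?case .
qed

abbreviation "parts_gf1 \<equiv> parts_gf (\<lambda>_. 1)"

lemma parts_gf1_nth: "n \<le> N \<Longrightarrow> fps_nth (parts_gf1 {1..N}) n = int (card (partitions n))"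
  by (simp add: parts_gf_def partitions_eq_parts_in[of n N])

lemma parts_gf1_mult_prod:
  assumes "a > 0"
  shows "parts_gf1 {a..N} * (\<Prod>k=a..N. 1 - fps_X ^ k) = 1"
  using parts_gf_mult_prod[of "{a..N}" "\<lambda>_. 1"] assms by simp

text \<open>Cauchy's q-binomial theorem at x = -q: the recursion makes \<open>c w\<close> equal to
  (a;q)_w / (q;q)_w, and the sum is (-aq;q) / (-q;q) with infinite products. The functional equation
  (1 - x) F(x) = (1 - a x) F(q x) is iterated along x = -q, -q^2, ...; truncating F costs only terms
  of degree above N.\<close>

lemma q_binomial_upto:
  fixes c :: "nat \<Rightarrow> int fps"
  assumes c0: "c 0 = 1" and c: "\<And>w. c (Suc w) * (1 - fps_X ^ Suc w) = c w * (1 - a * fps_X ^ w)"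
  shows "fps_eq_upto N ((\<Sum>w\<le>N. c w * (- fps_X) ^ w) * (\<Prod>k=1..N. 1 + fps_X ^ k)) (\<Prod>k=1..N. 1 + a * fps_X ^ k)"
proof -
  let ?X = "fps_X :: int fps"
  define x where "x = (\<lambda>j. - (?X ^ Suc j))"
  define F where "F = (\<lambda>j. \<Sum>w\<le>N. c w * x j ^ w)"
  have x_Suc: "x (Suc j) = ?X * x j" for j by (simp add: x_def)
  have step: "fps_eq_upto N (F j * (1 + ?X ^ Suc j)) ((1 + a * ?X ^ Suc j) * F (Suc j))" for j
  proof -
    have "(\<Sum>w\<le>M. c w * x j ^ w) - (\<Sum>w\<le>M. c w * x (Suc j) ^ w) =
        x j * (\<Sum>w\<le>M. c w * x j ^ w) - a * x j * (\<Sum>w\<le>M. c w * x (Suc j) ^ w)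
         - x j ^ Suc M * (c M * (1 - a * ?X ^ M))" for M
    proof (induction M)
      case 0
      show ?case by (simp add: c0 algebra_simps)
    next
      case (Suc M)
      have 1: "c (Suc M) * x j ^ Suc M - c (Suc M) * x (Suc j) ^ Suc M =
            x j ^ Suc M * (c M * (1 - a * ?X ^ M))"
        unfolding x_Suc power_mult_distrib c[symmetric] by (simp add: algebra_simps del: power_Suc)
      have 2: "x j * (c (Suc M) * x j ^ Suc M) - a * x j * (c (Suc M) * x (Suc j) ^ Suc M) =
            x j ^ Suc (Suc M) * (c (Suc M) * (1 - a * ?X ^ Suc M))"
        unfolding x_Suc power_mult_distrib by (simp add: algebra_simps)
      have aux: "(A + C) - (B + D) = (P + E) - (Q + G) - r"
        if "A - B = P - Q - p" "C - D = p" "E - G = r" for A B C D E G P Q p r :: "int fps"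
      proof -
        have "(A + C) - (B + D) = (A - B) + (C - D)" by simp
        also have "\<dots> = (P + E) - (Q + G) - (E - G)" unfolding that(1,2) by simp
        finally show ?thesis unfolding that(3) .
      qed
      show ?case unfolding sum.atMost_Suc ring_distribs(1) by (rule aux[OF Suc.IH 1 2])
    qed
    hence "F j * (1 + ?X ^ Suc j) =
        (1 + a * ?X ^ Suc j) * F (Suc j) - x j ^ Suc N * (c N * (1 - a * ?X ^ N))"
      unfolding F_def by (auto simp: x_def algebra_simps)
    moreover have "x j ^ Suc N * (c N * (1 - a * ?X ^ N)) =
        ?X ^ (Suc j * Suc N) * ((-1) ^ Suc N * (c N * (1 - a * ?X ^ N)))"
      unfolding x_def power_minus[of "?X ^ Suc j"] power_mult by (simp only: mult_ac)
    moreover have "fps_eq_upto N (?X ^ (Suc j * Suc N) * ((-1) ^ Suc N * (c N * (1 - a * ?X ^ N)))) 0"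
      by (rule fps_eq_upto_X_power) auto
    ultimately show ?thesis by (simp add: fps_eq_upto_def)
  qed
  have "fps_eq_upto N (F 0 * (\<Prod>k=1..J. 1 + ?X ^ k)) ((\<Prod>k=1..J. 1 + a * ?X ^ k) * F J)" for J
  proof (induction J)
    case (Suc J)
    have "F 0 * (\<Prod>k=1..Suc J. 1 + ?X ^ k) = (F 0 * (\<Prod>k=1..J. 1 + ?X ^ k)) * (1 + ?X ^ Suc J)"
      by (simp add: mult_ac)
    also have "fps_eq_upto N \<dots> (((\<Prod>k=1..J. 1 + a * ?X ^ k) * F J) * (1 + ?X ^ Suc J))"
      by (intro fps_eq_upto_mult Suc.IH fps_eq_upto_refl)
    also have "\<dots> = (\<Prod>k=1..J. 1 + a * ?X ^ k) * (F J * (1 + ?X ^ Suc J))" by (simp only: mult_ac)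
    also have "fps_eq_upto N \<dots> ((\<Prod>k=1..J. 1 + a * ?X ^ k) * ((1 + a * ?X ^ Suc J) * F (Suc J)))"
      by (intro fps_eq_upto_mult step fps_eq_upto_refl)
    also have "\<dots> = (\<Prod>k=1..Suc J. 1 + a * ?X ^ k) * F (Suc J)" by (simp add: mult_ac)
    finally show ?case .
  qed simp
  note this[of N]
  \<comment> \<open>At x = -q^(N+1) all terms of F except the constant one have degree above
    N.\<close>
  also have "fps_eq_upto N ((\<Prod>k=1..N. 1 + a * ?X ^ k) * F N) ((\<Prod>k=1..N. 1 + a * ?X ^ k) * 1)"
  proof (intro fps_eq_upto_mult fps_eq_upto_refl)
    have "F N = 1 + (\<Sum>w\<in>{1..N}. c w * x N ^ w)"
      by (simp add: F_def c0 atMost_atLeast0 sum.atLeast_Suc_atMost)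
    also have "(\<Sum>w\<in>{1..N}. c w * x N ^ w) = (\<Sum>w\<in>{1..N}. ?X ^ (Suc N * w) * ((-1) ^ w * c w))"
      unfolding x_def power_minus[of "?X ^ Suc N"] power_mult by (simp only: mult_ac)
    also have "fps_eq_upto N (1 + \<dots>) (1 + (\<Sum>w\<in>{1..N}. 0))"
    proof (intro fps_eq_upto_add fps_eq_upto_sum fps_eq_upto_refl fps_eq_upto_X_power)
      fix w assume "w \<in> {1..N}"
      hence "Suc N * 1 \<le> Suc N * w" by (intro mult_le_mono) auto
      thus "N < Suc N * w" by simp
    qed
    finally show "fps_eq_upto N (F N) 1" by simp
  qed
  finally show ?thesis by (simp add: F_def x_def)
qed

section \<open>Signed crank counts split by the number of ones\<close>

definition crank_diff :: "nat \<Rightarrow> int" where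
  "crank_diff n = int (M\<^sub>0 n) - int (M\<^sub>1 n)"

definition parity_sign :: "int \<Rightarrow> int" where
  "parity_sign c = (if even c then 1 else -1)"

lemma parity_sign_diff: "parity_sign (int a - int b) = (-1) ^ a * (-1) ^ b"
  by (auto simp: parity_sign_def)

lemma parity_sign_of_nat: "parity_sign (int a) = (-1) ^ a"
  by (auto simp: parity_sign_def)

lemma crank_diff_eq_sum: "crank_diff n = (\<Sum>L\<in>partitions n. parity_sign (crank L))"
proof -
  have "(\<Sum>L\<in>partitions n. parity_sign (crank L)) =
        (\<Sum>L\<in>{L\<in>partitions n. even (crank L)}. 1) + (\<Sum>L\<in>{L\<in>partitions n. odd (crank L)}. -1)"
    unfolding parity_sign_def by (subst sum.If_cases) (simp_all add: finite_partitions Int_def)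
  thus ?thesis by (simp add: crank_diff_def M\<^sub>0_def M\<^sub>1_def)
qed

lemma M_sum: "M\<^sub>0 n + M\<^sub>1 n = card (partitions n)"
proof -
  have "card {L \<in> partitions n. even (crank L)} + card {L \<in> partitions n. odd (crank L)} =
        card ({L \<in> partitions n. even (crank L)} \<union> {L \<in> partitions n. odd (crank L)})"
    by (subst card_Un_disjoint) (auto simp: finite_partitions)
  also have "{L \<in> partitions n. even (crank L)} \<union> {L \<in> partitions n. odd (crank L)} = partitions n"
    by auto
  finally show ?thesis by (simp add: M\<^sub>0_def M\<^sub>1_def)
qed

lemma partitions_with_ones:
  assumes "n \<le> N" "w \<le> n"
  shows "{L\<in>partitions n. num_ones L = w} = (\<lambda>L. L + replicate_mset w 1) ` parts_in {2..N} (n - w)"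
proof (intro equalityI subsetI)
  fix L assume L: "L \<in> {L\<in>partitions n. num_ones L = w}"
  define L' where "L' = filter_mset (\<lambda>x. x \<noteq> 1) L"
  have eq: "L = L' + replicate_mset w 1"
    using L by (auto simp: multiset_eq_iff L'_def num_ones_def)
  have sum: "sum_mset L = n" and "0 \<notin># L" using L by (simp_all add: partitions_def)
  have "x \<in> {2..N}" if "x \<in># L'" for x
  proof -
    have "x \<in># L" "x \<noteq> 1" using that by (simp_all add: L'_def)
    moreover have "x \<noteq> 0" using \<open>x \<in># L\<close> \<open>0 \<notin># L\<close> by metis
    ultimately show ?thesis using part_le_sum_mset[of x L] sum assms by simp
  qed
  moreover have "sum_mset L' = n - w" using sum by (subst (asm) eq) simp
  ultimately have "L' \<in> parts_in {2..N} (n - w)" by (auto simp: parts_in_def)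
  thus "L \<in> (\<lambda>L. L + replicate_mset w 1) ` parts_in {2..N} (n - w)"
    using eq by blast
next
  fix L assume "L \<in> (\<lambda>L. L + replicate_mset w 1) ` parts_in {2..N} (n - w)"
  then obtain L' where L: "L = L' + replicate_mset w 1" and L': "set_mset L' \<subseteq> {2..N}" "sum_mset L' = n - w"
    by (auto simp: parts_in_def)
  have "0 \<notin># L'" "1 \<notin># L'" using L'(1) by auto
  thus "L \<in> {L\<in>partitions n. num_ones L = w}"
    using assms L'(2) by (simp add: partitions_def num_ones_def L not_in_iff)
qed

text \<open>A multiplicative weight whose product over a partition is the sign belonging to the
  number of parts above w.\<close>

definition sign_above :: "nat \<Rightarrow> nat \<Rightarrow> int" where
  "sign_above w x = (if w < x then -1 else 1)"

lemma prod_sign_above: "(\<Prod>x\<in>#L. sign_above w x) = (-1) ^ size {#x\<in>#L. w < x#}"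
  by (induction L) (auto simp: sign_above_def)

text \<open>For w > 0 the w ones are not themselves above w, so the crank is the number of large
  parts among the remaining ones minus w, and its sign splits into \<open>(-1) ^ w\<close> and the
  weight \<open>sign_above\<close>.\<close>

lemma sum_crank_with_ones:
  assumes "n \<le> N" "1 \<le> w" "w \<le> n"
  shows "(\<Sum>L | L \<in> partitions n \<and> num_ones L = w. parity_sign (crank L)) =
         (-1) ^ w * fps_nth (parts_gf (sign_above w) {2..N}) (n - w)"
proof -
  have "(\<Sum>L | L \<in> partitions n \<and> num_ones L = w. parity_sign (crank L)) =
        (\<Sum>L\<in>parts_in {2..N} (n - w). parity_sign (crank (L + replicate_mset w 1)))"
    unfolding partitions_with_ones[OF assms(1,3)]
    by (subst sum.reindex) (simp_all add: inj_on_def)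
  also have "\<dots> = (\<Sum>L\<in>parts_in {2..N} (n - w). (-1) ^ w * (\<Prod>x\<in>#L. sign_above w x))"
  proof (intro sum.cong refl)
    fix L assume "L \<in> parts_in {2..N} (n - w)"
    hence "1 \<notin># L" by (auto simp: parts_in_def)
    hence ones: "num_ones (L + replicate_mset w 1) = w"
      by (simp add: num_ones_def not_in_iff)
    have none: "{#x\<in>#replicate_mset w 1. w < x#} = {#}"
      using assms by (simp add: filter_mset_eq_conv)
    have "num_parts_above_ones (L + replicate_mset w 1) = size {#x\<in>#L. w < x#}"
      unfolding num_parts_above_ones_def ones filter_union_mset none by simp
    thus "parity_sign (crank (L + replicate_mset w 1)) = (-1) ^ w * (\<Prod>x\<in>#L. sign_above w x)"
      using assms(2) ones
      by (simp add: crank_def parity_sign_diff prod_sign_above)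
  qed
  finally show ?thesis by (simp add: parts_gf_def sum_distrib_left)
qed

text \<open>Induction on the bound: a partition that uses the new part \<open>Suc N\<close> has this
  maximum whatever its other parts are, so removing one copy leaves an arbitrary partition into
  parts from 2 to \<open>Suc N\<close>.\<close>

lemma sum_Max_parts_in:
  assumes "n > 0" "1 \<le> N"
  shows "(\<Sum>L\<in>parts_in {2..N} n. (-1) ^ Max_mset L) =
         (\<Sum>m=2..N. if m \<le> n then (-1) ^ m * fps_nth (parts_gf1 {2..m}) (n - m) else 0)"
  using assms(2)
proof (induction N rule: dec_induct)
  case base
  have "parts_in {2..1} n = {}" using assms(1) by (auto simp: parts_in_def)
  thus ?case by simp
next
  case (step N)
  have ins: "{2..Suc N} = insert (Suc N) {2..N}" using step.hyps by auto
  have "(\<Sum>L\<in>parts_in (insert (Suc N) {2..N}) n. (-1::int) ^ Max_mset L) =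
      (\<Sum>L\<in>parts_in {2..N} n. (-1) ^ Max_mset L) +
      (if Suc N \<le> n then \<Sum>L\<in>parts_in (insert (Suc N) {2..N}) (n - Suc N). (-1) ^ Max_mset (add_mset (Suc N) L) else 0)"
    by (rule sum_parts_in_insert) auto
  also have "(\<Sum>L\<in>parts_in (insert (Suc N) {2..N}) (n - Suc N). (-1::int) ^ Max_mset (add_mset (Suc N) L)) =
      (\<Sum>L\<in>parts_in {2..Suc N} (n - Suc N). (-1) ^ Suc N)"
    unfolding ins
  proof (intro sum.cong refl)
    fix L assume "L \<in> parts_in (insert (Suc N) {2..N}) (n - Suc N)"
    hence "set_mset L \<subseteq> {..Suc N}" by (auto simp: parts_in_def)
    hence "Max_mset (add_mset (Suc N) L) = Suc N"
      by (intro Max_eqI) auto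
    thus "(-1::int) ^ Max_mset (add_mset (Suc N) L) = (-1) ^ Suc N" by simp
  qed
  also have "\<dots> = (-1) ^ Suc N * fps_nth (parts_gf1 {2..Suc N}) (n - Suc N)"
    by (simp add: parts_gf_def)
  finally show ?case using step.IH step.hyps by (simp flip: ins)
qed

lemma sum_crank_without_ones:
  assumes "0 < n" "n \<le> N"
  shows "(\<Sum>L | L \<in> partitions n \<and> num_ones L = 0. parity_sign (crank L)) =
         (\<Sum>m=2..N. if m \<le> n then (-1) ^ m * fps_nth (parts_gf1 {2..m}) (n - m) else 0)"
proof -
  have "(\<Sum>L | L \<in> partitions n \<and> num_ones L = 0. parity_sign (crank L)) =
        (\<Sum>L\<in>parts_in {2..N} n. parity_sign (crank L))"
    using partitions_with_ones[OF assms(2), of 0] by simp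
  also have "\<dots> = (\<Sum>L\<in>parts_in {2..N} n. (-1) ^ Max_mset L)"
  proof (intro sum.cong refl)
    fix L assume "L \<in> parts_in {2..N} n"
    hence "1 \<notin># L" "L \<noteq> {#}" using assms by (auto simp: parts_in_def)
    thus "parity_sign (crank L) = (-1) ^ Max_mset L"
      by (simp add: crank_def num_ones_def not_in_iff parity_sign_of_nat)
  qed
  also have "\<dots> = (\<Sum>m=2..N. if m \<le> n then (-1) ^ m * fps_nth (parts_gf1 {2..m}) (n - m) else 0)"
    using assms by (intro sum_Max_parts_in) auto
  finally show ?thesis .
qed

lemma minus_X_power_mult_nth:
  "fps_nth ((- fps_X) ^ m * f) n = (if m \<le> n then (-1) ^ m * fps_nth f (n - m) else 0)"
  for f :: "int fps"
proof -
  have sign: "(-1 :: int fps) ^ m = fps_const ((-1) ^ m)"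
    by (metis fps_const_1_eq_1 fps_const_neg fps_const_power)
  have "(- fps_X) ^ m * f = fps_const ((-1) ^ m) * (fps_X ^ m * f)"
    unfolding power_minus[of fps_X] sign by (simp only: mult.assoc)
  thus ?thesis by (simp only: fps_mult_left_const_nth fps_X_power_mult_nth) simp
qed

lemma crank_diff_nth:
  assumes "0 < n" "n \<le> N"
  shows "crank_diff n = fps_nth ((\<Sum>m=2..N. (- fps_X) ^ m * parts_gf1 {2..m}) +
           (\<Sum>w=1..N. (- fps_X) ^ w * parts_gf (sign_above w) {2..N})) n"
proof -
  have le: "num_ones L \<le> n" if "L \<in> partitions n" for L
  proof -
    have "count L 1 \<le> sum_mset L" for L :: "nat multiset"
      by (induction L) auto
    thus ?thesis using that by (auto simp: num_ones_def partitions_def)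
  qed
  have "crank_diff n = (\<Sum>w\<in>{0..n}. \<Sum>L | L \<in> partitions n \<and> num_ones L = w. parity_sign (crank L))"
    unfolding crank_diff_eq_sum
    by (rule sum.group[symmetric]) (use le in \<open>auto simp: finite_partitions\<close>)
  also have "\<dots> = (\<Sum>L | L \<in> partitions n \<and> num_ones L = 0. parity_sign (crank L)) +
      (\<Sum>w\<in>{1..n}. \<Sum>L | L \<in> partitions n \<and> num_ones L = w. parity_sign (crank L))"
    by (simp add: sum.atLeast_Suc_atMost)
  also have "(\<Sum>w\<in>{1..n}. \<Sum>L | L \<in> partitions n \<and> num_ones L = w. parity_sign (crank L)) =
      (\<Sum>w\<in>{1..n}. fps_nth ((- fps_X) ^ w * parts_gf (sign_above w) {2..N}) n)"
    using assms by (intro sum.cong refl) (simp add: sum_crank_with_ones minus_X_power_mult_nth)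
  also have "\<dots> = (\<Sum>w\<in>{1..N}. fps_nth ((- fps_X) ^ w * parts_gf (sign_above w) {2..N}) n)"
    using assms by (intro sum.mono_neutral_left) (auto simp: minus_X_power_mult_nth)
  finally show ?thesis
    using sum_crank_without_ones[OF assms] by (simp add: fps_sum_nth minus_X_power_mult_nth)
qed

section \<open>Evaluation of both contributions by the q-binomial theorem\<close>

definition qpoch :: "nat \<Rightarrow> int fps" where
  "qpoch N = (\<Prod>k=1..N. 1 - fps_X ^ k)"

definition qpoch_plus :: "nat \<Rightarrow> int fps" where
  "qpoch_plus N = (\<Prod>k=1..N. 1 + fps_X ^ k)"

text \<open>The q-binomial theorem with a = 0, where \<open>c w\<close> is 1 / (q;q)_w. The
  polynomial \<open>1 - 2 * fps_X\<close> supplies the terms m = 0 and m = 1, which no partition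
  without ones contributes.\<close>

lemma sum_max_gf_upto:
  assumes "1 \<le> N"
  shows "fps_eq_upto N (((\<Sum>m=2..N. (- fps_X) ^ m * parts_gf1 {2..m}) + 1 - 2 * fps_X) * qpoch_plus N)
           (1 - fps_X)"
proof -
  let ?X = "fps_X :: int fps"
  define c where "c = (\<lambda>w. parts_gf1 {1..w})"
  define F where "F = (\<Sum>w\<le>N. c w * (- ?X) ^ w)"
  have c0: "c 0 = 1"
    using parts_gf1_mult_prod[of 1 0] by (simp add: c_def)
  have c_Suc: "c (Suc w) * (1 - ?X ^ Suc w) = c w" for w
    using parts_gf_insert[of "Suc w" "{1..w}" "\<lambda>_. 1"] by (simp add: c_def atLeastAtMostSuc_conv)
  have bin: "fps_eq_upto N (F * qpoch_plus N) 1"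
    using q_binomial_upto[of c 0 N] c0 c_Suc by (simp add: F_def qpoch_plus_def)
  have c_eq: "(1 - ?X) * c m = parts_gf1 {2..m}" if "1 \<le> m" for m
    using parts_gf_insert[of 1 "{2..m}" "\<lambda>_. 1"] that
    by (simp add: c_def mult.commute numeral_2_eq_2 flip: atLeastAtMost_insertL)
  have "(\<Sum>m=2..N. (- ?X) ^ m * parts_gf1 {2..m}) = (1 - ?X) * (\<Sum>m=2..N. c m * (- ?X) ^ m)"
    unfolding sum_distrib_left by (intro sum.cong refl) (simp flip: c_eq add: mult_ac)
  also have "(\<Sum>m=2..N. c m * (- ?X) ^ m) = F - 1 + c 1 * ?X"
    using assms
    by (simp add: F_def c0 atMost_atLeast0 sum.atLeast_Suc_atMost numeral_2_eq_2)
  also have "(1 - ?X) * (F - 1 + c 1 * ?X) = (1 - ?X) * F - (1 - ?X) + ((1 - ?X) * c 1) * ?X"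
    by (simp add: algebra_simps)
  also have "(1 - ?X) * c 1 = 1" using c_Suc[of 0] by (simp add: c0 mult.commute)
  finally have eq: "(\<Sum>m=2..N. (- ?X) ^ m * parts_gf1 {2..m}) = (1 - ?X) * F - (1 - ?X) + 1 * ?X" .
  have "((\<Sum>m=2..N. (- ?X) ^ m * parts_gf1 {2..m}) + 1 - 2 * ?X) * qpoch_plus N =
      (1 - ?X) * (F * qpoch_plus N)" unfolding eq by (simp add: algebra_simps)
  also have "fps_eq_upto N \<dots> ((1 - ?X) * 1)"
    by (intro fps_eq_upto_mult bin fps_eq_upto_refl)
  finally show ?thesis by simp
qed

text \<open>The q-binomial theorem with a = -q, where \<open>c w\<close> is (-q;q)_w / (q;q)_w. The
  term w = 0 is absent from the sum, which accounts for the subtracted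
  \<open>(1 - fps_X) * qpoch_plus N\<close>.\<close>

lemma sum_ones_gf_upto:
  "fps_eq_upto N ((\<Sum>w=1..N. (- fps_X) ^ w * parts_gf (sign_above w) {2..N}) * qpoch_plus N ^ 2)
     (qpoch N - (1 - fps_X) * qpoch_plus N)"
proof -
  let ?X = "fps_X :: int fps"
  define c where "c = (\<lambda>w. parts_gf1 {1..w} * qpoch_plus w)"
  define F where "F = (\<Sum>w\<le>N. c w * (- ?X) ^ w)"
  have c0: "c 0 = 1"
    using parts_gf1_mult_prod[of 1 0] by (simp add: c_def qpoch_plus_def)
  have c_Suc: "c (Suc w) * (1 - ?X ^ Suc w) = c w * (1 - (- ?X) * ?X ^ w)" for w
  proof -
    have "parts_gf1 {1..Suc w} * (1 - ?X ^ Suc w) = parts_gf1 {1..w}"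
      using parts_gf_insert[of "Suc w" "{1..w}" "\<lambda>_. 1"] by (simp add: atLeastAtMostSuc_conv)
    hence "c (Suc w) * (1 - ?X ^ Suc w) = parts_gf1 {1..w} * qpoch_plus (Suc w)"
      by (simp add: c_def mult_ac)
    thus ?thesis by (simp add: c_def qpoch_plus_def mult_ac)
  qed
  have bin: "fps_eq_upto N (F * qpoch_plus N) (\<Prod>k=1..N. 1 - ?X ^ Suc k)"
    using q_binomial_upto[of c "- ?X" N] c0 c_Suc by (simp add: F_def qpoch_plus_def)
  \<comment> \<open>The factor \<open>1 - ?X\<close> completes the shifted product to
    \<open>qpoch (Suc N)\<close>, which agrees with \<open>qpoch N\<close> up to degree N.\<close>
  have shift: "fps_eq_upto N ((1 - ?X) * (\<Prod>k=1..N. 1 - ?X ^ Suc k)) (qpoch N)"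
  proof -
    have "(1 - ?X) * (\<Prod>k=1..N. 1 - ?X ^ Suc k) = qpoch (Suc N)"
      unfolding qpoch_def by (induction N) (simp_all flip: mult.assoc)
    also have "\<dots> = qpoch N - ?X ^ Suc N * qpoch N" by (simp add: qpoch_def algebra_simps)
    also have "fps_eq_upto N \<dots> (qpoch N - 0)"
      by (intro fps_eq_upto_diff fps_eq_upto_X_power) auto
    finally show ?thesis by simp
  qed
  \<comment> \<open>Parts up to w have weight 1 and larger parts weight -1, so the generating
    function is the reciprocal of factors \<open>1 - ?X ^ k\<close> for 2 <= k <= w and
    \<open>1 + ?X ^ k\<close> beyond. The latter cancel against part of
    \<open>qpoch_plus N\<close>.\<close>
  have gf: "parts_gf (sign_above w) {2..N} * qpoch_plus N = (1 - ?X) * c w" if w: "1 \<le> w" "w \<le> N" for w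
  proof -
    define H where "H = (\<Prod>k\<in>{w<..N}. 1 + ?X ^ k)"
    have *: "1 - fps_const (sign_above w k) * ?X ^ k = (if k \<le> w then 1 - ?X ^ k else 1 + ?X ^ k)" for k
      by (simp add: sign_above_def flip: fps_const_neg)
    have "(\<Prod>k\<in>{2..N}. 1 - fps_const (sign_above w k) * ?X ^ k) =
        (\<Prod>k\<in>{2..w} \<union> {w<..N}. if k \<le> w then 1 - ?X ^ k else 1 + ?X ^ k)"
      unfolding * using w by (intro prod.cong) auto
    also have "\<dots> = (\<Prod>k\<in>{2..w}. 1 - ?X ^ k) * H"
      unfolding H_def by (subst prod.union_disjoint) (auto intro!: arg_cong2[of _ _ _ _ "(*)"] prod.cong)
    finally have 1: "parts_gf (sign_above w) {2..N} * ((\<Prod>k\<in>{2..w}. 1 - ?X ^ k) * H) = 1"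
      using parts_gf_mult_prod[of "{2..N}" "sign_above w"] by simp
    have 2: "qpoch_plus N = qpoch_plus w * H"
    proof -
      have "qpoch_plus N = (\<Prod>k\<in>{1..w} \<union> {w<..N}. 1 + ?X ^ k)"
        unfolding qpoch_plus_def using w by (intro prod.cong) auto
      thus ?thesis unfolding qpoch_plus_def H_def by (subst (asm) prod.union_disjoint) auto
    qed
    have 3: "parts_gf1 {1..w} * ((1 - ?X) * (\<Prod>k\<in>{2..w}. 1 - ?X ^ k)) = 1"
      using parts_gf1_mult_prod[of 1 w] w by (simp add: prod.atLeast_Suc_atMost numeral_2_eq_2)
    have "parts_gf (sign_above w) {2..N} * qpoch_plus N =
        parts_gf (sign_above w) {2..N} * (qpoch_plus w * H) * (parts_gf1 {1..w} * ((1 - ?X) * (\<Prod>k\<in>{2..w}. 1 - ?X ^ k)))"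
      unfolding 2 3 by simp
    also have "\<dots> = (parts_gf (sign_above w) {2..N} * ((\<Prod>k\<in>{2..w}. 1 - ?X ^ k) * H)) *
        ((1 - ?X) * c w)"
      unfolding c_def by (simp only: mult_ac)
    finally show ?thesis unfolding 1 by simp
  qed
  have "(\<Sum>w=1..N. (- ?X) ^ w * parts_gf (sign_above w) {2..N}) * qpoch_plus N = (1 - ?X) * (\<Sum>w=1..N. c w * (- ?X) ^ w)"
    unfolding sum_distrib_left sum_distrib_right
  proof (intro sum.cong refl)
    fix w assume "w \<in> {1..N}"
    hence "(- ?X) ^ w * (parts_gf (sign_above w) {2..N} * qpoch_plus N) = (- ?X) ^ w * ((1 - ?X) * c w)"
      using gf[of w] by simp
    thus "(- ?X) ^ w * parts_gf (sign_above w) {2..N} * qpoch_plus N = (1 - ?X) * (c w * (- ?X) ^ w)"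
      by (simp only: mult_ac)
  qed
  also have "(\<Sum>w=1..N. c w * (- ?X) ^ w) = F - 1"
    by (simp add: F_def c0 atMost_atLeast0 sum.atLeast_Suc_atMost)
  finally have eq: "(\<Sum>w=1..N. (- ?X) ^ w * parts_gf (sign_above w) {2..N}) * qpoch_plus N = (1 - ?X) * (F - 1)" .
  have "(\<Sum>w=1..N. (- ?X) ^ w * parts_gf (sign_above w) {2..N}) * qpoch_plus N ^ 2 =
      (1 - ?X) * (F * qpoch_plus N) - (1 - ?X) * qpoch_plus N"
    unfolding power2_eq_square mult.assoc[symmetric] eq by (simp add: algebra_simps)
  also have "fps_eq_upto N \<dots> ((1 - ?X) * (\<Prod>k=1..N. 1 - ?X ^ Suc k) - (1 - ?X) * qpoch_plus N)"
    by (intro fps_eq_upto_diff fps_eq_upto_mult bin fps_eq_upto_refl)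
  also have "fps_eq_upto N \<dots> (qpoch N - (1 - ?X) * qpoch_plus N)"
    by (intro fps_eq_upto_diff shift fps_eq_upto_refl)
  finally show ?thesis .
qed

text \<open>The only partition of 1 gives \<open>crank_diff 1 = - 1\<close>, but (q;q) / (-q;q)^2
  has coefficient -3 there. At every other index, 0 included, the value is the true crank
  difference.\<close>

definition crank_gf :: "int fps" where
  "crank_gf = Abs_fps (\<lambda>n. if n = 0 then 1 else if n = 1 then - 3 else crank_diff n)"

text \<open>Adding \<open>1 - 2 * fps_X\<close> to the two contributions changes only the
  coefficients at 0 and 1, to the values prescribed in \<open>crank_gf\<close>. Then the terms
  \<open>(1 - fps_X) * qpoch_plus N\<close> cancel.\<close>

lemma crank_gf_upto:
  assumes "1 \<le> N"
  shows "fps_eq_upto N (crank_gf * qpoch_plus N ^ 2) (qpoch N)"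
proof -
  let ?X = "fps_X :: int fps"
  let ?S1 = "\<Sum>m=2..N. (- ?X) ^ m * parts_gf1 {2..m}"
  let ?S2 = "\<Sum>w=1..N. (- ?X) ^ w * parts_gf (sign_above w) {2..N}"
  have "fps_eq_upto N crank_gf (?S1 + ?S2 + 1 - 2 * ?X)"
    unfolding fps_eq_upto_def
  proof safe
    fix n assume n: "n \<le> N"
    consider "n = 0" | "n = 1" | "n \<ge> 2" by linarith
    thus "fps_nth crank_gf n = fps_nth (?S1 + ?S2 + 1 - 2 * ?X) n"
    proof cases
      case 1
      have "fps_nth ((- ?X) ^ k * f) 0 = 0" if "k \<ge> 1" for k f
        using that by (subst minus_X_power_mult_nth) auto
      hence "fps_nth ?S1 0 = 0" "fps_nth ?S2 0 = 0"
        unfolding fps_sum_nth by (intro sum.neutral ballI; force)+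
      thus ?thesis using 1 by (simp add: crank_gf_def)
    next
      case 2
      have nth: "fps_nth (\<Sum>w=1..N. (- ?X) ^ w * parts_gf (sign_above w) {2..N}) 1 =
          - fps_nth (parts_gf (sign_above 1) {2..N}) 0"
        unfolding fps_sum_nth minus_X_power_mult_nth using assms by (simp add: sum.atLeast_Suc_atMost)
      have "fps_nth (parts_gf (sign_above 1) {2..N} * (\<Prod>k\<in>{2..N}. 1 - fps_const (sign_above 1 k) * ?X ^ k)) 0 = 1"
        by (subst parts_gf_mult_prod) auto
      moreover have "fps_nth (\<Prod>k\<in>{2..N}. 1 - fps_const (sign_above 1 k) * ?X ^ k) 0 = 1"
        by (simp add: fps_prod_nth')
      ultimately have "fps_nth (parts_gf (sign_above 1) {2..N}) 0 = 1" by simp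
      moreover have "fps_nth ?S1 1 = 0"
        unfolding fps_sum_nth minus_X_power_mult_nth by (intro sum.neutral) auto
      ultimately have "fps_nth (?S1 + ?S2 + 1 - 2 * ?X) 1 = - 3"
        unfolding fps_add_nth fps_sub_nth nth by simp
      thus ?thesis unfolding 2 by (simp add: crank_gf_def)
    next
      case 3
      hence "fps_nth crank_gf n = crank_diff n" by (simp add: crank_gf_def)
      also have "\<dots> = fps_nth (?S1 + ?S2) n"
        using crank_diff_nth[of n N] 3 n by simp
      also have "\<dots> = fps_nth (?S1 + ?S2 + 1 - 2 * ?X) n"
        using 3 by (simp add: fps_numeral_nth)
      finally show ?thesis .
    qed
  qed
  hence "fps_eq_upto N (crank_gf * qpoch_plus N ^ 2) ((?S1 + ?S2 + 1 - 2 * ?X) * qpoch_plus N ^ 2)"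
    by (intro fps_eq_upto_mult fps_eq_upto_refl)
  also have "(?S1 + ?S2 + 1 - 2 * ?X) * qpoch_plus N ^ 2 =
      ((?S1 + 1 - 2 * ?X) * qpoch_plus N) * qpoch_plus N + ?S2 * qpoch_plus N ^ 2"
    by (simp add: algebra_simps power2_eq_square)
  also have "fps_eq_upto N \<dots> ((1 - ?X) * qpoch_plus N + (qpoch N - (1 - ?X) * qpoch_plus N))"
    by (intro fps_eq_upto_add fps_eq_upto_mult sum_max_gf_upto sum_ones_gf_upto assms fps_eq_upto_refl)
  finally show ?thesis by simp
qed

section \<open>Pentagonal series, theta series and the product over odd exponents\<close>

text \<open>The pentagonal numbers k(3k-1)/2 and k(3k+1)/2, written without division and in the form
  that Shanks' identity delivers.\<close>

definition pent_fps :: "nat \<Rightarrow> int fps" where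
  "pent_fps N = 1 + (\<Sum>k=1..N. (-1) ^ k * (fps_X ^ (k\<^sup>2 + triangle (k - 1)) + fps_X ^ (k\<^sup>2 + triangle k)))"

definition pent2_fps :: "nat \<Rightarrow> int fps" where
  "pent2_fps N = 1 + (\<Sum>k=1..N. (-1) ^ k * (fps_X ^ (2 * (k\<^sup>2 + triangle (k - 1))) + fps_X ^ (2 * (k\<^sup>2 + triangle k))))"

definition theta_fps :: "nat \<Rightarrow> int fps" where
  "theta_fps N = 1 + 2 * (\<Sum>k=1..N. (-1) ^ k * fps_X ^ (k\<^sup>2))"

definition qpoch_odd :: "nat \<Rightarrow> int fps" where
  "qpoch_odd N = (\<Prod>k | k \<in> {1..N} \<and> odd k. 1 - fps_X ^ k)"

lemma qpoch_plus_nth_0 [simp]: "fps_nth (qpoch_plus N) 0 = 1"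
  by (simp add: qpoch_plus_def fps_prod_nth')

lemma prod_pentagonal_upto:
  assumes "m > 0"
  shows "fps_eq_upto N (\<Prod>k=1..N. 1 - (fps_X ^ m) ^ k :: int fps)
     (1 + (\<Sum>k=1..N. (-1) ^ k * ((fps_X ^ m) ^ (k\<^sup>2 + triangle (k - 1)) + (fps_X ^ m) ^ (k\<^sup>2 + triangle k))))"
proof -
  let ?q = "fps_X ^ m :: int fps"
  let ?f = "\<lambda>s. (-1) ^ s * (\<Prod>k\<in>{s<..N}. 1 - ?q ^ k) * ?q ^ (s * N + triangle s)"
  have "(\<Sum>s\<le>N. ?f s) = ?f 0 + (\<Sum>s\<in>{1..N}. ?f s)"
    unfolding atMost_atLeast0 by (subst sum.atLeast_Suc_atMost) simp_all
  moreover have "fps_eq_upto N (\<Sum>s\<in>{1..N}. ?f s) (\<Sum>s\<in>{1..N}. 0)"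
  proof (rule fps_eq_upto_sum)
    fix s assume s: "s \<in> {1..N}"
    have "N < s * N + triangle s"
    proof -
      have "1 * N \<le> s * N" using s by (intro mult_le_mono) auto
      moreover have "triangle s > 0" using s by (cases s) auto
      ultimately show ?thesis by linarith
    qed
    also have "s * N + triangle s \<le> m * (s * N + triangle s)" using assms by simp
    finally have "fps_eq_upto N (fps_X ^ (m * (s * N + triangle s)) * ((-1) ^ s * (\<Prod>k\<in>{s<..N}. 1 - ?q ^ k))) 0"
      by (rule fps_eq_upto_X_power)
    thus "fps_eq_upto N (?f s) 0" by (simp only: power_mult mult_ac)
  qed
  ultimately have "fps_eq_upto N (\<Sum>s\<le>N. ?f s) (?f 0 + 0)"
    by (simp add: fps_eq_upto_def)
  moreover have "?f 0 = (\<Prod>k=1..N. 1 - ?q ^ k)"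
    by (simp add: atLeastSucAtMost_greaterThanAtMost)
  ultimately have "fps_eq_upto N (\<Sum>s\<le>N. ?f s) (\<Prod>k=1..N. 1 - ?q ^ k)" by simp
  thus ?thesis
    unfolding shanks_pentagonal by (rule fps_eq_upto_sym)
qed

lemma qpoch_upto_pent: "fps_eq_upto N (qpoch N) (pent_fps N)"
  using prod_pentagonal_upto[of 1 N] by (simp add: qpoch_def pent_fps_def)

lemma qpoch_mult_qpoch_plus: "qpoch N * qpoch_plus N = (\<Prod>k=1..N. 1 - fps_X ^ (2 * k))"
  unfolding qpoch_def qpoch_plus_def prod.distrib[symmetric]
  by (intro prod.cong refl) (simp only: mult_2 power_add ring_distribs mult_1_left mult_1_right, simp)

lemma qpoch_mult_qpoch_plus_upto_pent2: "fps_eq_upto N (qpoch N * qpoch_plus N) (pent2_fps N)"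
  using prod_pentagonal_upto[of 2 N]
  unfolding qpoch_mult_qpoch_plus pent2_fps_def power_mult[symmetric] by simp

lemma theta_upto: "fps_eq_upto N (qpoch_plus N * theta_fps N) (qpoch N)"
proof -
  let ?X = "fps_X :: int fps"
  let ?f = "\<lambda>s. (-1) ^ s * ?X ^ (s * Suc N) * ((\<Prod>k\<in>{0<..<s}. 1 + ?X ^ k) * (\<Prod>k\<in>{s<..N}. 1 - ?X ^ k))"
  have "fps_eq_upto N (\<Sum>s\<in>{1..N}. ?f s) (\<Sum>s\<in>{1..N}. 0)"
  proof (rule fps_eq_upto_sum)
    fix s assume s: "s \<in> {1..N}"
    have "1 * Suc N \<le> s * Suc N" using s by (intro mult_le_mono) auto
    hence "fps_eq_upto N (?X ^ (s * Suc N) * ((-1) ^ s * ((\<Prod>k\<in>{0<..<s}. 1 + ?X ^ k) * (\<Prod>k\<in>{s<..N}. 1 - ?X ^ k)))) 0"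
      by (intro fps_eq_upto_X_power) simp
    thus "fps_eq_upto N (?f s) 0" by (simp only: mult_ac)
  qed
  hence "fps_eq_upto N (qpoch N + 2 * (\<Sum>s\<in>{1..N}. ?f s)) (qpoch N + 2 * 0)"
    by (intro fps_eq_upto_add fps_eq_upto_mult fps_eq_upto_refl) simp
  thus ?thesis
    unfolding qpoch_def qpoch_plus_def theta_fps_def shanks_gauss by simp
qed

text \<open>Euler's identity between distinct and odd parts: (q;q) (-q;q) = (q^2;q^2), and
  cancelling the even factors of (q;q) leaves the odd ones. Factors of higher degree than N are
  congruent to 1.\<close>

lemma qpoch_plus_mult_odd_upto: "fps_eq_upto N (qpoch_plus N * qpoch_odd N) 1"
proof -
  let ?X = "fps_X :: int fps"
  let ?Ev = "\<Prod>k=1..N div 2. 1 - ?X ^ (2 * k)"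
  have "{k\<in>{1..N}. even k} = (*) 2 ` {1..N div 2}"
    by (auto simp: image_iff elim!: evenE intro!: bexI[of _ "_ div 2"])
  hence ev: "(\<Prod>k | k \<in> {1..N} \<and> even k. 1 - ?X ^ k) = ?Ev"
    by (simp add: prod.reindex inj_on_def)
  have "qpoch N = (\<Prod>k\<in>{k. k \<in> {1..N} \<and> odd k} \<union> {k. k \<in> {1..N} \<and> even k}. 1 - ?X ^ k)"
    unfolding qpoch_def by (intro prod.cong) auto
  also have "\<dots> = qpoch_odd N * ?Ev"
    unfolding qpoch_odd_def ev[symmetric] by (subst prod.union_disjoint) auto
  finally have E: "qpoch N = qpoch_odd N * ?Ev" .
  have "(\<Prod>k=1..N. 1 - ?X ^ (2 * k)) = ?Ev * (\<Prod>k\<in>{N div 2<..N}. 1 - ?X ^ (2 * k))"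
  proof -
    have "(\<Prod>k=1..N. 1 - ?X ^ (2 * k)) = (\<Prod>k\<in>{1..N div 2} \<union> {N div 2<..N}. 1 - ?X ^ (2 * k))"
      by (intro prod.cong) auto
    also have "\<dots> = ?Ev * (\<Prod>k\<in>{N div 2<..N}. 1 - ?X ^ (2 * k))"
      by (rule prod.union_disjoint) auto
    finally show ?thesis .
  qed
  also have "fps_eq_upto N \<dots> (?Ev * (\<Prod>k\<in>{N div 2<..N}. 1))"
  proof (intro fps_eq_upto_mult fps_eq_upto_prod fps_eq_upto_refl)
    fix k assume "k \<in> {N div 2<..N}"
    hence "fps_eq_upto N (1 - ?X ^ (2 * k) * 1) (1 - 0)"
      by (intro fps_eq_upto_diff fps_eq_upto_X_power) auto
    thus "fps_eq_upto N (1 - ?X ^ (2 * k)) 1" by simp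
  qed
  finally have "fps_eq_upto N (?Ev * (qpoch_plus N * qpoch_odd N)) (?Ev * 1)"
    unfolding qpoch_mult_qpoch_plus[symmetric] E by (simp add: mult_ac)
  moreover have "fps_nth ?Ev 0 = 1" by (simp add: fps_prod_nth')
  ultimately show ?thesis by (rule fps_eq_upto_cancel)
qed

text \<open>By Gauss (q;q) / (-q;q) is the theta series, and by Euler the remaining 1 / (-q;q) is
  the product over odd exponents. That only odd exponents remain is what the majorant estimate
  exploits.\<close>

lemma crank_gf_upto_theta:
  assumes "1 \<le> N"
  shows "fps_eq_upto N crank_gf (theta_fps N * qpoch_odd N)"
proof -
  have "fps_eq_upto N (qpoch_plus N * (crank_gf * qpoch_plus N)) (qpoch_plus N * theta_fps N)"
    using fps_eq_upto_trans[OF crank_gf_upto[OF assms] fps_eq_upto_sym[OF theta_upto]]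
    by (simp add: power2_eq_square mult_ac)
  hence "fps_eq_upto N (crank_gf * qpoch_plus N) (theta_fps N)"
    by (rule fps_eq_upto_cancel) simp
  hence "fps_eq_upto N (crank_gf * qpoch_plus N * qpoch_odd N) (theta_fps N * qpoch_odd N)"
    by (intro fps_eq_upto_mult) auto
  moreover have "fps_eq_upto N (crank_gf * (qpoch_plus N * qpoch_odd N)) (crank_gf * 1)"
    by (intro fps_eq_upto_mult qpoch_plus_mult_odd_upto) auto
  ultimately show ?thesis by (simp add: fps_eq_upto_def mult.assoc)
qed

text \<open>From (q^2;q^2) (q;q^2) = (q;q): a recurrence for the odd product whose coefficients are
  sparse and are 0, 1 or -1, as in Euler's recurrence for p.\<close>

lemma qpoch_odd_recurrence: "fps_eq_upto N (pent2_fps N * qpoch_odd N) (pent_fps N)"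
proof -
  have "fps_eq_upto N (pent2_fps N * qpoch_odd N) (qpoch N * qpoch_plus N * qpoch_odd N)"
    by (intro fps_eq_upto_mult fps_eq_upto_sym[OF qpoch_mult_qpoch_plus_upto_pent2]) auto
  also have "\<dots> = qpoch N * (qpoch_plus N * qpoch_odd N)" by (simp add: mult.assoc)
  also have "fps_eq_upto N \<dots> (pent_fps N * 1)"
    by (intro fps_eq_upto_mult qpoch_upto_pent qpoch_plus_mult_odd_upto)
  finally show ?thesis by simp
qed

definition partition_fps :: "int fps" where
  "partition_fps = Abs_fps (\<lambda>n. int (card (partitions n)))"

lemma qpoch_mult_partition_upto: "fps_eq_upto N (qpoch N * partition_fps) 1"
proof -
  have "fps_eq_upto N partition_fps (parts_gf1 {1..N})"
    using parts_gf1_nth[of _ N] by (simp add: fps_eq_upto_def partition_fps_def)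
  hence "fps_eq_upto N (qpoch N * partition_fps) (qpoch N * parts_gf1 {1..N})"
    by (intro fps_eq_upto_mult) auto
  also have "qpoch N * parts_gf1 {1..N} = 1"
    using parts_gf1_mult_prod[of 1 N] by (simp add: qpoch_def mult.commute)
  finally show ?thesis .
qed

lemma partition_recurrence: "fps_eq_upto N (pent_fps N * partition_fps) 1"
  using fps_eq_upto_trans[OF fps_eq_upto_mult[OF fps_eq_upto_sym[OF qpoch_upto_pent] fps_eq_upto_refl]
      qpoch_mult_partition_upto] .

section \<open>Coefficient bounds from values at a positive radius\<close>

text \<open>A truncated l1 norm at radius r. It is submultiplicative and dominates the term of index
  n, so it bounds coefficients of products without any convergence argument.\<close>

definition majorant :: "real \<Rightarrow> nat \<Rightarrow> int fps \<Rightarrow> real" where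
  "majorant r n f = (\<Sum>i\<le>n. \<bar>real_of_int (fps_nth f i)\<bar> * r ^ i)"

lemma majorant_mult_le:
  assumes "r \<ge> 0"
  shows "majorant r n (f * g) \<le> majorant r n f * majorant r n g"
proof -
  define F where "F = (\<lambda>i. \<bar>real_of_int (fps_nth f i)\<bar> * r ^ i)"
  define G where "G = (\<lambda>i. \<bar>real_of_int (fps_nth g i)\<bar> * r ^ i)"
  have nonneg: "F i \<ge> 0" "G i \<ge> 0" for i using assms by (simp_all add: F_def G_def)
  have "majorant r n (f * g) \<le> (\<Sum>i\<le>n. \<Sum>j\<le>i. F j * G (i - j))"
    unfolding majorant_def
  proof (rule sum_mono)
    fix i
    have "\<bar>real_of_int (fps_nth (f * g) i)\<bar> \<le> (\<Sum>j\<le>i. \<bar>real_of_int (fps_nth f j * fps_nth g (i - j))\<bar>)"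
      unfolding fps_mult_nth of_int_sum atMost_atLeast0 by (rule sum_abs)
    hence "\<bar>real_of_int (fps_nth (f * g) i)\<bar> * r ^ i \<le>
        (\<Sum>j\<le>i. \<bar>real_of_int (fps_nth f j * fps_nth g (i - j))\<bar>) * r ^ i"
      using assms by (intro mult_right_mono) auto
    also have "\<dots> = (\<Sum>j\<le>i. F j * G (i - j))"
      unfolding sum_distrib_right
    proof (intro sum.cong refl)
      fix j assume "j \<in> {..i}"
      hence "r ^ i = r ^ j * r ^ (i - j)" by (simp flip: power_add)
      thus "\<bar>real_of_int (fps_nth f j * fps_nth g (i - j))\<bar> * r ^ i = F j * G (i - j)"
        by (simp add: F_def G_def abs_mult)
    qed
    finally show "\<bar>real_of_int (fps_nth (f * g) i)\<bar> * r ^ i \<le> (\<Sum>j\<le>i. F j * G (i - j))" .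
  qed
  also have "\<dots> = (\<Sum>(i,j)\<in>{(i,j). i + j \<le> n}. F i * G j)"
    by (rule sum.triangle_reindex_eq[symmetric])
  also have "\<dots> \<le> (\<Sum>(i,j)\<in>{..n} \<times> {..n}. F i * G j)"
    using nonneg by (intro sum_mono2) auto
  also have "\<dots> = majorant r n f * majorant r n g"
    by (simp add: majorant_def F_def G_def sum_product sum.cartesian_product)
  finally show ?thesis .
qed

lemma majorant_add_le: "r \<ge> 0 \<Longrightarrow> majorant r n (f + g) \<le> majorant r n f + majorant r n g"
  unfolding majorant_def sum.distrib[symmetric]
  by (intro sum_mono) (simp add: ring_distribs(2)[symmetric] mult_right_mono)

lemma majorant_sum_le: "r \<ge> 0 \<Longrightarrow> majorant r n (\<Sum>x\<in>A. f x) \<le> (\<Sum>x\<in>A. majorant r n (f x))"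
proof (induction A rule: infinite_finite_induct)
  case (insert x A)
  thus ?case using majorant_add_le[of r n "f x" "\<Sum>x\<in>A. f x"] by simp
qed (simp_all add: majorant_def)

lemma majorant_nonneg: "r \<ge> 0 \<Longrightarrow> majorant r n f \<ge> 0"
  by (auto simp: majorant_def intro!: sum_nonneg)

lemma majorant_X_power: "r \<ge> 0 \<Longrightarrow> majorant r n (fps_const c * fps_X ^ k) \<le> \<bar>real_of_int c\<bar> * r ^ k"
  by (simp add: majorant_def if_distrib if_distribR sum.delta cong: if_cong)

lemma majorant_prod_le:
  "r \<ge> 0 \<Longrightarrow> (\<And>x. x \<in> A \<Longrightarrow> majorant r n (f x) \<le> g x) \<Longrightarrow> majorant r n (\<Prod>x\<in>A. f x) \<le> (\<Prod>x\<in>A. g x)"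
proof (induction A rule: infinite_finite_induct)
  case (insert x A)
  have "majorant r n (\<Prod>x\<in>insert x A. f x) \<le> majorant r n (f x) * majorant r n (\<Prod>x\<in>A. f x)"
    using insert majorant_mult_le[of r n "f x"] by simp
  also have "\<dots> \<le> g x * (\<Prod>x\<in>A. g x)"
    using insert majorant_nonneg[of r n "f x"] by (intro mult_mono) (auto intro: order_trans majorant_nonneg)
  finally show ?case using insert by simp
qed (use majorant_X_power[of r n 1 0] in auto)

text \<open>The theta factor is bounded by a geometric series because k <= k^2, the odd product by
  the exponential of the sum of its odd powers. Requiring n >= 2 avoids the index 1, where
  \<open>crank_gf\<close> deviates from \<open>crank_diff\<close>.\<close>

lemma abs_crank_diff_le:
  fixes r :: real
  assumes "n \<ge> 2" "0 < r" "r < 1"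
  shows "\<bar>real_of_int (crank_diff n)\<bar> * r ^ n \<le> (1 + 2 * (r / (1 - r))) * exp (r / (1 - r ^ 2))"
proof -
  have r: "r \<ge> 0" "norm r < 1" "norm (r ^ 2) < 1" using assms by (auto simp: power_less_one_iff abs_square_less_1)
  have "\<bar>real_of_int (crank_diff n)\<bar> * r ^ n = \<bar>real_of_int (fps_nth (theta_fps n * qpoch_odd n) n)\<bar> * r ^ n"
  proof -
    have "fps_nth crank_gf n = fps_nth (theta_fps n * qpoch_odd n) n"
      using crank_gf_upto_theta[of n] assms(1) unfolding fps_eq_upto_def by simp
    thus ?thesis using assms(1) by (simp add: crank_gf_def)
  qed
  also have "\<dots> \<le> majorant r n (theta_fps n * qpoch_odd n)"
    unfolding majorant_def using r by (intro member_le_sum[of n]) auto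
  also have "\<dots> \<le> majorant r n (theta_fps n) * majorant r n (qpoch_odd n)"
    by (rule majorant_mult_le) (use r in auto)
  also have "\<dots> \<le> (1 + 2 * (r / (1 - r))) * exp (r / (1 - r ^ 2))"
  proof (intro mult_mono)
    have sign: "(-1 :: int fps) ^ k = fps_const ((-1) ^ k)" for k
      by (metis fps_const_1_eq_1 fps_const_neg fps_const_power)
    have "theta_fps n = fps_const 1 * fps_X ^ 0 + (\<Sum>k=1..n. fps_const (2 * (-1) ^ k) * fps_X ^ (k\<^sup>2))"
      by (simp add: theta_fps_def sign sum_distrib_left numeral_fps_const flip: fps_const_mult mult.assoc)
    hence "majorant r n (theta_fps n) \<le> majorant r n (fps_const 1 * fps_X ^ 0) +
        (\<Sum>k=1..n. majorant r n (fps_const (2 * (-1) ^ k) * fps_X ^ (k\<^sup>2)))"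
      using r by (auto intro: order_trans[OF majorant_add_le] majorant_sum_le add_mono)
    also have "\<dots> \<le> 1 + (\<Sum>k=1..n. 2 * r ^ k)"
    proof (intro add_mono sum_mono)
      fix k assume "k \<in> {1..n}"
      hence "k \<le> k ^ 2" by (simp add: power2_eq_square)
      hence "r ^ (k ^ 2) \<le> r ^ k" using assms by (intro power_decreasing) auto
      thus "majorant r n (fps_const (2 * (-1) ^ k) * fps_X ^ (k\<^sup>2)) \<le> 2 * r ^ k"
        using majorant_X_power[of r n "2 * (-1) ^ k" "k ^ 2"] r by (simp add: abs_mult power_abs)
    qed (use majorant_X_power[of r n 1 0] r in simp)
    also have "(\<Sum>k=1..n. 2 * r ^ k) = 2 * (\<Sum>k=1..n. r ^ k)" by (simp add: sum_distrib_left)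
    also have "(\<Sum>k=1..n. r ^ k) \<le> r / (1 - r)"
    proof -
      have "(\<Sum>k=1..n. r ^ k) = r * (\<Sum>k<n. r ^ k)"
        unfolding sum_distrib_left by (rule sum.reindex_bij_witness[of _ Suc "\<lambda>k. k - 1"]) (auto simp flip: power_Suc)
      also have "(\<Sum>k<n. r ^ k) \<le> 1 / (1 - r)"
        using assms by (simp add: sum_gp_strict divide_right_mono)
      finally show ?thesis using assms by simp
    qed
    finally show "majorant r n (theta_fps n) \<le> 1 + 2 * (r / (1 - r))" by simp
  next
    have fac: "majorant r n (1 - fps_X ^ k) \<le> exp (r ^ k)" for k
    proof -
      have "majorant r n (1 - fps_X ^ k) = majorant r n (fps_const 1 * fps_X ^ 0 + fps_const (-1) * fps_X ^ k)"
        by (simp flip: fps_const_neg)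
      also have "\<dots> \<le> 1 + r ^ k"
        using r majorant_X_power[of r n 1 0] majorant_X_power[of r n "-1" k]
        by (intro order_trans[OF majorant_add_le]) auto
      also have "\<dots> \<le> exp (r ^ k)" by (rule exp_ge_add_one_self)
      finally show ?thesis .
    qed
    have "majorant r n (qpoch_odd n) \<le> (\<Prod>k | k \<in> {1..n} \<and> odd k. exp (r ^ k))"
      unfolding qpoch_odd_def by (rule majorant_prod_le) (use r fac in auto)
    also have "\<dots> = exp (\<Sum>k | k \<in> {1..n} \<and> odd k. r ^ k)" by (simp add: exp_sum)
    also have "(\<Sum>k | k \<in> {1..n} \<and> odd k. r ^ k) \<le> (\<Sum>k\<in>(\<lambda>j. 2 * j + 1) ` {..<n}. r ^ k)"
      using r by (intro sum_mono2) (auto elim!: oddE)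
    also have "\<dots> = r * (\<Sum>j<n. (r ^ 2) ^ j)"
      by (simp add: sum.reindex inj_on_def sum_distrib_left power_mult)
    also have "(\<Sum>j<n. (r ^ 2) ^ j) \<le> 1 / (1 - r ^ 2)"
      using assms r by (simp add: sum_gp_strict divide_right_mono)
    finally show "majorant r n (qpoch_odd n) \<le> exp (r / (1 - r ^ 2))"
      using r by (simp add: mult_left_mono)
  qed (use assms r in \<open>auto intro!: majorant_nonneg add_nonneg_nonneg\<close>)
  finally show ?thesis .
qed

section \<open>Modular inversion of the partition series\<close>

text \<open>The logarithmic derivative of the reflection formula for \<open>rGamma\<close>. In the
  difference of the Digamma limits at \<open>1 - z\<close> and z the logarithms cancel.\<close>

lemma cot_partial_fractions:
  fixes z :: complex
  assumes "z \<notin> \<int>"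
  shows "(\<lambda>m. \<Sum>n<m. inverse (z + of_nat n) - inverse (of_nat (Suc n) - z)) \<longlonglongrightarrow> pi * cot (pi * z)"
proof -
  have notint: "z \<notin> \<int>\<^sub>\<le>\<^sub>0" "1 - z \<notin> \<int>\<^sub>\<le>\<^sub>0" "z \<noteq> 0" "1 - z \<noteq> 0"
    using assms by (auto dest!: nonpos_Ints_Int)
  have sin: "sin (pi * z) \<noteq> 0"
    using assms by (auto simp: sin_eq_0)
  have "((\<lambda>z. rGamma z * rGamma (1 - z)) has_field_derivative
          (rGamma z * rGamma (1 - z) * (Digamma (1 - z) - Digamma z))) (at z)"
    using notint by (auto intro!: derivative_eq_intros simp: algebra_simps)
  moreover have "(\<lambda>z. rGamma z * rGamma (1 - z)) = (\<lambda>z::complex. sin (of_real pi * z) / of_real pi)"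
    by (rule ext) (rule rGamma_reflection_complex)
  moreover have "((\<lambda>z. sin (of_real pi * z) / of_real pi) has_field_derivative cos (pi * z)) (at z)"
    by (auto intro!: derivative_eq_intros)
  ultimately have "sin (pi * z) / pi * (Digamma (1 - z) - Digamma z) = cos (pi * z)"
    by (metis DERIV_unique)
  hence eq: "Digamma (1 - z) - Digamma z = pi * cot (pi * z)"
    using sin by (simp add: cot_def field_simps)
  have "(\<lambda>m. (of_real (ln (real m)) - (\<Sum>n<m. inverse (1 - z + of_nat n))) -
             (of_real (ln (real m)) - (\<Sum>n<m. inverse (z + of_nat n)))) \<longlonglongrightarrow> Digamma (1 - z) - Digamma z"
    by (intro tendsto_diff Digamma_LIMSEQ notint)
  thus ?thesis unfolding eq by (simp add: sum_subtractf algebra_simps)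
qed

section \<open>The Bose function and its truncated partial fraction expansion\<close>

text \<open>This is (coth (pi w) - 1 / (pi w)) / 2: the Bose factor freed of its pole and of its
  constant term at 0.\<close>

definition bose :: "real \<Rightarrow> real" where
  "bose w = 1 / (exp (2 * pi * w) - 1) - 1 / (2 * pi * w) + 1 / 2"

text \<open>The cotangent expansion at z = i w; joining the terms of n and -n produces the
  denominators w^2 + n^2.\<close>

lemma bose_sums:
  assumes "w > 0"
  shows "(\<lambda>k. w / (pi * (w\<^sup>2 + (real (Suc k))\<^sup>2))) sums bose w"
proof -
  define z where "z = \<i> * complex_of_real w"
  have z: "z \<notin> \<int>" using assms by (auto simp: z_def elim!: Ints_cases simp: complex_eq_iff)
  \<comment> \<open>The cotangent sum pairs 1/(z + n) with 1/(n + 1 - z). Regrouping it by equal n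
    leaves 1/z in front and one boundary term that tends to 0.\<close>
  have partial: "(\<Sum>n<Suc m. inverse (z + of_nat n) - inverse (of_nat (Suc n) - z)) =
      inverse z - inverse (of_nat (Suc m) - z) - 2 * z * (\<Sum>k<m. inverse (of_real (w\<^sup>2 + (real (Suc k))\<^sup>2)))" for m
  proof (induction m)
    case (Suc m)
    define N where "N = complex_of_real (real (Suc m))"
    have nz: "z + N \<noteq> 0" "N - z \<noteq> 0" "w\<^sup>2 + (real (Suc m))\<^sup>2 \<noteq> 0"
      using assms by (auto simp: z_def complex_eq_iff N_def add_nonneg_eq_0_iff)
    have "(z + N) * (N - z) = of_real (w\<^sup>2 + (real (Suc m))\<^sup>2)"
      by (simp add: z_def N_def algebra_simps power2_eq_square)
    hence "inverse (z + N) - inverse (N - z) = - 2 * z * inverse (of_real (w\<^sup>2 + (real (Suc m))\<^sup>2))"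
      using nz by (simp add: field_simps flip: of_real_add of_real_power)
    thus ?case unfolding sum.lessThan_Suc[of _ "Suc m"] Suc.IH
      by (simp add: N_def algebra_simps)
  qed simp
  have "(\<lambda>m. inverse (of_nat (Suc m) - z)) \<longlonglongrightarrow> 0"
  proof (rule tendsto_inverse_0[THEN filterlim_compose])
    have "filterlim (\<lambda>m. - z + of_nat (Suc m)) at_infinity sequentially"
      by (intro tendsto_add_filterlim_at_infinity[OF tendsto_const] filterlim_compose[OF tendsto_of_nat filterlim_Suc])
    thus "filterlim (\<lambda>m. of_nat (Suc m) - z) at_infinity sequentially" by simp
  qed
  moreover have "(\<lambda>m. \<Sum>n<Suc m. inverse (z + of_nat n) - inverse (of_nat (Suc n) - z)) \<longlonglongrightarrow> pi * cot (pi * z)"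
    by (rule filterlim_compose[OF cot_partial_fractions[OF z] filterlim_Suc])
  ultimately have "(\<lambda>m. (\<i> / (2 * pi)) * ((\<Sum>n<Suc m. inverse (z + of_nat n) - inverse (of_nat (Suc n) - z))
      + inverse (of_nat (Suc m) - z) - inverse z)) \<longlonglongrightarrow> (\<i> / (2 * pi)) * (pi * cot (pi * z) + 0 - inverse z)"
    by (intro tendsto_intros)
  also have "(\<lambda>m. (\<i> / (2 * pi)) * ((\<Sum>n<Suc m. inverse (z + of_nat n) - inverse (of_nat (Suc n) - z))
      + inverse (of_nat (Suc m) - z) - inverse z)) = (\<lambda>m. of_real (\<Sum>k<m. w / (pi * (w\<^sup>2 + (real (Suc k))\<^sup>2))))"
    unfolding partial by (simp add: z_def sum_distrib_left sum_negf field_simps)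
  also have "(\<i> / (2 * pi)) * (pi * cot (pi * z) + 0 - inverse z) = of_real (bose w)"
  proof -
    have e: "exp (pi * w) > 1" using assms by simp
    define E where "E = exp (pi * w)"
    have E: "E > 1" "exp (2 * pi * w) = E * E" using e by (simp_all add: E_def mult_exp_exp)
    have iz: "\<i> * (of_real pi * z) = of_real (- (pi * w))"
      by (simp add: z_def complex_eq_iff)
    have "cos (pi * z) = of_real ((E + inverse E) / 2)"
      unfolding cos_exp_eq iz of_real_minus[symmetric] exp_of_real by (simp add: E_def exp_minus)
    moreover have "sin (pi * z) = \<i> * of_real ((E - inverse E) / 2)"
      unfolding sin_exp_eq iz of_real_minus[symmetric] exp_of_real by (simp add: E_def exp_minus field_simps)
    ultimately have "cot (pi * z) = of_real ((E + inverse E) / 2) / (\<i> * of_real ((E - inverse E) / 2))"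
      by (simp only: cot_def)
    also have "\<dots> = - \<i> * (of_real ((E + inverse E) / 2) / of_real ((E - inverse E) / 2))"
    proof -
      have "x / (\<i> * y) = - \<i> * (x / y)" for x y :: complex
        by (simp add: divide_inverse mult_ac)
      thus ?thesis .
    qed
    also have "\<dots> = - \<i> * of_real (((E + inverse E) / 2) / ((E - inverse E) / 2))"
      by (simp only: of_real_divide)
    also have "((E + inverse E) / 2) / ((E - inverse E) / 2) = (E * E + 1) / (E * E - 1)"
    proof -
      have "E + inverse E = (E * E + 1) / E" "E - inverse E = (E * E - 1) / E"
        using E(1) by (simp_all add: field_simps)
      thus ?thesis using E(1) by simp
    qed
    finally have cot: "cot (pi * z) = - \<i> * of_real ((E * E + 1) / (E * E - 1))" .
    have EE: "E * E > 1" using E(1) by (metis less_1_mult)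
    have aux: "(\<i> / (2 * P)) * (P * (- \<i> * R) + 0 - inverse (\<i> * W)) = R / 2 - 1 / (2 * P * W)"
      if "P \<noteq> 0" "W \<noteq> 0" for P W R :: complex
      using that by (simp add: field_simps)
    have "(\<i> / (2 * pi)) * (pi * cot (pi * z) + 0 - inverse z) = of_real ((E * E + 1) / (E * E - 1) / 2 - 1 / (2 * pi * w))"
      using assms aux[of "of_real pi" "of_real w" "of_real ((E * E + 1) / (E * E - 1))"]
      unfolding cot unfolding z_def by simp
    also have "(E * E + 1) / (E * E - 1) / 2 - 1 / (2 * pi * w) = bose w"
    proof -
      have "(A + 1) / (A - 1) / 2 = 1 / (A - 1) + 1 / 2" if "A > 1" for A :: real
        using that by (simp add: field_simps)
      from this[OF EE] show ?thesis by (simp add: bose_def E(2))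
    qed
    finally show ?thesis .
  qed
  finally show ?thesis unfolding sums_def by (simp only: tendsto_of_real_iff)
qed

text \<open>A comparison of sum and integral in telescoping form: arctan (w / x) has derivative -w /
  (w^2 + x^2), which is monotone in x.\<close>

lemma arctan_diff_bounds:
  fixes w k :: real
  assumes "w > 0" "k \<ge> 1"
  shows "w / (w\<^sup>2 + (k + 1)\<^sup>2) \<le> arctan (w / k) - arctan (w / (k + 1))"
    and "arctan (w / k) - arctan (w / (k + 1)) \<le> w / (w\<^sup>2 + k\<^sup>2)"
proof -
  have d: "((\<lambda>x. arctan (w / x)) has_field_derivative - (w / (w\<^sup>2 + x\<^sup>2))) (at x)" if "x \<ge> k" for x
  proof -
    have "x > 0" using that assms by simp
    hence "inverse (1 + (w / x)\<^sup>2) * (- (w / (x * x))) = - (w / (w\<^sup>2 + x\<^sup>2))"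
      by (simp add: divide_simps power2_eq_square) (simp add: algebra_simps)?
    thus ?thesis using \<open>x > 0\<close>
      by (auto intro!: derivative_eq_intros simp: power2_eq_square)
  qed
  obtain x where x: "k < x" "x < k + 1" "arctan (w / (k + 1)) - arctan (w / k) = (k + 1 - k) * - (w / (w\<^sup>2 + x\<^sup>2))"
    using MVT2[of k "k + 1" "\<lambda>x. arctan (w / x)" "\<lambda>x. - (w / (w\<^sup>2 + x\<^sup>2))"] d by auto
  have "w / (w\<^sup>2 + (k + 1)\<^sup>2) \<le> w / (w\<^sup>2 + x\<^sup>2)" "w / (w\<^sup>2 + x\<^sup>2) \<le> w / (w\<^sup>2 + k\<^sup>2)"
    using x assms by (auto intro!: divide_left_mono add_left_mono power_mono mult_pos_pos add_pos_pos)
  thus "w / (w\<^sup>2 + (k + 1)\<^sup>2) \<le> arctan (w / k) - arctan (w / (k + 1))"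
       "arctan (w / k) - arctan (w / (k + 1)) \<le> w / (w\<^sup>2 + k\<^sup>2)" using x(3) by auto
qed

text \<open>The tail over k > K is close to the integral of w / (w^2 + x^2) from K to infinity,
  which is arctan (w / K). The telescoping bounds take the place of the integral.\<close>

lemma bose_truncated:
  assumes "w > 0" "K \<ge> 1"
  shows "\<bar>bose w - (\<Sum>k=1..K. w / (pi * (w\<^sup>2 + (real k)\<^sup>2))) - arctan (w / real K) / pi\<bar> \<le> w / (pi * (real K)\<^sup>2)"
proof -
  define f where "f = (\<lambda>k. w / (w\<^sup>2 + (real (k + Suc K))\<^sup>2))"
  define T where "T = pi * bose w - (\<Sum>k=1..K. w / (w\<^sup>2 + (real k)\<^sup>2))"
  have "(\<lambda>k. pi * (w / (pi * (w\<^sup>2 + (real (Suc k))\<^sup>2)))) sums (pi * bose w)"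
    by (intro sums_mult bose_sums assms)
  hence "(\<lambda>k. w / (w\<^sup>2 + (real (Suc k))\<^sup>2)) sums (pi * bose w)" by simp
  hence "(\<lambda>k. w / (w\<^sup>2 + (real (Suc (k + K)))\<^sup>2)) sums (pi * bose w - (\<Sum>k<K. w / (w\<^sup>2 + (real (Suc k))\<^sup>2)))"
    by (rule sums_split_initial_segment)
  moreover have "(\<Sum>k<K. w / (w\<^sup>2 + (real (Suc k))\<^sup>2)) = (\<Sum>k=1..K. w / (w\<^sup>2 + (real k)\<^sup>2))"
    by (rule sum.reindex_bij_witness[of _ "\<lambda>k. k - 1" Suc]) auto
  ultimately have f: "f sums T" by (simp add: f_def T_def)
  have tele: "(\<lambda>k. arctan (w / real (k + J)) - arctan (w / real (Suc k + J))) sums (arctan (w / real (0 + J)) - 0)" for J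
  proof (rule telescope_sums')
    have "(\<lambda>k. arctan (w * inverse (real (k + J)))) \<longlonglongrightarrow> arctan (w * 0)"
      by (intro tendsto_intros LIMSEQ_ignore_initial_segment[OF lim_inverse_n])
    thus "(\<lambda>k. arctan (w / real (k + J))) \<longlonglongrightarrow> 0" by (simp add: field_simps)
  qed
  have "T \<le> arctan (w / real K)"
  proof (rule sums_le[OF _ f])
    show "(\<lambda>k. arctan (w / real (k + K)) - arctan (w / real (Suc k + K))) sums arctan (w / real K)"
      using tele[of K] by simp
    show "f k \<le> arctan (w / real (k + K)) - arctan (w / real (Suc k + K))" for k
      using arctan_diff_bounds(1)[of w "real (k + K)"] assms by (simp add: f_def algebra_simps)
  qed
  moreover have "arctan (w / real (Suc K)) \<le> T"
  proof (rule sums_le[OF _ _ f])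
    show "(\<lambda>k. arctan (w / real (k + Suc K)) - arctan (w / real (Suc k + Suc K))) sums arctan (w / real (Suc K))"
      using tele[of "Suc K"] by simp
    show "arctan (w / real (k + Suc K)) - arctan (w / real (Suc k + Suc K)) \<le> f k" for k
      using arctan_diff_bounds(2)[of w "real (k + Suc K)"] assms by (simp add: f_def algebra_simps)
  qed
  moreover have "arctan (w / real K) - arctan (w / real (Suc K)) \<le> w / (w\<^sup>2 + (real K)\<^sup>2)"
    using arctan_diff_bounds(2)[of w "real K"] assms by (simp add: algebra_simps)
  moreover have "w / (w\<^sup>2 + (real K)\<^sup>2) \<le> w / (real K)\<^sup>2"
    using assms by (intro divide_left_mono mult_pos_pos add_pos_pos) auto
  ultimately have "\<bar>T - arctan (w / real K)\<bar> \<le> w / (real K)\<^sup>2" by linarith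
  hence "\<bar>T - arctan (w / real K)\<bar> / pi \<le> w / (real K)\<^sup>2 / pi" by (intro divide_right_mono) auto
  moreover have "bose w - (\<Sum>k=1..K. w / (pi * (w\<^sup>2 + (real k)\<^sup>2))) - arctan (w / real K) / pi = (T - arctan (w / real K)) / pi"
  proof -
    have "(\<Sum>k=1..K. w / (pi * (w\<^sup>2 + (real k)\<^sup>2))) = (\<Sum>k=1..K. w / (w\<^sup>2 + (real k)\<^sup>2)) / pi"
      unfolding sum_divide_distrib by (intro sum.cong refl) (simp only: divide_divide_eq_left mult.commute)
    thus ?thesis by (simp add: T_def diff_divide_distrib)
  qed
  ultimately show ?thesis by (simp add: abs_divide mult.commute)
qed

section \<open>Reciprocity by exchanging a finite double sum\<close>

text \<open>A right Riemann sum with M intervals for arctan x / x on the unit interval. It collects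
  the arctan tails of the truncated expansions.\<close>

definition arctan_sum :: "nat \<Rightarrow> real" where
  "arctan_sum M = (\<Sum>m=1..M. arctan (real m / real M) / real m)"

lemma arctan_ratio_antimono:
  assumes "0 < x" "x \<le> y"
  shows "arctan y / y \<le> arctan x / x"
proof (cases "x = y")
  case False
  have "\<exists>z. x < z \<and> z < y \<and> arctan y / y - arctan x / x = (y - x) * ((inverse (1 + z\<^sup>2) * z - arctan z) / (z * z))"
    using assms False by (intro MVT2) (auto intro!: derivative_eq_intros)
  then obtain z where z: "x < z" "z < y"
    "arctan y / y - arctan x / x = (y - x) * ((inverse (1 + z\<^sup>2) * z - arctan z) / (z * z))" by blast
  have "\<exists>u. 0 < u \<and> u < z \<and> arctan z - arctan 0 = (z - 0) * inverse (1 + u\<^sup>2)"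
    using z assms by (intro MVT2) (auto intro!: derivative_eq_intros)
  then obtain u where u: "0 < u" "u < z" "arctan z = z * inverse (1 + u\<^sup>2)" by auto
  have "inverse (1 + z\<^sup>2) \<le> inverse (1 + u\<^sup>2)"
    using u by (intro le_imp_inverse_le add_left_mono power_mono) (auto intro!: add_pos_nonneg)
  hence "inverse (1 + z\<^sup>2) * z - arctan z \<le> 0" using u z assms by (simp add: mult.commute)
  hence "(inverse (1 + z\<^sup>2) * z - arctan z) / (z * z) \<le> 0" by (simp add: divide_le_0_iff)
  hence "(y - x) * ((inverse (1 + z\<^sup>2) * z - arctan z) / (z * z)) \<le> 0"
    using assms by (intro mult_nonneg_nonpos) auto
  thus ?thesis using z by simp
qed auto

lemma arctan_ratio_le_1: "x > 0 \<Longrightarrow> arctan x / x \<le> 1"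
  by (simp add: arctan_le_self)

text \<open>Since arctan x / x decreases, the right sum is a lower sum. Refining it cannot exceed
  the left sum, and the two differ by at most the value 1 at the origin divided by M.\<close>

lemma arctan_sum_refine:
  assumes "M \<ge> 1" "J \<ge> 1"
  shows "\<bar>arctan_sum (M * J) - arctan_sum M\<bar> \<le> 1 / real M"
proof -
  define g where "g = (\<lambda>x::real. if x = 0 then 1 else arctan x / x)"
  have g_anti: "g y \<le> g x" if "0 \<le> x" "x \<le> y" for x y
    using that arctan_ratio_antimono[of x y] arctan_ratio_le_1[of y] by (auto simp: g_def)
  have g0: "g 0 = 1" by (simp add: g_def)
  have g_nonneg: "g x \<ge> 0" if "x \<ge> 0" for x
    using that by (auto simp: g_def)
  have sum_eq: "arctan_sum N = (\<Sum>m<N. g (real (Suc m) / real N) / real N)" if "N \<ge> 1" for N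
  proof -
    have "arctan_sum N = (\<Sum>m<N. arctan (real (Suc m) / real N) / real (Suc m))"
      unfolding arctan_sum_def by (rule sum.reindex_bij_witness[of _ Suc "\<lambda>k. k - 1"]) auto
    also have "\<dots> = (\<Sum>m<N. g (real (Suc m) / real N) / real N)"
      using that by (intro sum.cong refl) (simp add: g_def)
    finally show ?thesis .
  qed
  have "M * J \<ge> 1" using assms by (metis mult_le_mono mult_1)
  hence "arctan_sum (M * J) = (\<Sum>i<M * J. g (real (Suc i) / real (M * J)) / real (M * J))" by (simp add: sum_eq)
  also have "\<dots> = (\<Sum>m<M. \<Sum>i\<in>{m*J..<m*J+J}. g (real (Suc i) / real (M * J)) / real (M * J))"
    by (rule sum.nat_group[symmetric])
  finally have eq: "arctan_sum (M * J) = (\<Sum>m<M. \<Sum>i\<in>{m*J..<m*J+J}. g (real (Suc i) / real (M * J)) / real (M * J))" .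
  have pos: "real M > 0" "real J > 0" using assms by auto
  have low: "(\<Sum>i\<in>{m*J..<m*J+J}. g (real (Suc i) / real (M * J)) / real (M * J)) \<ge> g (real (Suc m) / real M) / real M" for m
  proof -
    have "g (real (Suc m) / real M) / real (M * J) \<le> g (real (Suc i) / real (M * J)) / real (M * J)" if "i \<in> {m*J..<m*J+J}" for i
    proof (intro divide_right_mono g_anti)
      have "Suc i \<le> Suc m * J" using that by auto
      hence "real (Suc i) \<le> real (Suc m) * real J" by (simp only: of_nat_mult[symmetric] of_nat_le_iff)
      hence "real (Suc i) / real (M * J) \<le> (real (Suc m) * real J) / real (M * J)"
        by (rule divide_right_mono) simp
      also have "\<dots> = real (Suc m) / real M" using pos by simp
      finally show "real (Suc i) / real (M * J) \<le> real (Suc m) / real M" .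
    qed auto
    hence "(\<Sum>i\<in>{m*J..<m*J+J}. g (real (Suc m) / real M) / real (M * J)) \<le> (\<Sum>i\<in>{m*J..<m*J+J}. g (real (Suc i) / real (M * J)) / real (M * J))"
      by (rule sum_mono)
    thus ?thesis using pos by simp
  qed
  have upp: "(\<Sum>i\<in>{m*J..<m*J+J}. g (real (Suc i) / real (M * J)) / real (M * J)) \<le> g (real m / real M) / real M" for m
  proof -
    have "g (real (Suc i) / real (M * J)) / real (M * J) \<le> g (real m / real M) / real (M * J)" if "i \<in> {m*J..<m*J+J}" for i
    proof (intro divide_right_mono g_anti)
      have "m * J \<le> Suc i" using that by auto
      hence "real m * real J \<le> real (Suc i)" by (simp only: of_nat_mult[symmetric] of_nat_le_iff)
      hence "(real m * real J) / real (M * J) \<le> real (Suc i) / real (M * J)"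
        by (rule divide_right_mono) simp
      thus "real m / real M \<le> real (Suc i) / real (M * J)" using pos by simp
    qed auto
    hence "(\<Sum>i\<in>{m*J..<m*J+J}. g (real (Suc i) / real (M * J)) / real (M * J)) \<le> (\<Sum>i\<in>{m*J..<m*J+J}. g (real m / real M) / real (M * J))"
      by (rule sum_mono)
    thus ?thesis using pos by simp
  qed
  have "arctan_sum M \<le> arctan_sum (M * J)"
    unfolding eq using low assms by (subst sum_eq) (auto intro: sum_mono)
  moreover have "arctan_sum (M * J) \<le> arctan_sum M + 1 / real M"
  proof -
    have "arctan_sum (M * J) \<le> (\<Sum>m<M. g (real m / real M) / real M)"
      unfolding eq by (intro sum_mono upp)
    also have "\<dots> = arctan_sum M + g 0 / real M - g 1 / real M"
    proof -
      have "(\<Sum>m<M. g (real m / real M) / real M) + g (real M / real M) / real M = (\<Sum>m<Suc M. g (real m / real M) / real M)" by simp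
      also have "\<dots> = g 0 / real M + (\<Sum>m<M. g (real (Suc m) / real M) / real M)"
        by (subst sum.lessThan_Suc_shift) simp
      finally show ?thesis using sum_eq[of M] assms by simp
    qed
    also have "\<dots> \<le> arctan_sum M + 1 / real M" using g0 g_nonneg[of 1] by simp
    finally show ?thesis .
  qed
  ultimately show ?thesis by linarith
qed

text \<open>Both sums are compared with their common refinement into M K intervals.\<close>

lemma arctan_sum_diff:
  assumes "M \<ge> 1" "K \<ge> 1"
  shows "\<bar>arctan_sum M - arctan_sum K\<bar> \<le> 1 / real M + 1 / real K"
  using arctan_sum_refine[of M K] arctan_sum_refine[of K M] assms by (simp add: mult.commute)

text \<open>The heart of the inversion. With sampling points m K / M and the rectangle m <= M, k <=
  K, the kernel is symmetric under the simultaneous exchange of m with k and M with K, so the two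
  double sums agree. The arctan tails become arctan (m / M) / m, free of K; hence their totals are
  two Riemann sums of the same function.\<close>

lemma bose_sum_swap:
  assumes "M \<ge> 1" "K \<ge> 1"
  shows "\<bar>(\<Sum>m=1..M. bose (real m * (real K / real M)) / real m) - (\<Sum>k=1..K. bose (real k * (real M / real K)) / real k)\<bar> \<le> 1 / real M + 1 / real K"
proof -
  define a where "a = (\<lambda>m k. (real K / real M) / (pi * ((real m * (real K / real M))\<^sup>2 + (real k)\<^sup>2)))"
  have half: "\<bar>(\<Sum>m=1..M. bose (real m * (real K / real M)) / real m) - (\<Sum>m=1..M. \<Sum>k=1..K. (real K / real M) / (pi * ((real m * (real K / real M))\<^sup>2 + (real k)\<^sup>2)))
      - arctan_sum M / pi\<bar> \<le> 1 / (pi * real K)" if "M \<ge> 1" "K \<ge> 1" for M K :: nat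
  proof -
    have "\<bar>(\<Sum>m=1..M. bose (real m * (real K / real M)) / real m) - (\<Sum>m=1..M. \<Sum>k=1..K. (real K / real M) / (pi * ((real m * (real K / real M))\<^sup>2 + (real k)\<^sup>2))) - arctan_sum M / pi\<bar> =
        \<bar>\<Sum>m=1..M. (bose (real m * (real K / real M)) - (\<Sum>k=1..K. (real m * (real K / real M)) / (pi * ((real m * (real K / real M))\<^sup>2 + (real k)\<^sup>2)))
             - arctan (real m * (real K / real M) / real K) / pi) / real m\<bar>"
    proof -
      have "(\<Sum>k=1..K. (real m * (real K / real M)) / (pi * ((real m * (real K / real M))\<^sup>2 + (real k)\<^sup>2))) / real m =
          (\<Sum>k=1..K. (real K / real M) / (pi * ((real m * (real K / real M))\<^sup>2 + (real k)\<^sup>2)))" if "m \<in> {1..M}" for m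
        using that unfolding sum_divide_distrib by (intro sum.cong refl) simp
      moreover have "arctan (real m * (real K / real M) / real K) / pi / real m = arctan (real m / real M) / real m / pi" for m
        using \<open>K \<ge> 1\<close> by simp
      ultimately have "bose (real m * (real K / real M)) / real m - (\<Sum>k=1..K. (real K / real M) / (pi * ((real m * (real K / real M))\<^sup>2 + (real k)\<^sup>2)))
           - arctan (real m / real M) / real m / pi = (bose (real m * (real K / real M)) - (\<Sum>k=1..K. (real m * (real K / real M)) / (pi * ((real m * (real K / real M))\<^sup>2 + (real k)\<^sup>2)))
             - arctan (real m * (real K / real M) / real K) / pi) / real m" if "m \<in> {1..M}" for m
        using that by (simp only: diff_divide_distrib)
      thus ?thesis
        unfolding arctan_sum_def sum_divide_distrib[of _ _ pi] sum_subtractf[symmetric]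
        by (intro arg_cong[of _ _ abs] sum.cong refl)
    qed
    also have "\<dots> \<le> (\<Sum>m=1..M. (real m * (real K / real M)) / (pi * (real K)\<^sup>2) / real m)"
    proof (rule order_trans[OF sum_abs], rule sum_mono)
      fix m assume "m \<in> {1..M}"
      thus "\<bar>(bose (real m * (real K / real M)) - (\<Sum>k=1..K. (real m * (real K / real M)) / (pi * ((real m * (real K / real M))\<^sup>2 + (real k)\<^sup>2)))
             - arctan (real m * (real K / real M) / real K) / pi) / real m\<bar> \<le> (real m * (real K / real M)) / (pi * (real K)\<^sup>2) / real m"
        unfolding abs_divide using bose_truncated[of "m * (K / M)" K] that
        by (simp only: abs_of_nat) (intro divide_right_mono, auto)
    qed
    also have "\<dots> = (\<Sum>m=1..M. (K / M) / (pi * (real K)\<^sup>2))" by (intro sum.cong refl) simp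
    also have "\<dots> = 1 / (pi * real K)" using that by (simp add: field_simps power2_eq_square)
    finally show ?thesis .
  qed
  have pos: "real M > 0" "real K > 0" using assms by auto
  have "(real K / real M) / (pi * ((real m * (real K / real M))\<^sup>2 + (real k)\<^sup>2)) = (real M / real K) / (pi * ((real k * (real M / real K))\<^sup>2 + (real m)\<^sup>2))"
    if "m \<ge> 1" "k \<ge> 1" for m k :: nat
  proof -
    have "(real k * (real M / real K))\<^sup>2 + (real m)\<^sup>2 = (M / K)\<^sup>2 * ((real m * (real K / real M))\<^sup>2 + (real k)\<^sup>2)"
      using pos by (simp add: field_simps power2_eq_square)
    thus ?thesis using pos by (simp add: power2_eq_square)
  qed
  hence "(\<Sum>m=1..M. \<Sum>k=1..K. (real K / real M) / (pi * ((real m * (real K / real M))\<^sup>2 + (real k)\<^sup>2))) =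
        (\<Sum>m=1..M. \<Sum>k=1..K. (real M / real K) / (pi * ((real k * (real M / real K))\<^sup>2 + (real m)\<^sup>2)))"
    by (intro sum.cong refl) auto
  also have "\<dots> = (\<Sum>k=1..K. \<Sum>m=1..M. (real M / real K) / (pi * ((real k * (real M / real K))\<^sup>2 + (real m)\<^sup>2)))"
    by (rule sum.swap)
  finally have "\<bar>(\<Sum>m=1..M. bose (real m * (real K / real M)) / real m) - (\<Sum>k=1..K. bose (real k * (real M / real K)) / real k)\<bar> \<le>
      1 / (pi * real K) + 1 / (pi * real M) + \<bar>arctan_sum M / pi - arctan_sum K / pi\<bar>"
    using half[OF assms] half[OF assms(2,1)] by linarith
  also have "\<bar>arctan_sum M / pi - arctan_sum K / pi\<bar> = \<bar>arctan_sum M - arctan_sum K\<bar> / pi"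
    by (simp flip: diff_divide_distrib)
  also have "\<dots> \<le> (1 / real M + 1 / real K) / pi"
    using arctan_sum_diff[OF assms] by (intro divide_right_mono) auto
  also have "1 / (pi * real K) + 1 / (pi * real M) + (1 / real M + 1 / real K) / pi = (1 / real M + 1 / real K) * (2 / pi)"
    by (simp add: field_simps)
  also have "\<dots> \<le> (1 / real M + 1 / real K) * 1"
    using pi_ge_two by (intro mult_left_mono) auto
  finally show ?thesis by simp
qed

lemma inverse_squares_sums': "(\<lambda>m. 1 / (real m + 1) ^ 2) sums (pi\<^sup>2 / 6)"
  using inverse_squares_sums by (simp add: add.commute)

section \<open>Inversion of the logarithm of the partition series at rational points\<close>

text \<open>The logarithm of the product of 1 / (1 - exp (- k t)): expand each logarithm and sum the
  geometric series over k first.\<close>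

definition log_partition :: "real \<Rightarrow> real" where
  "log_partition t = (\<Sum>m. 1 / (real (Suc m) * (exp (real (Suc m) * t) - 1)))"

lemma log_partition_term_le:
  fixes t :: real
  assumes "t > 0"
  shows "1 / (real (Suc m) * (exp (real (Suc m) * t) - 1)) \<le> 1 / t * (1 / (real m + 1) ^ 2)"
proof -
  have "1 + real (Suc m) * t \<le> exp (real (Suc m) * t)" by (rule exp_ge_add_one_self)
  hence le: "real (Suc m) * t \<le> exp (real (Suc m) * t) - 1" by linarith
  have "1 / (real (Suc m) * (exp (real (Suc m) * t) - 1)) \<le> 1 / (real (Suc m) * (real (Suc m) * t))"
  proof (rule divide_left_mono)
    show "real (Suc m) * (real (Suc m) * t) \<le> real (Suc m) * (exp (real (Suc m) * t) - 1)"
      by (rule mult_left_mono[OF le]) simp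
    have "0 < real (Suc m) * t" using assms by simp
    with le have "0 < exp (real (Suc m) * t) - 1" by (rule less_le_trans[rotated])
    thus "0 < real (Suc m) * (exp (real (Suc m) * t) - 1) * (real (Suc m) * (real (Suc m) * t))"
      using assms by (intro mult_pos_pos) auto
  qed simp
  also have "\<dots> = 1 / t * (1 / (real m + 1) ^ 2)" by (simp add: power2_eq_square field_simps)
  finally show ?thesis .
qed

lemma summable_log_partition:
  fixes t :: real
  assumes "t > 0"
  shows "summable (\<lambda>m. 1 / (real (Suc m) * (exp (real (Suc m) * t) - 1)))"
proof (rule summable_comparison_test)
  show "summable (\<lambda>m. 1 / t * (1 / (real m + 1) ^ 2))"
    using sums_summable[OF inverse_squares_sums'] by (intro summable_mult)
  show "\<exists>N. \<forall>m\<ge>N. norm (1 / (real (Suc m) * (exp (real (Suc m) * t) - 1))) \<le> 1 / t * (1 / (real m + 1) ^ 2)"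
  proof (intro exI[of _ 0] allI impI)
    fix m :: nat
    have "0 < real (Suc m) * t" using assms by simp
    hence "0 \<le> 1 / (real (Suc m) * (exp (real (Suc m) * t) - 1))" by simp
    thus "norm (1 / (real (Suc m) * (exp (real (Suc m) * t) - 1))) \<le> 1 / t * (1 / (real m + 1) ^ 2)"
      unfolding real_norm_def abs_of_nonneg using log_partition_term_le[OF assms] by (simp only: abs_of_nonneg)
  qed
qed

lemma filterlim_Suc_mult:
  assumes "M \<ge> 1"
  shows "filterlim (\<lambda>j. Suc j * M) at_top sequentially"
proof (rule filterlim_at_top_mono[OF filterlim_Suc])
  have "Suc j * 1 \<le> Suc j * M" for j using assms by (rule mult_le_mono2)
  thus "\<forall>\<^sub>F j in sequentially. Suc j \<le> Suc j * M" by (simp del: mult_Suc)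
qed

text \<open>\<open>bose_sum_swap\<close> is used for (j + 1) M and (j + 1) K, whose ratio remains
  \<kappa>, and j tends to infinity. The pole terms contribute multiples of the Basel sum, and the
  harmonic numbers combine to ln \<kappa> / 2 through Euler's constant.\<close>

lemma log_partition_inversion_rational:
  assumes "M \<ge> 1" "K \<ge> 1" and \<kappa>: "\<kappa> = real K / real M"
  shows "log_partition (2 * pi * \<kappa>) = log_partition (2 * pi / \<kappa>) + pi / (12 * \<kappa>) - pi * \<kappa> / 12 + ln \<kappa> / 2"
proof -
  have lim: "(\<lambda>j. (\<Sum>m=1..Suc j * M. bose (real m * c) / real m) - harm (Suc j * M) / 2) \<longlonglongrightarrow>
      log_partition (2 * pi * c) - 1 / (2 * pi * c) * (pi\<^sup>2 / 6)" if "c > 0" "M \<ge> 1" for c :: real and M :: nat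
  proof -
    have "(\<lambda>N. (\<Sum>m<N. 1 / (real (Suc m) * (exp (real (Suc m) * (2 * pi * c)) - 1))) - 1 / (2 * pi * c) * (\<Sum>m<N. 1 / (real m + 1) ^ 2))
        \<longlonglongrightarrow> log_partition (2 * pi * c) - 1 / (2 * pi * c) * (pi\<^sup>2 / 6)"
      using that inverse_squares_sums' summable_sums[OF summable_log_partition[of "2 * pi * c"]]
      unfolding log_partition_def sums_def by (intro tendsto_diff tendsto_mult tendsto_const) simp_all
    moreover have "(\<Sum>m<N. 1 / (real (Suc m) * (exp (real (Suc m) * (2 * pi * c)) - 1))) - 1 / (2 * pi * c) * (\<Sum>m<N. 1 / (real m + 1) ^ 2)
        = (\<Sum>m=1..N. bose (real m * c) / real m) - harm N / 2" for N
    proof (induction N)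
      case (Suc N)
      have "bose (real (Suc N) * c) / real (Suc N) = 1 / (real (Suc N) * (exp (real (Suc N) * (2 * pi * c)) - 1)) -
          1 / (2 * pi * c) * (1 / (real N + 1) ^ 2) + 1 / real (Suc N) / 2"
        using that(1) unfolding bose_def add_divide_distrib diff_divide_distrib
        by (simp add: mult_ac power2_eq_square) (simp add: algebra_simps)
      thus ?case using Suc by (simp add: harm_Suc algebra_simps inverse_eq_divide add_divide_distrib)
    qed (simp add: harm_def)
    ultimately have *: "(\<lambda>N. (\<Sum>m=1..N. bose (real m * c) / real m) - harm N / 2) \<longlonglongrightarrow>
       log_partition (2 * pi * c) - 1 / (2 * pi * c) * (pi\<^sup>2 / 6)" by simp
    have "filterlim (\<lambda>j. Suc j * M) at_top sequentially"
      by (rule filterlim_Suc_mult[OF that(2)])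
    from filterlim_compose[OF * this] show ?thesis .
  qed
  have pos: "\<kappa> > 0" using assms by simp
  \<comment> \<open>Harmonic numbers minus logarithms are added back so that every summand converges
    separately; what is left over is the constant difference of the logarithms.\<close>
  define D where "D = (\<lambda>j. ((\<Sum>m=1..Suc j * M. bose (real m * \<kappa>) / real m) - harm (Suc j * M) / 2) -
     ((\<Sum>k=1..Suc j * K. bose (real k * (1 / \<kappa>)) / real k) - harm (Suc j * K) / 2) + (harm (Suc j * M) - ln (Suc j * M)) / 2
       - (harm (Suc j * K) - ln (Suc j * K)) / 2)"
  have euler: "(\<lambda>j. harm (Suc j * M) - ln (real (Suc j * M))) \<longlonglongrightarrow> (euler_mascheroni :: real)" if "M \<ge> 1" for M :: nat
  proof -
    have "filterlim (\<lambda>j. Suc j * M) at_top sequentially"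
      by (rule filterlim_Suc_mult[OF that])
    from filterlim_compose[OF euler_mascheroni_LIMSEQ this] show ?thesis by simp
  qed
  have "D \<longlonglongrightarrow> (log_partition (2 * pi * \<kappa>) - 1 / (2 * pi * \<kappa>) * (pi\<^sup>2 / 6)) -
      (log_partition (2 * pi * (1 / \<kappa>)) - 1 / (2 * pi * (1 / \<kappa>)) * (pi\<^sup>2 / 6)) + euler_mascheroni / 2 - euler_mascheroni / 2"
    unfolding D_def using pos assms by (intro tendsto_add tendsto_diff tendsto_divide lim euler tendsto_const) auto
  moreover have "D \<longlonglongrightarrow> (ln (real K) - ln (real M)) / 2"
  proof (rule Lim_transform2)
    show "(\<lambda>j. (ln (real K) - ln (real M)) / 2) \<longlonglongrightarrow> (ln (real K) - ln (real M)) / 2" by simp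
    show "(\<lambda>j. (ln (real K) - ln (real M)) / 2 - D j) \<longlonglongrightarrow> 0"
    proof (rule Lim_null_comparison)
      show "(\<lambda>j. (1 / real M + 1 / real K) * inverse (real (Suc j))) \<longlonglongrightarrow> 0"
        using tendsto_mult_right_zero[OF LIMSEQ_inverse_real_of_nat] by simp
      have "\<bar>(ln (real K) - ln (real M)) / 2 - D j\<bar> \<le> (1 / real M + 1 / real K) * inverse (real (Suc j))" for j
      proof -
        have k: "\<kappa> = real (Suc j * K) / real (Suc j * M)" "1 / \<kappa> = real (Suc j * M) / real (Suc j * K)"
          unfolding \<kappa> of_nat_mult by simp_all
        have "ln (real (Suc j * M)) = ln (real (Suc j)) + ln (real M)"
             "ln (real (Suc j * K)) = ln (real (Suc j)) + ln (real K)"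
          unfolding of_nat_mult using assms by (simp_all only: ln_mult_pos of_nat_0_less_iff)
        hence "(ln (real K) - ln (real M)) / 2 - D j =
            - ((\<Sum>m=1..Suc j * M. bose (real m * \<kappa>) / real m) - (\<Sum>k=1..Suc j * K. bose (real k * (1 / \<kappa>)) / real k))"
          unfolding D_def by (simp add: field_simps)
        hence "\<bar>(ln (real K) - ln (real M)) / 2 - D j\<bar> = 
            \<bar>(\<Sum>m=1..Suc j * M. bose (real m * \<kappa>) / real m) - (\<Sum>k=1..Suc j * K. bose (real k * (1 / \<kappa>)) / real k)\<bar>" by simp
        also have "\<dots> \<le> 1 / real (Suc j * M) + 1 / real (Suc j * K)"
          unfolding k(2) unfolding k(1) using assms by (intro bose_sum_swap) auto
        also have "\<dots> = (1 / real M + 1 / real K) * inverse (real (Suc j))"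
          unfolding of_nat_mult by (simp add: divide_inverse algebra_simps del: of_nat_Suc)
        finally show ?thesis .
      qed
      thus "\<forall>\<^sub>F j in sequentially. norm ((ln (real K) - ln (real M)) / 2 - D j) \<le> (1 / real M + 1 / real K) * inverse (real (Suc j))"
        by simp
    qed
  qed
  ultimately have L: "(log_partition (2 * pi * \<kappa>) - 1 / (2 * pi * \<kappa>) * (pi\<^sup>2 / 6)) -
      (log_partition (2 * pi * (1 / \<kappa>)) - 1 / (2 * pi * (1 / \<kappa>)) * (pi\<^sup>2 / 6)) + euler_mascheroni / 2 - euler_mascheroni / 2 =
      (ln (real K) - ln (real M)) / 2"
    by (rule LIMSEQ_unique)
  have ln: "ln \<kappa> = ln (real K) - ln (real M)" using assms by (simp add: ln_div)
  have e: "1 / (2 * pi * \<kappa>) * (pi\<^sup>2 / 6) = pi / (12 * \<kappa>)" "1 / (2 * pi * (1 / \<kappa>)) * (pi\<^sup>2 / 6) = pi * \<kappa> / 12"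
    using pos by (simp_all add: field_simps power2_eq_square)
  have e': "2 * pi * (1 / \<kappa>) = 2 * pi / \<kappa>" by simp
  have "A = B + p - q + l / 2" if "A - p - (B - q) + g / 2 - g / 2 = l / 2" for A B p q l g :: real
    using that by simp
  from this[OF L[unfolded e, unfolded e', folded ln]] show ?thesis .
qed

section \<open>Coefficient bounds by Fourier integration\<close>

definition num_partitions :: "nat \<Rightarrow> nat" where
  "num_partitions n = card (partitions n)"

definition bounded_partitions :: "nat \<Rightarrow> nat \<Rightarrow> nat" where
  "bounded_partitions N n = card (parts_in {1..N} n)"

lemma bounded_partitions_eq: "n \<le> N \<Longrightarrow> bounded_partitions N n = num_partitions n"
  by (simp add: bounded_partitions_def num_partitions_def partitions_eq_parts_in[of n N])

lemma bounded_partitions_le: "bounded_partitions N n \<le> num_partitions n"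
  unfolding bounded_partitions_def num_partitions_def
  by (intro card_mono finite_partitions parts_in_subset_partitions) auto

lemma bounded_partitions_0: "bounded_partitions 0 n = (if n = 0 then 1 else 0)"
proof -
  have "parts_in {} n = (if n = 0 then {{#}} else {})" by (auto simp: parts_in_def)
  thus ?thesis by (simp add: bounded_partitions_def)
qed

lemma bounded_partitions_Suc:
  "bounded_partitions (Suc N) n = bounded_partitions N n +
     (if Suc N \<le> n then bounded_partitions (Suc N) (n - Suc N) else 0)"
proof -
  have ins: "{1..Suc N} = insert (Suc N) {1..N}" by auto
  have "(\<Sum>L\<in>parts_in (insert (Suc N) {1..N}) n. 1) = (\<Sum>L\<in>parts_in {1..N} n. 1) +
      (if Suc N \<le> n then \<Sum>L\<in>parts_in (insert (Suc N) {1..N}) (n - Suc N). 1 else (0::nat))"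
    by (rule sum_parts_in_insert) auto
  thus ?thesis unfolding bounded_partitions_def ins by simp
qed

text \<open>Adding the part \<open>Suc N\<close> gives F' = F + c F' for the values of the series.
  Partial sums are bounded first, because F' must be known to converge before the equation can be
  solved.\<close>

lemma bounded_partitions_sums:
  fixes r :: real
  assumes r: "0 \<le> r" "r < 1"
  shows "(\<lambda>i. bounded_partitions N i * r ^ i) sums (\<Prod>k=1..N. 1 / (1 - r ^ k))"
proof (induction N)
  case 0
  have "(\<lambda>i. bounded_partitions 0 i * r ^ i) = (\<lambda>i. if i = 0 then 1 else 0)"
    by (auto simp: bounded_partitions_0)
  thus ?case using sums_single[of 0 "\<lambda>_. 1::real"] by simp
next
  case (Suc N)
  define f where "f = (\<lambda>N i. real (bounded_partitions N i) * r ^ i)"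
  define c where "c = r ^ Suc N"
  have c: "0 \<le> c" "c < 1" using r by (auto simp: c_def power_less_one_iff simp del: power_Suc)
  have f_nonneg: "f N i \<ge> 0" for N i using r by (simp add: f_def)
  have rec: "f (Suc N) i = f N i + (if Suc N \<le> i then c * f (Suc N) (i - Suc N) else 0)" for i
  proof (cases "Suc N \<le> i")
    case True
    hence "r ^ i = c * r ^ (i - Suc N)" unfolding c_def by (simp flip: power_add power_Suc)
    thus ?thesis using True
      unfolding f_def bounded_partitions_Suc[of N i] by (simp add: algebra_simps)
  next
    case False
    thus ?thesis unfolding f_def bounded_partitions_Suc[of N i] by simp
  qed
  have sums: "f N sums (\<Prod>k=1..N. 1 / (1 - r ^ k))" using Suc.IH by (simp add: f_def)
  have shifted: "(\<Sum>i<n. if Suc N \<le> i then c * f (Suc N) (i - Suc N) else 0) \<le> c * (\<Sum>i<n. f (Suc N) i)" for n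
  proof -
    have "(\<Sum>i<n. if Suc N \<le> i then c * f (Suc N) (i - Suc N) else 0) = (\<Sum>i\<in>{i. i < n \<and> Suc N \<le> i}. c * f (Suc N) (i - Suc N))"
      by (simp add: sum.If_cases Int_def conj_commute)
    also have "\<dots> = (\<Sum>i<n - Suc N. c * f (Suc N) i)"
      by (rule sum.reindex_bij_witness[of _ "\<lambda>i. i + Suc N" "\<lambda>i. i - Suc N"]) auto
    also have "\<dots> \<le> (\<Sum>i<n. c * f (Suc N) i)"
      using c f_nonneg by (intro sum_mono2) auto
    finally show ?thesis by (simp add: sum_distrib_left)
  qed
  have bound: "(\<Sum>i<n. f (Suc N) i) \<le> (\<Prod>k=1..N. 1 / (1 - r ^ k)) / (1 - c)" for n
  proof -
    have "(\<Sum>i<n. f (Suc N) i) = (\<Sum>i<n. f N i) + (\<Sum>i<n. if Suc N \<le> i then c * f (Suc N) (i - Suc N) else 0)"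
      unfolding sum.distrib[symmetric] by (intro sum.cong refl rec)
    also have "(\<Sum>i<n. f N i) \<le> (\<Prod>k=1..N. 1 / (1 - r ^ k))"
      using sum_le_suminf[OF sums_summable[OF sums], of "{..<n}"] f_nonneg sums_unique[OF sums] by simp
    finally have "(\<Sum>i<n. f (Suc N) i) * (1 - c) \<le> (\<Prod>k=1..N. 1 / (1 - r ^ k))"
      using shifted[of n] by (simp add: algebra_simps)
    thus ?thesis using c by (simp add: pos_le_divide_eq)
  qed
  have summable: "summable (f (Suc N))"
    by (rule summableI_nonneg_bounded[OF f_nonneg bound])
  have "(\<lambda>i. if Suc N \<le> i then c * f (Suc N) (i - Suc N) else 0) sums (c * suminf (f (Suc N)))"
  proof -
    have "(\<lambda>i. c * f (Suc N) i) sums (c * suminf (f (Suc N)))"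
      by (intro sums_mult summable_sums summable)
    hence "(\<lambda>i. if Suc N \<le> i + Suc N then c * f (Suc N) (i + Suc N - Suc N) else 0) sums (c * suminf (f (Suc N)))"
      by simp
    thus ?thesis by (subst (asm) sums_zero_iff_shift) auto
  qed
  from sums_add[OF sums this] have "f (Suc N) sums ((\<Prod>k=1..N. 1 / (1 - r ^ k)) + c * suminf (f (Suc N)))"
    by (subst rec[abs_def])
  hence eq: "suminf (f (Suc N)) = (\<Prod>k=1..N. 1 / (1 - r ^ k)) + c * suminf (f (Suc N))"
    by (simp add: sums_iff)
  hence "suminf (f (Suc N)) = (\<Prod>k=1..Suc N. 1 / (1 - r ^ k))"
    using c by (simp add: field_simps flip: c_def power_Suc)
  thus ?case using summable_sums[OF summable] by (simp add: f_def)
qed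

lemma prod_eq_exp_sum:
  fixes t :: real
  assumes t: "t > 0"
  shows "(\<Prod>k=1..N. 1 / (1 - exp (-t) ^ k)) = exp (\<Sum>m. (\<Sum>k=1..N. exp (-t) ^ (k * Suc m)) / real (Suc m))"
proof -
  define r where "r = exp (-t)"
  have r: "0 < r" "r < 1" using t by (simp_all add: r_def)
  have ln: "(\<lambda>m. r ^ (k * Suc m) / real (Suc m)) sums - ln (1 - r ^ k)" if "k \<ge> 1" for k
  proof -
    have "r ^ k < 1" "r ^ k > 0" using r that by (auto simp: power_less_one_iff)
    hence "(\<lambda>n. - ((r ^ k) ^ n / of_nat n)) sums ln (1 - r ^ k)"
      using ln_series'[of "- (r ^ k)"] by simp
    hence "(\<lambda>n. (r ^ k) ^ n / of_nat n) sums - ln (1 - r ^ k)"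
      using sums_minus by fastforce
    hence "(\<lambda>m. (r ^ k) ^ Suc m / of_nat (Suc m)) sums - ln (1 - r ^ k)"
      by (subst sums_Suc_iff) simp
    thus ?thesis by (simp only: power_mult)
  qed
  have "(\<lambda>m. \<Sum>k=1..N. r ^ (k * Suc m) / real (Suc m)) sums (\<Sum>k=1..N. - ln (1 - r ^ k))"
    by (intro sums_sum ln) auto
  hence "(\<Sum>m. (\<Sum>k=1..N. r ^ (k * Suc m)) / real (Suc m)) = (\<Sum>k=1..N. - ln (1 - r ^ k))"
    by (simp add: sums_iff sum_divide_distrib)
  also have "exp \<dots> = (\<Prod>k=1..N. exp (- ln (1 - r ^ k)))" by (simp add: exp_sum)
  also have "\<dots> = (\<Prod>k=1..N. 1 / (1 - r ^ k))"
  proof (rule prod.cong[OF refl])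
    fix k assume "k \<in> {1..N}"
    hence "r ^ k < 1" using r by (auto simp: power_less_one_iff)
    thus "exp (- ln (1 - r ^ k)) = 1 / (1 - r ^ k)" by (simp add: exp_minus inverse_eq_divide)
  qed
  finally show ?thesis by (simp add: r_def)
qed

lemma log_partition_term_eq:
  assumes "t > 0"
  shows "(\<lambda>k. exp (-t) ^ (Suc k * Suc m)) sums (1 / (exp (real (Suc m) * t) - 1))"
proof -
  define x where "x = exp (-t) ^ Suc m"
  have x: "x = exp (- (real (Suc m) * t))" unfolding x_def exp_of_nat_mult[symmetric] by (simp only: mult_minus_right)
  have "0 < real (Suc m) * t" using assms by simp
  hence "norm x < 1" by (simp only: x) simp
  hence "(\<lambda>k. x * x ^ k) sums (x * (1 / (1 - x)))" by (intro sums_mult geometric_sums)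
  moreover have "x * (1 / (1 - x)) = 1 / (exp (real (Suc m) * t) - 1)"
  proof -
    have E: "exp (real (Suc m) * t) = 1 / x" unfolding x exp_minus by (simp add: inverse_eq_divide)
    have "x > 0" "x < 1" using \<open>0 < real (Suc m) * t\<close> by (simp_all only: x) simp_all
    thus ?thesis unfolding E by (simp add: divide_simps)
  qed
  moreover have "x * x ^ k = exp (-t) ^ (Suc k * Suc m)" for k
    unfolding x_def by (metis power_Suc power_mult mult.commute)
  ultimately show ?thesis by simp
qed

text \<open>Tannery's theorem exchanges the limit in N with the sum over m; the terms of
  \<open>log_partition\<close> dominate because all truncated sums are nonnegative and increase to
  them.\<close>

lemma prod_tendsto_exp_log_partition:
  assumes t: "t > 0"
  shows "(\<lambda>N. \<Prod>k=1..N. 1 / (1 - exp (-t) ^ k)) \<longlonglongrightarrow> exp (log_partition t)"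
    and "(\<Prod>k=1..N. 1 / (1 - exp (-t) ^ k)) \<le> exp (log_partition t)"
proof -
  define a where "a = (\<lambda>m N. (\<Sum>k=1..N. exp (-t) ^ (k * Suc m)) / real (Suc m))"
  define b where "b = (\<lambda>m. 1 / (real (Suc m) * (exp (real (Suc m) * t) - 1)))"
  have shift: "(\<Sum>k=1..N. exp (-t) ^ (k * Suc m)) = (\<Sum>k<N. exp (-t) ^ (Suc k * Suc m))" for N m
    by (rule sum.reindex_bij_witness[of _ Suc "\<lambda>k. k - 1"]) auto
  have lim: "(\<lambda>N. a m N) \<longlonglongrightarrow> b m" for m
  proof -
    have "(\<lambda>N. (\<Sum>k<N. exp (-t) ^ (Suc k * Suc m)) / real (Suc m)) \<longlonglongrightarrow> 1 / (exp (real (Suc m) * t) - 1) / real (Suc m)"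
      using log_partition_term_eq[OF t, of m] unfolding sums_def by (intro tendsto_divide) auto
    thus ?thesis unfolding a_def b_def shift by (simp add: mult.commute)
  qed
  have a_nonneg: "0 \<le> a m N" for m N by (auto simp: a_def intro!: sum_nonneg divide_nonneg_nonneg)
  have a_le: "a m N \<le> b m" for m N
  proof -
    have "(\<Sum>k<N. exp (-t) ^ (Suc k * Suc m)) \<le> 1 / (exp (real (Suc m) * t) - 1)"
      using sum_le_suminf[OF sums_summable[OF log_partition_term_eq[OF t, of m]], of "{..<N}"]
        sums_unique[OF log_partition_term_eq[OF t, of m]] by simp
    hence "(\<Sum>k<N. exp (-t) ^ (Suc k * Suc m)) / real (Suc m) \<le> 1 / (exp (real (Suc m) * t) - 1) / real (Suc m)"
      by (rule divide_right_mono) simp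
    thus ?thesis unfolding a_def b_def shift by (simp add: mult.commute)
  qed
  have sum_b: "summable b" unfolding b_def by (rule summable_log_partition[OF t])
  have "(\<lambda>N. suminf (\<lambda>m. a m N)) \<longlonglongrightarrow> suminf b"
    using tannerys_theorem[of a b sequentially b] lim sum_b a_nonneg a_le
    by (auto intro!: always_eventually)
  hence "(\<lambda>N. exp (suminf (\<lambda>m. a m N))) \<longlonglongrightarrow> exp (suminf b)" by (rule tendsto_exp)
  moreover have eq: "exp (suminf (\<lambda>m. a m N)) = (\<Prod>k=1..N. 1 / (1 - exp (-t) ^ k))" for N
    unfolding a_def by (rule prod_eq_exp_sum[OF t, symmetric])
  moreover have b: "suminf b = log_partition t" by (simp add: b_def log_partition_def)
  ultimately show "(\<lambda>N. \<Prod>k=1..N. 1 / (1 - exp (-t) ^ k)) \<longlonglongrightarrow> exp (log_partition t)" by simp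
  have "summable (\<lambda>m. a m N)"
    by (rule summable_comparison_test'[OF sum_b, of 0]) (use a_nonneg a_le in auto)
  hence "suminf (\<lambda>m. a m N) \<le> suminf b" using a_le sum_b by (intro suminf_le) auto
  thus "(\<Prod>k=1..N. 1 / (1 - exp (-t) ^ k)) \<le> exp (log_partition t)"
    unfolding eq[symmetric] b[symmetric] by simp
qed

text \<open>Partitions with parts at most N are all partitions once N >= n, and never more.
  Tannery's theorem therefore passes from the finite to the infinite product.\<close>

lemma num_partitions_sums_exp:
  assumes t: "t > 0"
  shows "(\<lambda>n. num_partitions n * exp (-t) ^ n) sums exp (log_partition t)"
proof -
  define r where "r = exp (-t)"
  have r: "0 \<le> r" "r < 1" using t by (simp_all add: r_def)
  have "(\<Sum>i<n. num_partitions i * r ^ i) \<le> exp (log_partition t)" for n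
  proof -
    have "(\<Sum>i<n. num_partitions i * r ^ i) = (\<Sum>i<n. bounded_partitions n i * r ^ i)"
      by (intro sum.cong refl) (simp add: bounded_partitions_eq)
    also have "\<dots> \<le> (\<Prod>k=1..n. 1 / (1 - r ^ k))"
      using sum_le_suminf[OF sums_summable[OF bounded_partitions_sums[OF r, of n]], of "{..<n}"]
        sums_unique[OF bounded_partitions_sums[OF r, of n]] r by simp
    also have "\<dots> \<le> exp (log_partition t)" unfolding r_def by (rule prod_tendsto_exp_log_partition[OF t])
    finally show ?thesis .
  qed
  hence summable: "summable (\<lambda>i. num_partitions i * r ^ i)"
    using r by (intro summableI_nonneg_bounded) auto
  have "(\<lambda>N. suminf (\<lambda>i. bounded_partitions N i * r ^ i)) \<longlonglongrightarrow> suminf (\<lambda>i. num_partitions i * r ^ i)"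
  proof (rule tannerys_theorem[THEN conjunct2, THEN conjunct2, OF _ _ summable])
    fix i
    have "\<forall>\<^sub>F N in sequentially. bounded_partitions N i * r ^ i = num_partitions i * r ^ i"
      using eventually_ge_at_top[of i] by eventually_elim (simp add: bounded_partitions_eq)
    thus "(\<lambda>N. bounded_partitions N i * r ^ i) \<longlonglongrightarrow> num_partitions i * r ^ i"
      by (rule tendsto_eventually)
  qed (use r bounded_partitions_le in \<open>auto intro!: always_eventually mult_right_mono\<close>)
  also have "(\<lambda>N. suminf (\<lambda>i. bounded_partitions N i * r ^ i)) = (\<lambda>N. \<Prod>k=1..N. 1 / (1 - r ^ k))"
    using sums_unique[OF bounded_partitions_sums[OF r]] by simp
  finally have "suminf (\<lambda>i. num_partitions i * r ^ i) = exp (log_partition t)"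
    using prod_tendsto_exp_log_partition(1)[OF t] unfolding r_def by (rule LIMSEQ_unique)
  thus ?thesis using summable_sums[OF summable] by (simp add: r_def)
qed

section \<open>The partition series on the half-plane\<close>

definition partition_series :: "complex \<Rightarrow> complex" where
  "partition_series q = (\<Sum>n. of_nat (num_partitions n) * q ^ n)"

lemma summable_num_partitions:
  fixes r :: real
  assumes "0 \<le> r" "r < 1"
  shows "summable (\<lambda>n. num_partitions n * r ^ n)"
proof (cases "r = 0")
  case True
  thus ?thesis by (intro summable_finite[of "{0}"]) auto
next
  case False
  with assms have "r = exp (- (- ln r))" "- ln r > 0" by auto
  thus ?thesis using sums_summable[OF num_partitions_sums_exp[of "- ln r"]] by simp
qed

lemma partition_series_sums:
  assumes "norm q < 1"
  shows "(\<lambda>n. of_nat (num_partitions n) * q ^ n) sums partition_series q"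
  unfolding partition_series_def
proof (rule summable_sums, rule summable_norm_cancel)
  show "summable (\<lambda>n. norm (of_nat (num_partitions n) * q ^ n))"
    using summable_num_partitions[of "norm q"] assms by (simp add: norm_mult norm_power)
qed

lemma partition_series_holomorphic: "partition_series holomorphic_on ball 0 1"
  by (rule power_series_holomorphic[of 0 1 "\<lambda>n. of_nat (num_partitions n)"]) (simp add: partition_series_sums)

lemma partition_series_exp_real:
  assumes "t > 0"
  shows "partition_series (exp (- complex_of_real t)) = of_real (exp (log_partition t))"
proof -
  have "(\<lambda>n. complex_of_real (num_partitions n * exp (-t) ^ n)) sums of_real (exp (log_partition t))"
    by (intro sums_of_real num_partitions_sums_exp assms)
  hence "(\<lambda>n. of_nat (num_partitions n) * exp (- complex_of_real t) ^ n) sums of_real (exp (log_partition t))"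
    by (simp flip: exp_of_real)
  thus ?thesis by (simp add: partition_series_def sums_iff)
qed

text \<open>The coefficients are nonnegative, so the series without its constant term 1 is dominated
  by its value at the modulus.\<close>

lemma norm_partition_series_minus_1_le:
  assumes "Re t > 0"
  shows "norm (partition_series (exp (-t)) - 1) \<le> exp (log_partition (Re t)) - 1"
proof -
  define r where "r = exp (- Re t)"
  have r: "r < 1" "norm (exp (-t)) = r" using assms by (auto simp: r_def)
  have "(\<lambda>n. of_nat (num_partitions n) * exp (-t) ^ n) sums partition_series (exp (-t))"
    using r by (intro partition_series_sums) simp
  hence s: "(\<lambda>n. of_nat (num_partitions (Suc n)) * exp (-t) ^ Suc n) sums (partition_series (exp (-t)) - num_partitions 0)"
    by (subst sums_Suc_iff) simp
  have "(\<lambda>n. num_partitions n * r ^ n) sums exp (log_partition (Re t))"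
    unfolding r_def by (rule num_partitions_sums_exp[OF assms])
  hence s': "(\<lambda>n. num_partitions (Suc n) * r ^ Suc n) sums (exp (log_partition (Re t)) - num_partitions 0)"
    by (subst sums_Suc_iff) simp
  have "num_partitions 0 = 1" using bounded_partitions_0[of 0] by (simp add: bounded_partitions_eq)
  moreover have "norm (partition_series (exp (-t)) - num_partitions 0) \<le> exp (log_partition (Re t)) - num_partitions 0"
  proof -
    have "norm (\<Sum>n. of_nat (num_partitions (Suc n)) * exp (-t) ^ Suc n) \<le> (\<Sum>n. num_partitions (Suc n) * r ^ Suc n)"
      by (rule norm_suminf_le[OF _ sums_summable[OF s']]) (simp only: norm_mult norm_power r norm_of_nat order_refl)
    thus ?thesis using sums_unique[OF s] sums_unique[OF s'] by simp
  qed
  ultimately show ?thesis by simp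
qed

lemma partition_series_inversion_rational:
  fixes t :: complex
  assumes "M \<ge> 1" "K \<ge> 1" and t: "t = complex_of_real (2 * pi * (real K / real M))"
  shows "partition_series (exp (-t)) =
    csqrt (t / (2 * pi)) * exp (pi\<^sup>2 / 6 / t - t / 24) * partition_series (exp (- (4 * pi\<^sup>2 / t)))"
proof -
  define \<kappa> where "\<kappa> = real K / real M"
  have \<kappa>: "\<kappa> > 0" using assms by (simp add: \<kappa>_def)
  have t\<kappa>: "t = complex_of_real (2 * pi * \<kappa>)" unfolding \<kappa>_def by (rule t)
  have "4 * pi\<^sup>2 / (2 * pi * \<kappa>) = 2 * pi / \<kappa>"
    using \<kappa> by (simp add: power2_eq_square field_simps)
  moreover have "4 * pi\<^sup>2 / t = of_real (4 * pi\<^sup>2 / (2 * pi * \<kappa>))" unfolding t\<kappa> by simp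
  ultimately have t': "4 * pi\<^sup>2 / t = of_real (2 * pi / \<kappa>)" by (simp only:)
  have "csqrt (t / (2 * pi)) = of_real (sqrt \<kappa>)"
    unfolding t\<kappa> of_real_divide[symmetric] using \<kappa> by (simp add: csqrt_of_real_nonneg)
  also have "sqrt \<kappa> = exp (ln \<kappa> / 2)"
    using \<kappa> exp_ln[of "sqrt \<kappa>"] by (simp add: ln_sqrt)
  finally have sq: "csqrt (t / (2 * pi)) = of_real (exp (ln \<kappa> / 2))" .
  have ex: "exp (pi\<^sup>2 / 6 / t - t / 24) = of_real (exp (pi / (12 * \<kappa>) - pi * \<kappa> / 12))"
    unfolding exp_of_real[symmetric] t\<kappa> using \<kappa>
    by (intro arg_cong[of _ _ exp]) (simp add: power2_eq_square field_simps)
  have "partition_series (exp (-t)) = of_real (exp (log_partition (2 * pi * \<kappa>)))"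
    using partition_series_exp_real[of "2 * pi * \<kappa>"] \<kappa> by (simp add: t\<kappa>)
  also have "log_partition (2 * pi * \<kappa>) = ln \<kappa> / 2 + (pi / (12 * \<kappa>) - pi * \<kappa> / 12) + log_partition (2 * pi / \<kappa>)"
    using log_partition_inversion_rational[OF assms(1,2) \<kappa>_def] by simp
  also have "complex_of_real (exp \<dots>) = of_real (exp (ln \<kappa> / 2)) * of_real (exp (pi / (12 * \<kappa>) - pi * \<kappa> / 12))
      * of_real (exp (log_partition (2 * pi / \<kappa>)))"
    by (simp only: exp_add of_real_mult)
  also have "complex_of_real (exp (log_partition (2 * pi / \<kappa>))) = partition_series (exp (- (4 * pi\<^sup>2 / t)))"
    unfolding t' using partition_series_exp_real[of "2 * pi / \<kappa>"] \<kappa> by simp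
  finally show ?thesis by (simp only: sq ex)
qed

text \<open>The transformation law of Dedekind's eta function. Both sides are holomorphic in the
  half-plane and agree at the points 2 pi (n + 2) / (n + 1), which accumulate at 2 pi, so the
  identity theorem applies.\<close>

theorem partition_series_inversion:
  fixes t :: complex
  assumes "Re t > 0"
  shows "partition_series (exp (-t)) =
    csqrt (t / (2 * pi)) * exp (pi\<^sup>2 / 6 / t - t / 24) * partition_series (exp (- (4 * pi\<^sup>2 / t)))"
proof -
  define S where "S = {t::complex. Re t > 0}"
  define U where "U = (\<lambda>n. complex_of_real (2 * pi * (real (Suc (Suc n)) / real (Suc n)))) ` UNIV"
  define f where "f = (\<lambda>t::complex. partition_series (exp (-t)) -
    csqrt (t / (2 * pi)) * exp (pi\<^sup>2 / 6 / t - t / 24) * partition_series (exp (- (4 * pi\<^sup>2 / t))))"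
  have Re_inv: "Re (4 * pi\<^sup>2 / t) > 0" if "Re t > 0" for t :: complex
  proof -
    have "Re (complex_of_real (4 * pi\<^sup>2) / t) = 4 * pi\<^sup>2 * (Re t / ((Re t)\<^sup>2 + (Im t)\<^sup>2))"
      by (simp add: Re_divide' cmod_power2)
    also have "\<dots> > 0" using that by (intro mult_pos_pos divide_pos_pos add_pos_nonneg) auto
    finally show ?thesis by simp
  qed
  have "f t = 0"
  proof (rule analytic_continuation[of f S U "of_real (2 * pi)"])
    have 1: "(\<lambda>t::complex. partition_series (exp (-t))) holomorphic_on S"
      by (rule holomorphic_on_compose_gen[OF _ partition_series_holomorphic, unfolded o_def])
         (auto intro!: holomorphic_intros simp: S_def)
    have 2: "(\<lambda>t::complex. partition_series (exp (- (4 * pi\<^sup>2 / t)))) holomorphic_on S"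
    proof (rule holomorphic_on_compose_gen[OF _ partition_series_holomorphic, unfolded o_def])
      show "(\<lambda>t::complex. exp (- (4 * pi\<^sup>2 / t))) holomorphic_on S"
        by (intro holomorphic_intros) (auto simp: S_def)
      show "(\<lambda>t::complex. exp (- (4 * pi\<^sup>2 / t))) ` S \<subseteq> ball 0 1"
        using Re_inv by (simp add: image_subset_iff S_def)
    qed
    have 3: "(\<lambda>t::complex. csqrt (t / (2 * pi))) holomorphic_on S"
    proof (intro holomorphic_intros)
      fix t assume "t \<in> S"
      hence "Re (t / (2 * pi)) > 0" by (simp add: S_def flip: of_real_mult[of 2 pi, simplified])
      thus "t / (2 * pi) \<notin> \<real>\<^sub>\<le>\<^sub>0" by (auto simp: complex_nonpos_Reals_iff)
    qed auto
    have 4: "(\<lambda>t::complex. exp (pi\<^sup>2 / 6 / t - t / 24)) holomorphic_on S"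
      by (intro holomorphic_intros) (auto simp: S_def)
    show "f holomorphic_on S"
      unfolding f_def by (intro holomorphic_on_diff holomorphic_on_mult 1 2 3 4)
    have "convex S" unfolding S_def using convex_halfspace_Re_gt[of 0] by simp
    thus "connected S" by (rule convex_connected)
    show "open S" unfolding S_def by (rule open_halfspace_Re_gt)
    show "U \<subseteq> S" by (auto simp: U_def S_def)
    show "complex_of_real (2 * pi) \<in> S" by (simp add: S_def)
    show "t \<in> S" using assms by (simp add: S_def)
    show "f z = 0" if "z \<in> U" for z
    proof -
      obtain n where "z = complex_of_real (2 * pi * (real (Suc (Suc n)) / real (Suc n)))"
        using \<open>z \<in> U\<close> unfolding U_def by blast
      from partition_series_inversion_rational[OF _ _ this] show ?thesis by (simp add: f_def)
    qed
    show "complex_of_real (2 * pi) islimpt U"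
      unfolding islimpt_sequential
    proof (intro exI conjI allI)
      show "(\<lambda>n. complex_of_real (2 * pi * (1 + inverse (real (Suc n))))) \<longlonglongrightarrow> complex_of_real (2 * pi)"
      proof -
        have "(\<lambda>n. complex_of_real (2 * pi * (1 + inverse (real (Suc n))))) \<longlonglongrightarrow> complex_of_real (2 * pi * (1 + 0))"
          by (intro tendsto_intros LIMSEQ_inverse_real_of_nat)
        thus ?thesis by simp
      qed
      have "real (Suc (Suc n)) / real (Suc n) = 1 + inverse (real (Suc n))" for n
        by (simp add: field_simps)
      hence "complex_of_real (2 * pi * (1 + inverse (real (Suc n)))) \<in> U" for n
        unfolding U_def by (intro image_eqI[of _ _ n]) simp_all
      moreover have "2 * pi * (1 + inverse (real (Suc n))) \<noteq> 2 * pi" for n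
        by (simp del: of_nat_Suc)
      ultimately show "complex_of_real (2 * pi * (1 + inverse (real (Suc n)))) \<in> U - {complex_of_real (2 * pi)}" for n
        by (simp only: Diff_iff singleton_iff of_real_eq_iff simp_thms)
    qed
  qed
  thus ?thesis by (simp add: f_def)
qed

section \<open>Partition numbers as Fourier integrals\<close>

lemma exp_period_integral:
  fixes k :: int and y :: real
  shows "((\<lambda>\<theta>. exp (of_int k * Complex y \<theta>)) has_integral (if k = 0 then 2 * of_real pi else 0)) {-pi..pi}"
proof (cases "k = 0")
  case True
  thus ?thesis using has_integral_const_real[of "1::complex" "-pi" pi] by (simp add: scaleR_conv_of_real)
next
  case False
  define F where "F = (\<lambda>\<theta>. exp (of_int k * Complex y \<theta>) / (of_int k * \<i>))"
  have C: "Complex y \<theta> = of_real y + \<i> * of_real \<theta>" for \<theta> by (simp add: complex_eq_iff)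
  have "((\<lambda>\<theta>. exp (of_int k * Complex y \<theta>)) has_integral F pi - F (-pi)) {-pi..pi}"
  proof (rule fundamental_theorem_of_calculus)
    fix \<theta> :: real
    have "((\<lambda>w. exp (of_int k * (of_real y + \<i> * w)) / (of_int k * \<i>)) has_field_derivative
        exp (of_int k * (of_real y + \<i> * of_real \<theta>))) (at (of_real \<theta>))"
      using False by (auto intro!: derivative_eq_intros)
    from has_vector_derivative_real_field[OF this]
    show "(F has_vector_derivative exp (of_int k * Complex y \<theta>)) (at \<theta> within {-pi..pi})"
      unfolding F_def C .
  qed simp
  moreover have "F pi = F (-pi)"
  proof -
    have "of_int k * Complex y pi = of_int k * Complex y (-pi) + of_int k * (2 * of_real pi * \<i>)"
      by (simp add: C algebra_simps)
    hence "exp (of_int k * Complex y pi) = exp (of_int k * Complex y (-pi)) * exp (of_int k * (2 * of_real pi * \<i>))"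
      by (simp only: exp_add)
    also have "exp (of_int k * (2 * of_real pi * \<i>)) = 1"
      using exp_integer_2pi[of "of_int k"] by (simp add: mult_ac)
    finally show ?thesis by (simp add: F_def)
  qed
  ultimately show ?thesis using False by simp
qed

text \<open>Cauchy's coefficient formula on the circle of radius exp (-y), parametrised by the
  segment y + i \<theta> in the half-plane, where the inversion is available.\<close>

lemma num_partitions_integral:
  assumes "y > 0"
  shows "((\<lambda>\<theta>. partition_series (exp (- Complex y \<theta>)) * exp (of_nat n * Complex y \<theta>))
           has_integral (2 * of_real pi * of_nat (num_partitions n))) {-pi..pi}"
proof -
  define f where "f = (\<lambda>N \<theta>. \<Sum>m<N. of_nat (num_partitions m) * exp (of_int (int n - int m) * Complex y \<theta>))"
  define g where "g = (\<lambda>\<theta>. \<Sum>m. of_nat (num_partitions m) * exp (of_int (int n - int m) * Complex y \<theta>))"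
  define r where "r = exp (-y)"
  have r: "0 \<le> r" "r < 1" using assms by (simp_all add: r_def)
  have eq: "of_nat (num_partitions m) * exp (of_int (int n - int m) * Complex y \<theta>) =
      (of_nat (num_partitions m) * exp (- Complex y \<theta>) ^ m) * exp (of_nat n * Complex y \<theta>)" for m \<theta>
    by (simp add: exp_of_nat_mult[symmetric] algebra_simps flip: exp_add)
  have ul: "uniform_limit {-pi..pi} f g sequentially"
    unfolding f_def g_def
  proof (rule Weierstrass_m_test)
    show "summable (\<lambda>m. num_partitions m * r ^ m * exp (n * y))"
      using summable_mult2[OF summable_num_partitions[OF r]] by simp
    show "norm (of_nat (num_partitions m) * exp (of_int (int n - int m) * Complex y \<theta>)) \<le>
        num_partitions m * r ^ m * exp (n * y)" for m \<theta>
      unfolding eq norm_mult norm_power norm_exp_eq_Re by (simp add: r_def)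
  qed
  have cont: "continuous_on {-pi..pi} (f N)" for N
  proof -
    have "Complex y \<theta> = of_real y + \<i> * of_real \<theta>" for \<theta> by (simp add: complex_eq_iff)
    thus ?thesis unfolding f_def by (simp only:) (intro continuous_intros)
  qed
  obtain I J where IJ: "\<And>N. (f N has_integral I N) {-pi..pi}" "(g has_integral J) {-pi..pi}" "I \<longlonglongrightarrow> J"
    by (rule uniform_limit_integral[OF ul cont sequentially_bot]) blast
  have "I N = 2 * of_real pi * of_nat (num_partitions n)" if "N > n" for N
  proof -
    have "(f N has_integral (\<Sum>m<N. of_nat (num_partitions m) * (if int n - int m = 0 then 2 * of_real pi else 0))) {-pi..pi}"
      unfolding f_def by (intro has_integral_sum has_integral_mult_right exp_period_integral) auto
    hence "I N = (\<Sum>m<N. of_nat (num_partitions m) * (if int n - int m = 0 then 2 * of_real pi else 0))"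
      using IJ(1) has_integral_unique by blast
    also have "\<dots> = (\<Sum>m<N. if m = n then 2 * of_real pi * of_nat (num_partitions n) else 0)"
      by (intro sum.cong refl) auto
    finally show ?thesis using that by simp
  qed
  hence "\<forall>\<^sub>F N in sequentially. I N = 2 * of_real pi * of_nat (num_partitions n)"
    by (rule eventually_mono[OF eventually_gt_at_top[of n]])
  hence "I \<longlonglongrightarrow> 2 * of_real pi * of_nat (num_partitions n)" by (rule tendsto_eventually)
  with IJ(3) have "J = 2 * of_real pi * of_nat (num_partitions n)" by (rule LIMSEQ_unique)
  moreover have "g = (\<lambda>\<theta>. partition_series (exp (- Complex y \<theta>)) * exp (of_nat n * Complex y \<theta>))"
  proof
    fix \<theta>
    have "norm (exp (- Complex y \<theta>)) < 1" using assms by simp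
    from sums_mult2[OF partition_series_sums[OF this], of "exp (of_nat n * Complex y \<theta>)"]
    show "g \<theta> = partition_series (exp (- Complex y \<theta>)) * exp (of_nat n * Complex y \<theta>)"
      unfolding g_def eq by (rule sums_unique[symmetric])
  qed
  ultimately show ?thesis using IJ(2) by simp
qed

section \<open>A primitive of exp (z^2) and its behaviour in both half-planes\<close>

lemma gaussian_half_line:
  "((\<lambda>x. exp (- x\<^sup>2)) has_integral (sqrt pi / 2)) {0..}" (is ?th1)
  and integral_gaussian_le: "T \<ge> 0 \<Longrightarrow> integral {0..T} (\<lambda>x. exp (- x\<^sup>2)) \<le> sqrt pi / 2"
  and integral_gaussian_tendsto:
    "((\<lambda>T. integral {0..T} (\<lambda>x. exp (- x\<^sup>2))) \<longlongrightarrow> sqrt pi / 2) at_top"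
proof -
  let ?f = "\<lambda>x::real. indicator {0..} x *\<^sub>R exp (- x\<^sup>2)"
  have b: "has_bochner_integral lborel ?f (sqrt pi / 2)" by (rule gaussian_moment_0)
  hence integ: "integrable lborel ?f" and eq: "integral\<^sup>L lborel ?f = sqrt pi / 2"
    unfolding has_bochner_integral_iff by blast+
  from has_integral_integral_lborel[OF integ] have "(?f has_integral (sqrt pi / 2)) UNIV"
    unfolding eq .
  moreover have "?f = (\<lambda>x. if x \<in> {0..} then exp (- x\<^sup>2) else 0)" by (auto simp: indicator_def)
  ultimately show 1: ?th1 by (simp only: has_integral_restrict_UNIV)
  have int: "(\<lambda>x::real. exp (- x\<^sup>2)) integrable_on {0..T}" for T
    by (intro integrable_continuous_real continuous_intros)
  show "integral {0..T} (\<lambda>x. exp (- x\<^sup>2)) \<le> sqrt pi / 2" if "T \<ge> 0" for T :: real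
  proof -
    have "integral {0..T} (\<lambda>x. exp (- x\<^sup>2)) \<le> integral {0..} (\<lambda>x. exp (- x\<^sup>2))"
      using 1 by (intro integral_subset_le int) (auto simp: has_integral_iff)
    thus ?thesis using 1 by (simp add: has_integral_iff)
  qed
  have "((\<lambda>T. integral\<^sup>L lborel (\<lambda>x. indicator {..T} x *\<^sub>R ?f x)) \<longlongrightarrow> integral\<^sup>L lborel ?f) at_top"
    by (rule tendsto_integral_at_top[OF _ integ]) simp
  moreover have "integral\<^sup>L lborel (\<lambda>x. indicator {..T} x *\<^sub>R ?f x) = integral {0..T} (\<lambda>x. exp (- x\<^sup>2))" for T
  proof -
    have "integrable lborel (\<lambda>x. indicator {..T} x *\<^sub>R ?f x)"
      by (rule integrable_mult_indicator[OF _ integ]) simp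
    hence "((\<lambda>x. indicator {..T} x *\<^sub>R ?f x) has_integral integral\<^sup>L lborel (\<lambda>x. indicator {..T} x *\<^sub>R ?f x)) UNIV"
      by (rule has_integral_integral_lborel)
    moreover have "(\<lambda>x. indicator {..T} x *\<^sub>R ?f x) = (\<lambda>x. if x \<in> {0..T} then exp (- x\<^sup>2) else 0)"
      by (auto simp: indicator_def)
    ultimately have "((\<lambda>x. exp (- x\<^sup>2)) has_integral integral\<^sup>L lborel (\<lambda>x. indicator {..T} x *\<^sub>R ?f x)) {0..T}"
      by (simp only: has_integral_restrict_UNIV)
    thus ?thesis by (simp add: has_integral_iff)
  qed
  ultimately show "((\<lambda>T. integral {0..T} (\<lambda>x. exp (- x\<^sup>2))) \<longlongrightarrow> sqrt pi / 2) at_top" unfolding eq by simp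
qed

text \<open>The function is sqrt pi / 2 times the imaginary error function. It tends to i sqrt pi /
  2 along every upward vertical ray, and if Im z >= 0 the remaining integral along the ray from z is
  at most exp (Re (z^2)) times the half-line Gaussian integral. Oddness gives the lower
  half-plane.\<close>

lemma gauss_primitive_exists:
  obtains G :: "complex \<Rightarrow> complex"
  where "\<And>z. (G has_field_derivative exp (z\<^sup>2)) (at z)"
        "\<And>z. Im z \<ge> 0 \<Longrightarrow> norm (G z - \<i> * (sqrt pi / 2)) \<le> sqrt pi / 2 * exp (Re (z\<^sup>2))"
        "\<And>z. Im z \<le> 0 \<Longrightarrow> norm (G z + \<i> * (sqrt pi / 2)) \<le> sqrt pi / 2 * exp (Re (z\<^sup>2))"
proof -
  obtain G0 :: "complex \<Rightarrow> complex" where G0: "\<And>z. (G0 has_field_derivative exp (z\<^sup>2)) (at z)"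
  proof -
    have "(\<lambda>z::complex. exp (z\<^sup>2)) holomorphic_on UNIV" by (intro holomorphic_intros)
    from holomorphic_convex_primitive'[OF convex_UNIV open_UNIV this] show ?thesis using that by auto
  qed
  define G where "G = (\<lambda>z. G0 z - G0 0)"
  have G: "(G has_field_derivative exp (z\<^sup>2)) (at z)" for z
    unfolding G_def by (auto intro!: derivative_eq_intros G0)
  have G_zero: "G 0 = 0" by (simp add: G_def)
  have odd: "G (-z) = - G z" for z
  proof -
    have "((\<lambda>z. G (-z) + G z) has_field_derivative 0) (at z)" for z
    proof -
      have "((\<lambda>z. G (-z)) has_field_derivative exp ((-z)\<^sup>2) * (-1)) (at z)"
        by (rule DERIV_chain2[OF G]) (auto intro!: derivative_eq_intros)
      from DERIV_add[OF this G] show ?thesis by simp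
    qed
    then obtain c where "\<And>z. G (-z) + G z = c"
      using has_field_derivative_zero_constant[of UNIV "\<lambda>z. G (-z) + G z"] by auto
    from this[of 0] this[of z] show ?thesis by (simp add: G_zero eq_neg_iff_add_eq_0)
  qed
  have vert: "((\<lambda>\<tau>. \<i> * exp ((z + \<i> * of_real \<tau>)\<^sup>2)) has_integral (G (z + \<i> * of_real T) - G z)) {0..T}"
    if "T \<ge> 0" for z T
  proof -
    have "((\<lambda>\<tau>. \<i> * exp ((z + \<i> * of_real \<tau>)\<^sup>2)) has_integral
        (G (z + \<i> * of_real T) - G (z + \<i> * of_real 0))) {0..T}"
    proof (rule fundamental_theorem_of_calculus[OF that])
      fix \<tau> :: real
      have "((\<lambda>w. G (z + \<i> * w)) has_field_derivative (exp ((z + \<i> * of_real \<tau>)\<^sup>2) * \<i>)) (at (of_real \<tau>))"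
        by (rule DERIV_chain2[OF G]) (auto intro!: derivative_eq_intros)
      from has_vector_derivative_real_field[OF this]
      show "((\<lambda>\<tau>. G (z + \<i> * of_real \<tau>)) has_vector_derivative \<i> * exp ((z + \<i> * of_real \<tau>)\<^sup>2)) (at \<tau> within {0..T})"
        by (simp add: mult.commute)
    qed
    thus ?thesis by simp
  qed
  have Gi: "G (\<i> * of_real T) = \<i> * of_real (integral {0..T} (\<lambda>x. exp (- x\<^sup>2)))" if "T \<ge> 0" for T
  proof -
    have "((\<lambda>x. exp (- x\<^sup>2)) has_integral integral {0..T} (\<lambda>x. exp (- x\<^sup>2))) {0..T}" for T :: real
      by (intro integrable_integral integrable_continuous_real continuous_intros)
    hence "((\<lambda>x. \<i> * complex_of_real (exp (- x\<^sup>2))) has_integral (\<i> * of_real (integral {0..T} (\<lambda>x. exp (- x\<^sup>2))))) {0..T}"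
      by (intro has_integral_mult_right has_integral_of_real)
    moreover have "(\<lambda>x. \<i> * complex_of_real (exp (- x\<^sup>2))) = (\<lambda>x. \<i> * exp ((0 + \<i> * of_real x)\<^sup>2))"
      by (simp add: power_mult_distrib flip: exp_of_real)
    ultimately have "((\<lambda>x. \<i> * exp ((0 + \<i> * of_real x)\<^sup>2)) has_integral
        (\<i> * of_real (integral {0..T} (\<lambda>x. exp (- x\<^sup>2))))) {0..T}" by (simp only:)
    from has_integral_unique[OF vert[OF that, of 0] this] show ?thesis by (simp add: G_zero)
  qed
  \<comment> \<open>The ray through z is compared with the imaginary axis at equal height. The
    horizontal distance is fixed and the integrand there is at most exp ((Re z)^2 - (T + Im
    z)^2).\<close>
  have lim: "((\<lambda>T. G (z + \<i> * of_real T)) \<longlongrightarrow> \<i> * (sqrt pi / 2)) at_top" for z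
  proof -
    have "((\<lambda>T. \<i> * complex_of_real (integral {0..T} (\<lambda>x. exp (- x\<^sup>2)))) \<longlongrightarrow> \<i> * of_real (sqrt pi / 2)) at_top"
      by (intro tendsto_intros integral_gaussian_tendsto)
    hence "((\<lambda>T. \<i> * complex_of_real (integral {0..T + Im z} (\<lambda>x. exp (- x\<^sup>2)))) \<longlongrightarrow> \<i> * of_real (sqrt pi / 2)) at_top"
      by (rule filterlim_compose) real_asymp
    moreover have "((\<lambda>T. G (z + \<i> * of_real T) - G (\<i> * of_real (T + Im z))) \<longlongrightarrow> 0) at_top"
    proof (rule Lim_null_comparison)
      show "\<forall>\<^sub>F T in at_top. norm (G (z + \<i> * of_real T) - G (\<i> * of_real (T + Im z))) \<le>
          exp ((Re z)\<^sup>2) * exp (- ((T + Im z)\<^sup>2)) * \<bar>Re z\<bar>"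
      proof (rule always_eventually, rule allI)
        fix T :: real
        define C where "C = {w. Im w = T + Im z \<and> \<bar>Re w\<bar> \<le> \<bar>Re z\<bar>}"
        have "C = {w. Im w \<le> T + Im z} \<inter> {w. Im w \<ge> T + Im z} \<inter> {w. Re w \<le> \<bar>Re z\<bar>} \<inter> {w. Re w \<ge> - \<bar>Re z\<bar>}"
          unfolding C_def by auto
        hence conv: "convex C"
          by (auto intro!: convex_Int convex_halfspace_Re_le convex_halfspace_Re_ge convex_halfspace_Im_le convex_halfspace_Im_ge)
        have "norm (G (z + \<i> * of_real T) - G (\<i> * of_real (T + Im z))) \<le>
            exp ((Re z)\<^sup>2) * exp (- ((T + Im z)\<^sup>2)) * norm ((z + \<i> * of_real T) - \<i> * of_real (T + Im z))"
        proof (rule field_differentiable_bound[OF conv])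
          fix w assume w: "w \<in> C"
          show "(G has_field_derivative exp (w\<^sup>2)) (at w within C)" by (rule has_field_derivative_at_within[OF G])
          have "(Re w)\<^sup>2 \<le> (Re z)\<^sup>2" using w by (simp add: C_def abs_le_square_iff)
          moreover have "Re (w\<^sup>2) = (Re w)\<^sup>2 - (T + Im z)\<^sup>2" using w by (simp add: C_def Re_power2)
          ultimately show "norm (exp (w\<^sup>2)) \<le> exp ((Re z)\<^sup>2) * exp (- ((T + Im z)\<^sup>2))"
            unfolding norm_exp_eq_Re exp_add[symmetric] by simp
        qed (auto simp: C_def)
        also have "(z + \<i> * of_real T) - \<i> * of_real (T + Im z) = of_real (Re z)"
          by (simp add: complex_eq_iff)
        finally show "norm (G (z + \<i> * of_real T) - G (\<i> * of_real (T + Im z))) \<le>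
            exp ((Re z)\<^sup>2) * exp (- ((T + Im z)\<^sup>2)) * \<bar>Re z\<bar>" by simp
      qed
      show "((\<lambda>T. exp ((Re z)\<^sup>2) * exp (- ((T + Im z)\<^sup>2)) * \<bar>Re z\<bar>) \<longlongrightarrow> 0) at_top"
        by real_asymp
    qed
    moreover have "\<forall>\<^sub>F T in at_top. G (\<i> * of_real (T + Im z)) = \<i> * of_real (integral {0..T + Im z} (\<lambda>x. exp (- x\<^sup>2)))"
      using eventually_ge_at_top[of "- Im z"] by eventually_elim (intro Gi, simp)
    ultimately have "((\<lambda>T. (G (z + \<i> * of_real T) - G (\<i> * of_real (T + Im z))) + G (\<i> * of_real (T + Im z))) \<longlongrightarrow> 0 + \<i> * of_real (sqrt pi / 2)) at_top"
      by (intro tendsto_add) (simp_all cong: tendsto_cong)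
    thus ?thesis by simp
  qed
  have upper: "norm (G z - \<i> * (sqrt pi / 2)) \<le> sqrt pi / 2 * exp (Re (z\<^sup>2))" if "Im z \<ge> 0" for z
  proof -
    have bound: "norm (G (z + \<i> * of_real T) - G z) \<le> sqrt pi / 2 * exp (Re (z\<^sup>2))" if T: "T \<ge> 0" for T
    proof -
      have "norm (integral {0..T} (\<lambda>\<tau>. \<i> * exp ((z + \<i> * of_real \<tau>)\<^sup>2))) \<le>
          integral {0..T} (\<lambda>\<tau>. exp (Re (z\<^sup>2)) * exp (- \<tau>\<^sup>2))"
      proof (rule integral_norm_bound_integral)
        fix \<tau> assume "\<tau> \<in> {0..T}"
        hence "Im z * \<tau> \<ge> 0" using \<open>Im z \<ge> 0\<close> by simp
        moreover have "Re ((z + \<i> * of_real \<tau>)\<^sup>2) = Re (z\<^sup>2) - 2 * (Im z * \<tau>) - \<tau>\<^sup>2"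
          by (simp add: Re_power2 power2_eq_square algebra_simps)
        ultimately show "norm (\<i> * exp ((z + \<i> * of_real \<tau>)\<^sup>2)) \<le> exp (Re (z\<^sup>2)) * exp (- \<tau>\<^sup>2)"
          unfolding norm_mult norm_exp_eq_Re exp_add[symmetric] by simp
      qed (use vert[OF T] in \<open>auto intro!: integrable_continuous_real continuous_intros simp: has_integral_iff\<close>)
      also have "\<dots> = exp (Re (z\<^sup>2)) * integral {0..T} (\<lambda>\<tau>. exp (- \<tau>\<^sup>2))" by simp
      also have "\<dots> \<le> exp (Re (z\<^sup>2)) * (sqrt pi / 2)"
        by (intro mult_left_mono integral_gaussian_le T) auto
      finally show ?thesis using vert[OF T, of z] by (simp add: has_integral_iff mult.commute)
    qed
    have "((\<lambda>T. norm (G (z + \<i> * of_real T) - G z)) \<longlongrightarrow> norm (\<i> * (sqrt pi / 2) - G z)) at_top"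
      by (intro tendsto_intros lim)
    hence "norm (\<i> * (sqrt pi / 2) - G z) \<le> sqrt pi / 2 * exp (Re (z\<^sup>2))"
      by (rule tendsto_upperbound[OF _ eventually_mono[OF eventually_ge_at_top[of 0] bound]])
         (assumption | rule trivial_limit_at_top_linorder)+
    thus ?thesis by (simp add: norm_minus_commute)
  qed
  have lower: "norm (G z + \<i> * (sqrt pi / 2)) \<le> sqrt pi / 2 * exp (Re (z\<^sup>2))" if "Im z \<le> 0" for z
  proof -
    have "norm (G (-z) - \<i> * (sqrt pi / 2)) = norm (G z + \<i> * (sqrt pi / 2))"
      unfolding odd by (metis minus_add_distrib norm_minus_cancel uminus_add_conv_diff diff_minus_eq_add minus_diff_eq add.commute)
    thus ?thesis using upper[of "-z"] that by simp
  qed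
  show ?thesis by (rule that[OF G upper lower])
qed

lemma csqrt_half_plane:
  fixes t :: complex
  assumes "Re t > 0"
  shows "Re (csqrt t) > 0" "Im t = 2 * Re (csqrt t) * Im (csqrt t)" "(norm (csqrt t))\<^sup>2 = norm t" "csqrt t \<noteq> 0"
proof -
  have sq: "(csqrt t)\<^sup>2 = t" by simp
  hence Re: "Re t = (Re (csqrt t))\<^sup>2 - (Im (csqrt t))\<^sup>2" by (metis Re_power2)
  show "Im t = 2 * Re (csqrt t) * Im (csqrt t)" using sq by (metis Im_power2)
  show "(norm (csqrt t))\<^sup>2 = norm t" using sq by (metis norm_power)
  have "a \<noteq> 0" if "Re t = a\<^sup>2 - b\<^sup>2" for a b using that assms by auto
  from this[OF Re] have "Re (csqrt t) \<noteq> 0" .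
  thus pos: "Re (csqrt t) > 0" using csqrt_principal[of t] by blast
  show "csqrt t \<noteq> 0"
  proof
    assume "csqrt t = 0"
    hence "t = 0" by (simp only: csqrt_eq_0)
    thus False using assms by simp
  qed
qed

section \<open>The main integral in closed form\<close>

text \<open>With \<mu> = 2 \<alpha> \<beta> this is (\<mu> cosh \<mu> - sinh \<mu>) / \<beta>, in
  essence the Bessel function of order 3/2, which is elementary.\<close>

definition main_const :: "real \<Rightarrow> real \<Rightarrow> real" where
  "main_const \<alpha> \<beta> = exp (2 * \<alpha> * \<beta>) * (\<alpha> - 1 / (2 * \<beta>)) - exp (- (2 * \<alpha> * \<beta>)) * (\<alpha> + 1 / (2 * \<beta>))"

context
  fixes G :: "complex \<Rightarrow> complex" and \<alpha> \<beta> x :: real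
  assumes G: "\<And>z. (G has_field_derivative exp (z\<^sup>2)) (at z)"
    and G_upper: "\<And>z. Im z \<ge> 0 \<Longrightarrow> norm (G z - \<i> * (sqrt pi / 2)) \<le> sqrt pi / 2 * exp (Re (z\<^sup>2))"
    and G_lower: "\<And>z. Im z \<le> 0 \<Longrightarrow> norm (G z + \<i> * (sqrt pi / 2)) \<le> sqrt pi / 2 * exp (Re (z\<^sup>2))"
    and pos: "\<alpha> > 0" "\<beta> > 0" and x: "x = \<beta>\<^sup>2" and \<mu>_ge: "1 \<le> 2 * \<alpha> * \<beta>"
begin

text \<open>The exponent \<alpha>^2 / s^2 + x s^2 equals (\<beta> s - \<alpha> / s)^2 + 2 \<alpha>
  \<beta> and also (\<beta> s + \<alpha> / s)^2 - 2 \<alpha> \<beta>. So all three summands have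
  derivatives that are rational multiples of the same exponential, and the coefficients of the G
  terms are those for which only the s^2 term survives.\<close>

definition Phi :: "complex \<Rightarrow> complex" where
  "Phi = (\<lambda>s::complex. (s * exp (of_real (\<alpha>\<^sup>2) / s\<^sup>2 + of_real x * s\<^sup>2)
      + of_real (exp (2 * \<alpha> * \<beta>) * (\<alpha> - 1 / (2 * \<beta>))) * G (of_real \<beta> * s - of_real \<alpha> / s)
      - of_real (exp (- (2 * \<alpha> * \<beta>)) * (\<alpha> + 1 / (2 * \<beta>))) * G (of_real \<beta> * s + of_real \<alpha> / s)) / of_real x)"

lemma Phi_deriv:
  fixes s :: complex
  assumes "s \<noteq> 0"
  shows "(Phi has_field_derivative 2 * s\<^sup>2 * exp (\<alpha>\<^sup>2 / s\<^sup>2 + x * s\<^sup>2)) (at s)"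
proof -
  define a where "a = complex_of_real \<alpha>"
  define b where "b = complex_of_real \<beta>"
  define E where "E = exp (a\<^sup>2 / s\<^sup>2 + b\<^sup>2 * s\<^sup>2)"
  have nz: "b \<noteq> 0" "s \<noteq> 0" using pos assms by (simp_all add: b_def)
  have d1: "((\<lambda>s. s * exp (a\<^sup>2 / s\<^sup>2 + b\<^sup>2 * s\<^sup>2)) has_field_derivative E * (1 + 2 * b\<^sup>2 * s\<^sup>2 - 2 * a\<^sup>2 / s\<^sup>2)) (at s)"
    unfolding E_def using nz
    by (auto intro!: derivative_eq_intros simp: field_simps power2_eq_square)
  have d2: "((\<lambda>s. G (b * s - a / s)) has_field_derivative exp ((b * s - a / s)\<^sup>2) * (b + a / s\<^sup>2)) (at s)"
    by (rule DERIV_chain2[OF G]) (use nz in \<open>auto intro!: derivative_eq_intros simp: power2_eq_square\<close>)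
  have d3: "((\<lambda>s. G (b * s + a / s)) has_field_derivative exp ((b * s + a / s)\<^sup>2) * (b - a / s\<^sup>2)) (at s)"
    by (rule DERIV_chain2[OF G]) (use nz in \<open>auto intro!: derivative_eq_intros simp: power2_eq_square\<close>)
  have e2: "exp (2 * a * b) * exp ((b * s - a / s)\<^sup>2) = E"
    unfolding E_def exp_add[symmetric] using nz by (intro arg_cong[of _ _ exp]) (simp add: field_simps power2_eq_square)
  have e3: "exp (- (2 * a * b)) * exp ((b * s + a / s)\<^sup>2) = E"
    unfolding E_def exp_add[symmetric] using nz by (intro arg_cong[of _ _ exp]) (simp add: field_simps power2_eq_square)
  have Phi_eq: "Phi = (\<lambda>s. (s * exp (a\<^sup>2 / s\<^sup>2 + b\<^sup>2 * s\<^sup>2) + exp (2 * a * b) * (a - 1 / (2 * b)) * G (b * s - a / s)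
      - exp (- (2 * a * b)) * (a + 1 / (2 * b)) * G (b * s + a / s)) / b\<^sup>2)"
    unfolding Phi_def unfolding x a_def b_def by (intro ext) (simp add: exp_of_real[symmetric])
  have "(Phi has_field_derivative (E * (1 + 2 * b\<^sup>2 * s\<^sup>2 - 2 * a\<^sup>2 / s\<^sup>2)
      + exp (2 * a * b) * (a - 1 / (2 * b)) * (exp ((b * s - a / s)\<^sup>2) * (b + a / s\<^sup>2))
      - exp (- (2 * a * b)) * (a + 1 / (2 * b)) * (exp ((b * s + a / s)\<^sup>2) * (b - a / s\<^sup>2))) / b\<^sup>2) (at s)"
    unfolding Phi_eq by (intro DERIV_cdivide DERIV_diff DERIV_add DERIV_cmult d1 d2 d3)
  also have "exp (2 * a * b) * (a - 1 / (2 * b)) * (exp ((b * s - a / s)\<^sup>2) * (b + a / s\<^sup>2)) =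
      (exp (2 * a * b) * exp ((b * s - a / s)\<^sup>2)) * ((a - 1 / (2 * b)) * (b + a / s\<^sup>2))" by (simp only: mult_ac)
  also have "exp (- (2 * a * b)) * (a + 1 / (2 * b)) * (exp ((b * s + a / s)\<^sup>2) * (b - a / s\<^sup>2)) =
      (exp (- (2 * a * b)) * exp ((b * s + a / s)\<^sup>2)) * ((a + 1 / (2 * b)) * (b - a / s\<^sup>2))" by (simp only: mult_ac)
  also have "(E * (1 + 2 * b\<^sup>2 * s\<^sup>2 - 2 * a\<^sup>2 / s\<^sup>2) + (exp (2 * a * b) * exp ((b * s - a / s)\<^sup>2)) * ((a - 1 / (2 * b)) * (b + a / s\<^sup>2))
      - (exp (- (2 * a * b)) * exp ((b * s + a / s)\<^sup>2)) * ((a + 1 / (2 * b)) * (b - a / s\<^sup>2))) / b\<^sup>2 =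
      E * ((1 + 2 * b\<^sup>2 * s\<^sup>2 - 2 * a\<^sup>2 / s\<^sup>2) + (a - 1 / (2 * b)) * (b + a / s\<^sup>2) - (a + 1 / (2 * b)) * (b - a / s\<^sup>2)) / b\<^sup>2"
    unfolding e2 e3 by (simp only: ring_distribs)
  also have "(1 + 2 * b\<^sup>2 * s\<^sup>2 - 2 * a\<^sup>2 / s\<^sup>2) + (a - 1 / (2 * b)) * (b + a / s\<^sup>2) - (a + 1 / (2 * b)) * (b - a / s\<^sup>2)
      = 2 * b\<^sup>2 * s\<^sup>2" using nz by (simp add: field_simps power2_eq_square)
  also have "E * (2 * b\<^sup>2 * s\<^sup>2) / b\<^sup>2 = 2 * s\<^sup>2 * E" using nz by simp
  finally show ?thesis by (simp add: E_def a_def b_def x)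
qed

text \<open>The substitution t = s^2: the derivative 1 / (2 s) of the square root turns the factor 2
  s^2 into s, which is \<open>csqrt t\<close>.\<close>

lemma Phi_csqrt_deriv:
  fixes t :: complex
  assumes "Re t > 0"
  shows "((\<lambda>t. Phi (csqrt t)) has_field_derivative csqrt t * exp (\<alpha>\<^sup>2 / t + x * t)) (at t)"
proof -
  have "t \<notin> \<real>\<^sub>\<le>\<^sub>0" using assms by (auto simp: complex_nonpos_Reals_iff)
  hence "((\<lambda>t. Phi (csqrt t)) has_field_derivative
      2 * (csqrt t)\<^sup>2 * exp (\<alpha>\<^sup>2 / (csqrt t)\<^sup>2 + x * (csqrt t)\<^sup>2) * inverse (2 * csqrt t)) (at t)"
    by (intro DERIV_chain2[OF Phi_deriv] has_field_derivative_csqrt csqrt_half_plane assms)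
  also have "2 * (csqrt t)\<^sup>2 * exp (\<alpha>\<^sup>2 / (csqrt t)\<^sup>2 + x * (csqrt t)\<^sup>2) * inverse (2 * csqrt t) =
      csqrt t * exp (\<alpha>\<^sup>2 / (csqrt t)\<^sup>2 + x * (csqrt t)\<^sup>2)"
    using csqrt_half_plane(4)[OF assms] by (simp add: power2_eq_square field_simps)
  finally show ?thesis by simp
qed

text \<open>For |t| >= \<alpha> / \<beta> both arguments of G lie in the same closed half-plane as
  t, so both values of G are near \<sigma> i sqrt pi / 2. In the error terms the factors exp (2
  \<alpha> \<beta>) and exp (- 2 \<alpha> \<beta>) cancel and leave exp (Re W).\<close>

lemma Phi_endpoint:
  fixes t :: complex and \<sigma> :: real
  assumes t: "Re t > 0" and far: "\<alpha> / \<beta> \<le> norm t" and \<sigma>: "\<sigma> = 1 \<and> Im t \<ge> 0 \<or> \<sigma> = -1 \<and> Im t \<le> 0"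
  shows "norm (Phi (csqrt t) - \<sigma> * \<i> * of_real (sqrt pi / 2 * main_const \<alpha> \<beta> / x)) \<le>
    exp (Re (\<alpha>\<^sup>2 / t + x * t)) * (sqrt (norm t) + sqrt pi * \<alpha>) / x"
proof -
  define s where "s = csqrt t"
  define W where "W = \<alpha>\<^sup>2 / t + x * t"
  define u where "u = \<beta> * s - \<alpha> / s"
  define v where "v = \<beta> * s + \<alpha> / s"
  define c1 where "c1 = \<alpha> - 1 / (2 * \<beta>)"
  define c2 where "c2 = \<alpha> + 1 / (2 * \<beta>)"
  have s: "s \<noteq> 0" "Re s > 0" "(norm s)\<^sup>2 = norm t" "Im t = 2 * Re s * Im s" "s\<^sup>2 = t"
    unfolding s_def by (rule csqrt_half_plane[OF t] power2_csqrt)+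
  have sign: "Im s \<ge> 0 \<longleftrightarrow> Im t \<ge> 0" "Im s \<le> 0 \<longleftrightarrow> Im t \<le> 0"
    unfolding s(4) using s(2) by (simp_all add: zero_le_mult_iff mult_le_0_iff)
  \<comment> \<open>The hypothesis \<open>\<mu>_ge\<close> enters here: with both coefficients
    nonnegative the errors of the two G terms add up to a multiple of 2 \<alpha>.\<close>
  have c: "c1 \<ge> 0" "c2 \<ge> 0" "c1 + c2 = 2 * \<alpha>"
    using \<mu>_ge pos by (simp_all add: c1_def c2_def field_simps)
  have xpos: "x > 0" using pos x by simp
  have inv: "Im (complex_of_real \<alpha> / s) = - \<alpha> * Im s / norm t"
    unfolding s(3)[symmetric] by (simp add: Im_divide' cmod_power2)
  have "Im u = Im s * (\<beta> + \<alpha> / norm t)" "Im v = Im s * (\<beta> - \<alpha> / norm t)"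
    by (simp_all add: u_def v_def inv algebra_simps)
  moreover have "norm t > 0" using t by auto
  hence "\<alpha> / norm t \<ge> 0" "\<beta> - \<alpha> / norm t \<ge> 0"
    using far pos by (simp_all add: field_simps)
  ultimately have Im: "Im s \<ge> 0 \<Longrightarrow> Im u \<ge> 0" "Im s \<ge> 0 \<Longrightarrow> Im v \<ge> 0" "Im s \<le> 0 \<Longrightarrow> Im u \<le> 0" "Im s \<le> 0 \<Longrightarrow> Im v \<le> 0"
    using pos by (auto intro: mult_nonneg_nonneg mult_nonpos_nonneg add_nonneg_nonneg)
  have "norm (G z - \<sigma> * \<i> * (sqrt pi / 2)) \<le> sqrt pi / 2 * exp (Re (z\<^sup>2))" if "z = u \<or> z = v" for z
    using \<sigma>
  proof (elim disjE conjE)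
    assume "\<sigma> = 1" "Im t \<ge> 0"
    thus ?thesis using G_upper[of z] Im that sign by auto
  next
    assume "\<sigma> = -1" "Im t \<le> 0"
    thus ?thesis using G_lower[of z] Im that sign by auto
  qed
  hence Gu: "norm (G u - \<sigma> * \<i> * (sqrt pi / 2)) \<le> sqrt pi / 2 * exp (Re (u\<^sup>2))"
    and Gv: "norm (G v - \<sigma> * \<i> * (sqrt pi / 2)) \<le> sqrt pi / 2 * exp (Re (v\<^sup>2))" by blast+
  have "u\<^sup>2 = W - of_real (2 * \<alpha> * \<beta>)" "v\<^sup>2 = W + of_real (2 * \<alpha> * \<beta>)"
    using s(1) unfolding u_def v_def W_def s(5)[symmetric] x by (simp_all add: field_simps power2_eq_square)
  hence Re: "Re (u\<^sup>2) = Re W - 2 * \<alpha> * \<beta>" "Re (v\<^sup>2) = Re W + 2 * \<alpha> * \<beta>" by simp_all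
  have "Phi s - \<sigma> * \<i> * of_real (sqrt pi / 2 * main_const \<alpha> \<beta> / x) =
     (s * exp W + of_real (exp (2 * \<alpha> * \<beta>) * c1) * (G u - \<sigma> * \<i> * (sqrt pi / 2))
        - of_real (exp (- (2 * \<alpha> * \<beta>)) * c2) * (G v - \<sigma> * \<i> * (sqrt pi / 2))) / x"
  proof -
    have aux: "(A + P * g - Q * k) / X - J * (h * (P - Q) / X) = (A + P * (g - J * h) - Q * (k - J * h)) / X"
      if "X \<noteq> 0" for A P Q g k J h X :: complex
      using that by (simp add: field_simps)
    have 1: "of_real (sqrt pi / 2 * main_const \<alpha> \<beta> / x) = of_real (sqrt pi / 2) *
        (of_real (exp (2 * \<alpha> * \<beta>) * c1) - of_real (exp (- (2 * \<alpha> * \<beta>)) * c2)) / complex_of_real x"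
      by (simp add: main_const_def c1_def c2_def)
    have 2: "Phi s = (s * exp W + of_real (exp (2 * \<alpha> * \<beta>) * c1) * G u - of_real (exp (- (2 * \<alpha> * \<beta>)) * c2) * G v) / of_real x"
      by (simp add: Phi_def W_def u_def v_def c1_def c2_def s(5))
    have "complex_of_real x \<noteq> 0" using xpos by simp
    thus ?thesis unfolding 1 2 by (rule aux)
  qed
  also have "norm \<dots> = norm (s * exp W + of_real (exp (2 * \<alpha> * \<beta>) * c1) * (G u - \<sigma> * \<i> * (sqrt pi / 2))
        - of_real (exp (- (2 * \<alpha> * \<beta>)) * c2) * (G v - \<sigma> * \<i> * (sqrt pi / 2))) / x"
    using xpos by (simp add: norm_divide)
  also have "\<dots> \<le> (norm (s * exp W) + norm (of_real (exp (2 * \<alpha> * \<beta>) * c1) * (G u - \<sigma> * \<i> * (sqrt pi / 2)))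
        + norm (of_real (exp (- (2 * \<alpha> * \<beta>)) * c2) * (G v - \<sigma> * \<i> * (sqrt pi / 2)))) / x"
    using xpos by (intro divide_right_mono order_trans[OF norm_triangle_ineq4] add_mono norm_triangle_ineq) auto
  also have "norm (s * exp W) = sqrt (norm t) * exp (Re W)"
    using s(3) by (simp add: norm_mult) (metis norm_ge_zero real_sqrt_unique)
  also have "norm (of_real (exp (2 * \<alpha> * \<beta>) * c1) * (G u - \<sigma> * \<i> * (sqrt pi / 2))) \<le>
      (exp (2 * \<alpha> * \<beta>) * c1) * (sqrt pi / 2 * exp (Re W - 2 * \<alpha> * \<beta>))"
    using Gu c unfolding Re norm_mult norm_of_real by (intro mult_mono) auto
  also have "(exp (2 * \<alpha> * \<beta>) * c1) * (sqrt pi / 2 * exp (Re W - 2 * \<alpha> * \<beta>)) = exp (Re W) * (sqrt pi / 2 * c1)"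
    by (simp add: exp_diff)
  also have "norm (of_real (exp (- (2 * \<alpha> * \<beta>)) * c2) * (G v - \<sigma> * \<i> * (sqrt pi / 2))) \<le>
      (exp (- (2 * \<alpha> * \<beta>)) * c2) * (sqrt pi / 2 * exp (Re W + 2 * \<alpha> * \<beta>))"
    using Gv c unfolding Re norm_mult norm_of_real by (intro mult_mono) auto
  also have "(exp (- (2 * \<alpha> * \<beta>)) * c2) * (sqrt pi / 2 * exp (Re W + 2 * \<alpha> * \<beta>)) = exp (Re W) * (sqrt pi / 2 * c2)"
    by (simp add: exp_add exp_minus)
  also have "sqrt (norm t) * exp (Re W) + exp (Re W) * (sqrt pi / 2 * c1) + exp (Re W) * (sqrt pi / 2 * c2) =
      exp (Re W) * (sqrt (norm t) + sqrt pi / 2 * (c1 + c2))" by (simp add: algebra_simps)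
  finally show ?thesis using xpos c(3) by (simp add: s_def W_def divide_right_mono)
qed

text \<open>The abscissa y = \<alpha> / \<beta> is the saddle point of \<alpha>^2 / t + x t. At the
  two ends the primitive is near opposite imaginary values, so the jump is twice that value; the
  error has about half the exponent of the main term.\<close>

lemma main_term_has_integral:
  assumes y: "y = \<alpha> / \<beta>" "y \<le> pi"
  shows "\<exists>I. ((\<lambda>\<theta>. csqrt (Complex y \<theta>) * exp (\<alpha>\<^sup>2 / Complex y \<theta> + x * Complex y \<theta>)) has_integral I) {-pi..pi} \<and>
     norm (I - of_real (sqrt pi * main_const \<alpha> \<beta> / x)) \<le>
       2 * exp (\<alpha> * \<beta> + \<alpha>\<^sup>2 * y / (y\<^sup>2 + pi\<^sup>2)) * (sqrt (sqrt (y\<^sup>2 + pi\<^sup>2)) + sqrt pi * \<alpha>) / x"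
proof -
  have ypos: "y > 0" using y pos by simp
  have C: "Complex y \<theta> = of_real y + \<i> * of_real \<theta>" for \<theta> by (simp add: complex_eq_iff)
  define F where "F = (\<lambda>\<theta>. Phi (csqrt (Complex y \<theta>)))"
  define f where "f = (\<lambda>\<theta>. csqrt (Complex y \<theta>) * exp (\<alpha>\<^sup>2 / Complex y \<theta> + x * Complex y \<theta>))"
  have "((\<lambda>\<theta>. f \<theta> * \<i>) has_integral F pi - F (-pi)) {-pi..pi}"
  proof (rule fundamental_theorem_of_calculus)
    fix \<theta> :: real
    have "((\<lambda>w. Phi (csqrt (of_real y + \<i> * w))) has_field_derivative f \<theta> * \<i>) (at (of_real \<theta>))"
      unfolding f_def C by (rule DERIV_chain2[OF Phi_csqrt_deriv]) (auto intro!: derivative_eq_intros simp: ypos)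
    from has_vector_derivative_real_field[OF this]
    show "(F has_vector_derivative f \<theta> * \<i>) (at \<theta> within {-pi..pi})"
      unfolding F_def C .
  qed simp
  hence "((\<lambda>\<theta>. f \<theta> * \<i> * (- \<i>)) has_integral (F pi - F (-pi)) * (- \<i>)) {-pi..pi}"
    by (rule has_integral_mult_left)
  hence int: "(f has_integral (F pi - F (-pi)) * (- \<i>)) {-pi..pi}" by (simp add: mult.assoc)
  define R where "R = exp (\<alpha> * \<beta> + \<alpha>\<^sup>2 * y / (y\<^sup>2 + pi\<^sup>2)) * (sqrt (sqrt (y\<^sup>2 + pi\<^sup>2)) + sqrt pi * \<alpha>) / x"
  define m where "m = sqrt pi / 2 * main_const \<alpha> \<beta> / x"
  have bound: "norm (F \<theta> - \<sigma> * \<i> * of_real m) \<le> R"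
    if "\<theta> = \<sigma> * pi" "\<sigma> = 1 \<or> \<sigma> = -1" for \<theta> \<sigma> :: real
  proof -
    have sq: "\<theta>\<^sup>2 = pi\<^sup>2" using that by auto
    have nrm: "norm (Complex y \<theta>) = sqrt (y\<^sup>2 + pi\<^sup>2)" by (simp add: complex_norm sq)
    have "pi \<le> sqrt (y\<^sup>2 + pi\<^sup>2)" by (rule real_le_rsqrt) simp
    hence far: "\<alpha> / \<beta> \<le> norm (Complex y \<theta>)" using y nrm by simp
    have "x * y = \<alpha> * \<beta>" unfolding y x using pos by (simp add: power2_eq_square)
    hence "Re (\<alpha>\<^sup>2 / Complex y \<theta> + x * Complex y \<theta>) = \<alpha> * \<beta> + \<alpha>\<^sup>2 * y / (y\<^sup>2 + pi\<^sup>2)"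
      by (simp add: Re_divide' sq cmod_power2)
    thus ?thesis
      using Phi_endpoint[of "Complex y \<theta>" \<sigma>] far ypos that nrm
      by (auto simp: F_def R_def m_def)
  qed
  have "(F pi - F (-pi)) * (- \<i>) - of_real (2 * m) =
      ((F pi - 1 * \<i> * of_real m) - (F (-pi) - (-1) * \<i> * of_real m)) * (- \<i>)"
    by (simp add: algebra_simps)
  also have "norm \<dots> = norm ((F pi - of_real 1 * \<i> * of_real m) - (F (-pi) - of_real (-1) * \<i> * of_real m))"
    by (simp add: norm_mult)
  also have "\<dots> \<le> R + R"
    by (intro order_trans[OF norm_triangle_ineq4] add_mono bound) auto
  finally have "norm ((F pi - F (-pi)) * (- \<i>) - of_real (2 * m)) \<le> 2 * R" by simp
  thus ?thesis using int unfolding f_def m_def R_def by (intro exI conjI) (assumption, simp)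
qed

end

section \<open>The Turan inequality for large indices\<close>

text \<open>Multiplied by exp (- z / 2) this is z <= 2 sinh (z / 2).\<close>

lemma exp_diff_ge:
  fixes z :: real
  assumes "z \<ge> 0"
  shows "z * exp (z / 2) \<le> exp z - 1"
proof -
  define f where "f = (\<lambda>w::real. exp w - exp (-w) - 2 * w)"
  have "f 0 \<le> f (z / 2)"
  proof (rule DERIV_nonneg_imp_nondecreasing[of 0 "z / 2" f])
    fix w :: real
    have "(f has_field_derivative exp w + exp (-w) - 2) (at w)"
      unfolding f_def by (auto intro!: derivative_eq_intros)
    moreover have "exp w + exp (-w) - 2 = (exp (w / 2) - exp (- w / 2))\<^sup>2"
    proof -
      have "exp w = exp (w / 2) * exp (w / 2)" "exp (-w) = exp (- w / 2) * exp (- w / 2)" "exp (w / 2) * exp (- w / 2) = 1"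
        by (simp_all flip: exp_add)
      thus ?thesis by (simp add: power2_eq_square algebra_simps)
    qed
    ultimately show "\<exists>y. (f has_real_derivative y) (at w) \<and> 0 \<le> y"
      by (intro exI[of _ "exp w + exp (-w) - 2"]) simp
  qed (use assms in simp)
  hence "z \<le> exp (z / 2) - exp (- (z / 2))" by (simp add: f_def)
  hence "z * exp (z / 2) \<le> (exp (z / 2) - exp (- (z / 2))) * exp (z / 2)"
    by (intro mult_right_mono) auto
  also have "\<dots> = exp z - 1" by (simp add: algebra_simps flip: exp_add)
  finally show ?thesis .
qed

text \<open>Beyond the trivial bound pi^2 / (6 s) there is a factor exp (- s / 2). It later
  outweighs the factor exp (s / 24) of the main integrand.\<close>

lemma log_partition_le:
  fixes s :: real
  assumes "s > 0"
  shows "log_partition s \<le> exp (- s / 2) * (pi\<^sup>2 / 6 / s)"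
proof -
  have term_le: "1 / (real (Suc m) * (exp (real (Suc m) * s) - 1)) \<le> exp (- s / 2) / s * (1 / (real m + 1) ^ 2)" for m
  proof -
    define k where "k = real (Suc m)"
    have k: "k \<ge> 1" by (simp add: k_def)
    have "(k * s) * exp (s / 2) \<le> (k * s) * exp (k * s / 2)"
      using k assms by (intro mult_left_mono) auto
    also have "\<dots> \<le> exp (k * s) - 1" using k assms by (intro exp_diff_ge) auto
    finally have "1 / (k * (exp (k * s) - 1)) \<le> 1 / (k * (k * s * exp (s / 2)))"
      using k assms by (intro divide_left_mono mult_left_mono mult_pos_pos) (auto intro: less_le_trans[of _ "(k * s) * exp (s / 2)"])
    also have "\<dots> = exp (- s / 2) / s * (1 / k ^ 2)"
      using k assms by (simp add: exp_minus power2_eq_square field_simps)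
    finally show ?thesis by (simp add: k_def add.commute)
  qed
  have S: "(\<lambda>m. exp (- s / 2) / s * (1 / (real m + 1) ^ 2)) sums (exp (- s / 2) / s * (pi\<^sup>2 / 6))"
    by (intro sums_mult inverse_squares_sums')
  from S have "log_partition s \<le> exp (- s / 2) / s * (pi\<^sup>2 / 6)"
    unfolding log_partition_def by (rule sums_le[OF term_le summable_sums[OF summable_log_partition[OF assms]]])
  thus ?thesis by simp
qed

lemma log_partition_nonneg: "s > 0 \<Longrightarrow> log_partition s \<ge> 0"
  unfolding log_partition_def by (rule suminf_nonneg[OF summable_log_partition]) auto

lemma exp_minus_1_le: "exp z - 1 \<le> z * exp z" for z :: real
proof -
  have "1 - z \<le> exp (-z)" using exp_ge_add_one_self[of "-z"] by simp
  hence "(1 - z) * exp z \<le> exp (-z) * exp z" by (intro mult_right_mono) auto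
  thus ?thesis by (simp add: algebra_simps flip: exp_add)
qed

lemma csqrt_of_real_mult:
  assumes "c > 0" "Re t > 0"
  shows "csqrt (of_real c * t) = of_real (sqrt c) * csqrt t"
proof (rule csqrt_unique)
  show "(of_real (sqrt c) * csqrt t)\<^sup>2 = of_real c * t"
    using assms(1) by (simp add: power_mult_distrib flip: of_real_power)
  have "Re (of_real (sqrt c) * csqrt t) = sqrt c * Re (csqrt t)" by (simp del: csqrt.simps)
  also have "\<dots> > 0" using assms csqrt_half_plane(1)[of t] by (intro mult_pos_pos) auto
  finally show "0 < Re (of_real (sqrt c) * csqrt t) \<or> Re (of_real (sqrt c) * csqrt t) = 0 \<and> 0 \<le> Im (of_real (sqrt c) * csqrt t)"
    by blast
qed

text \<open>The inversion is applied on the whole circle, so the error integrand is \<kappa> f (P -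
  1) with P the inverted series. For s = Re (4 pi^2 / t) the size of f is governed by exp (s / 24 +
  \<mu> / 2), while P - 1 is at most exp (- s / 2) (\<alpha>^2 / s) exp (\<alpha>^2 / s). Large s is
  therefore harmless and small s costs at most B exp B. The summand 2 covers the ends of the contour
  and the exp (- \<mu>) part of \<open>main_const\<close>, one unit each.\<close>

theorem num_partitions_approx:
  fixes n :: nat and \<alpha> \<beta> \<mu> x y B :: real
  defines "\<alpha> \<equiv> pi / sqrt 6" and "x \<equiv> real n - 1 / 24"
  defines "\<beta> \<equiv> sqrt x"
  defines "\<mu> \<equiv> 2 * \<alpha> * \<beta>" and "y \<equiv> \<alpha> / \<beta>"
  defines "B \<equiv> y / 24 + \<mu> / 8"
  assumes n: "n \<ge> 5"
  shows "\<bar>real (num_partitions n) - exp \<mu> * (\<alpha> - 1 / (2 * \<beta>)) / (2 * sqrt 2 * pi * x)\<bar> \<le> exp (\<mu> / 2) * (B * exp B + 2)"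
proof -
  have \<alpha>2: "\<alpha>\<^sup>2 = pi\<^sup>2 / 6" by (simp add: \<alpha>_def power_divide)
  have x: "x \<ge> 4" using n by (simp add: x_def)
  have \<beta>: "\<beta> \<ge> 2" "\<beta>\<^sup>2 = x" using x by (auto simp: \<beta>_def intro!: real_le_rsqrt)
  have "sqrt 6 \<ge> 2" by (rule real_le_rsqrt) simp
  hence \<alpha>: "\<alpha> > 0" "\<alpha> \<le> 2"
    using pi_less_4 by (simp_all add: \<alpha>_def pos_divide_le_eq)
  have "1 \<le> \<alpha>"
  proof (rule power2_le_imp_le)
    have "pi > 2.5"
      using pi_gt3 by simp
    hence "2.5 * 2.5 \<le> pi * pi" by (intro mult_mono) auto
    hence "6 \<le> pi\<^sup>2" by (simp add: power2_eq_square)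
    thus "1\<^sup>2 \<le> \<alpha>\<^sup>2" unfolding \<alpha>2 by simp
  qed (use \<alpha> in simp)
  have pos: "\<alpha> > 0" "\<beta> > 0" "x > 0" "y > 0" using \<alpha> \<beta> x by (simp_all add: y_def)
  have y1: "y \<le> 1" using \<alpha> \<beta> by (simp add: y_def)
  have ypi: "y \<le> pi" using y1 pi_ge_two by simp
  have "1 * 2 \<le> \<alpha> * \<beta>" using \<open>1 \<le> \<alpha>\<close> \<beta> by (intro mult_mono) auto
  hence \<mu>1: "1 \<le> 2 * \<alpha> * \<beta>" by simp
  have xy: "x * y = \<mu> / 2"
    using pos unfolding \<beta>(2)[symmetric] y_def \<mu>_def by (simp add: power2_eq_square)
  \<comment> \<open>On the segment \<alpha>^2 / s equals (y^2 + \<theta>^2) / (24 y), so B is its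
    maximum, attained at the two ends.\<close>
  have B_eq: "(y\<^sup>2 + pi\<^sup>2) / (24 * y) = B"
  proof -
    have "pi\<^sup>2 = 6 * \<alpha>\<^sup>2" by (simp add: \<alpha>2)
    moreover have "6 * \<alpha>\<^sup>2 / (24 * y) = \<mu> / 8"
      using pos unfolding y_def \<mu>_def by (simp add: power2_eq_square field_simps)
    ultimately show ?thesis using pos by (simp add: B_def add_divide_distrib power2_eq_square)
  qed
  define t where "t = Complex y"
  define \<kappa> where "\<kappa> = 1 / sqrt (2 * pi)"
  define f where "f = (\<lambda>\<theta>. csqrt (t \<theta>) * exp (\<alpha>\<^sup>2 / t \<theta> + x * t \<theta>))"
  define F where "F = (\<lambda>\<theta>. partition_series (exp (- t \<theta>)) * exp (of_nat n * t \<theta>))"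
  obtain G :: "complex \<Rightarrow> complex" where G:
    "\<And>z. (G has_field_derivative exp (z\<^sup>2)) (at z)"
    "\<And>z. Im z \<ge> 0 \<Longrightarrow> norm (G z - \<i> * (sqrt pi / 2)) \<le> sqrt pi / 2 * exp (Re (z\<^sup>2))"
    "\<And>z. Im z \<le> 0 \<Longrightarrow> norm (G z + \<i> * (sqrt pi / 2)) \<le> sqrt pi / 2 * exp (Re (z\<^sup>2))"
    by (rule gauss_primitive_exists) blast
  define mc where "mc = main_const \<alpha> \<beta>"
  obtain I where I: "(f has_integral I) {-pi..pi}" and
    I_bound: "norm (I - of_real (sqrt pi * mc / x)) \<le>
       2 * exp (\<alpha> * \<beta> + \<alpha>\<^sup>2 * y / (y\<^sup>2 + pi\<^sup>2)) * (sqrt (sqrt (y\<^sup>2 + pi\<^sup>2)) + sqrt pi * \<alpha>) / x"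
    using main_term_has_integral[OF G pos(1,2) \<beta>(2)[symmetric] \<mu>1 y_def[THEN meta_eq_to_obj_eq] ypi]
    unfolding f_def t_def mc_def by blast
  have F_int: "(F has_integral (2 * of_real pi * of_nat (num_partitions n))) {-pi..pi}"
    unfolding F_def t_def by (rule num_partitions_integral[OF pos(4)])
  have Re_t: "Re (t \<theta>) > 0" for \<theta> using pos by (simp add: t_def)
  have F_eq: "F \<theta> = of_real \<kappa> * f \<theta> * partition_series (exp (- (4 * pi\<^sup>2 / t \<theta>)))" for \<theta>
  proof -
    have "csqrt (t \<theta> / (2 * pi)) = csqrt (of_real (1 / (2 * pi)) * t \<theta>)" by simp
    also have "\<dots> = of_real (sqrt (1 / (2 * pi))) * csqrt (t \<theta>)"
      by (rule csqrt_of_real_mult) (simp_all add: Re_t)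
    finally have c: "csqrt (t \<theta> / (2 * pi)) = of_real \<kappa> * csqrt (t \<theta>)"
      by (simp only: \<kappa>_def real_sqrt_divide real_sqrt_one)
    have e: "exp (pi\<^sup>2 / 6 / t \<theta> - t \<theta> / 24) * exp (of_nat n * t \<theta>) = exp (\<alpha>\<^sup>2 / t \<theta> + x * t \<theta>)"
      unfolding exp_add[symmetric] \<alpha>2 x_def by (intro arg_cong[of _ _ exp]) (simp add: algebra_simps)
    have "F \<theta> = of_real \<kappa> * (csqrt (t \<theta>) * (exp (pi\<^sup>2 / 6 / t \<theta> - t \<theta> / 24) * exp (of_nat n * t \<theta>)))
        * partition_series (exp (- (4 * pi\<^sup>2 / t \<theta>)))"
      unfolding F_def partition_series_inversion[OF Re_t] c by (simp only: mult_ac)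
    thus ?thesis unfolding e f_def .
  qed
  have pointwise: "norm (F \<theta> - of_real \<kappa> * f \<theta>) \<le> exp (\<mu> / 2) * (B * exp B)" if \<theta>: "\<theta> \<in> {-pi..pi}" for \<theta>
  proof -
    define s where "s = 4 * pi\<^sup>2 * y / (y\<^sup>2 + \<theta>\<^sup>2)"
    define L where "L = log_partition s"
    have den: "y\<^sup>2 + \<theta>\<^sup>2 > 0" using pos by (intro add_pos_nonneg) auto
    have s: "s > 0" using pos den by (simp add: s_def)
    have "norm (t \<theta>) = sqrt (y\<^sup>2 + \<theta>\<^sup>2)" by (simp add: t_def complex_norm)
    have \<theta>2: "\<theta>\<^sup>2 \<le> pi\<^sup>2" using \<theta> by (intro abs_le_square_iff[THEN iffD1]) auto
    have Re_s: "Re (4 * pi\<^sup>2 / t \<theta>) = s"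
      by (simp add: t_def s_def Re_divide' cmod_power2)
    have Re_W: "Re (\<alpha>\<^sup>2 / t \<theta> + x * t \<theta>) = s / 24 + \<mu> / 2"
    proof -
      have "Re (\<alpha>\<^sup>2 / t \<theta> + x * t \<theta>) = \<alpha>\<^sup>2 * (y / (y\<^sup>2 + \<theta>\<^sup>2)) + x * y"
        by (simp add: t_def Re_divide' cmod_power2)
      moreover have "s / 24 = \<alpha>\<^sup>2 * (y / (y\<^sup>2 + \<theta>\<^sup>2))" 
      proof -
        have "4 * pi\<^sup>2 * y / d / 24 = pi\<^sup>2 / 6 * (y / d)" for d by (simp add: field_simps)
        thus ?thesis unfolding s_def \<alpha>2 .
      qed
      ultimately show ?thesis using xy by (simp only:)
    qed
    have "norm (F \<theta> - of_real \<kappa> * f \<theta>) = \<kappa> * norm (f \<theta>) * norm (partition_series (exp (- (4 * pi\<^sup>2 / t \<theta>))) - 1)"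
    proof -
      have "F \<theta> - of_real \<kappa> * f \<theta> = of_real \<kappa> * f \<theta> * (partition_series (exp (- (4 * pi\<^sup>2 / t \<theta>))) - 1)"
        unfolding F_eq by (simp add: algebra_simps)
      moreover have "\<kappa> \<ge> 0" by (simp add: \<kappa>_def)
      ultimately show ?thesis by (simp only: norm_mult norm_of_real abs_of_nonneg)
    qed
    also have "\<dots> \<le> \<kappa> * norm (f \<theta>) * (exp L - 1)"
      using norm_partition_series_minus_1_le[of "4 * pi\<^sup>2 / t \<theta>"] s unfolding L_def Re_s
      by (intro mult_left_mono) (auto simp: \<kappa>_def)
    also have "norm (f \<theta>) = norm (csqrt (t \<theta>)) * (exp (s / 24) * exp (\<mu> / 2))"
      unfolding f_def norm_mult norm_exp_eq_Re Re_W exp_add[of "s / 24"] ..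
    also have "\<kappa> * (norm (csqrt (t \<theta>)) * (exp (s / 24) * exp (\<mu> / 2))) * (exp L - 1) =
        (\<kappa> * norm (csqrt (t \<theta>))) * (exp (\<mu> / 2) * (exp (s / 24) * (exp L - 1)))" by (simp only: mult_ac)
    also have "\<dots> \<le> 1 * (exp (\<mu> / 2) * (B * exp B))"
    proof (rule mult_mono)
      show "\<kappa> * norm (csqrt (t \<theta>)) \<le> 1"
      proof -
        have "norm (t \<theta>) \<le> \<bar>Re (t \<theta>)\<bar> + \<bar>Im (t \<theta>)\<bar>" by (rule cmod_le)
        also have "\<dots> \<le> 2 * pi" using \<theta> ypi pos by (auto simp: t_def)
        finally have "(norm (csqrt (t \<theta>)))\<^sup>2 \<le> 2 * pi" unfolding csqrt_half_plane(3)[OF Re_t] .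
        hence "norm (csqrt (t \<theta>)) \<le> sqrt (2 * pi)" by (rule real_le_rsqrt)
        thus ?thesis by (simp add: \<kappa>_def)
      qed
      have "\<alpha>\<^sup>2 / s \<le> B"
      proof -
        have "\<alpha>\<^sup>2 / s = (y\<^sup>2 + \<theta>\<^sup>2) / (24 * y)" using pos den by (simp add: s_def \<alpha>2 field_simps)
        also have "\<dots> \<le> (y\<^sup>2 + pi\<^sup>2) / (24 * y)" using \<theta>2 pos by (intro divide_right_mono) auto
        finally show ?thesis unfolding B_eq .
      qed
      have "\<alpha>\<^sup>2 / s > 0" using s pos by simp
      have L: "0 \<le> L" "L \<le> exp (- s / 2) * (\<alpha>\<^sup>2 / s)"
        using log_partition_le[OF s] log_partition_nonneg[OF s] by (simp_all add: L_def \<alpha>2)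
      have "exp (- s / 2) * (\<alpha>\<^sup>2 / s) \<le> 1 * (\<alpha>\<^sup>2 / s)" using s pos by (intro mult_right_mono) auto
      from order_trans[OF L(2) this] have "L \<le> \<alpha>\<^sup>2 / s" by simp
      have "exp (s / 24) * (exp L - 1) \<le> exp (s / 24) * (L * exp L)"
        by (intro mult_left_mono exp_minus_1_le) auto
      also have "\<dots> \<le> exp (s / 24) * ((exp (- s / 2) * (\<alpha>\<^sup>2 / s)) * exp (\<alpha>\<^sup>2 / s))"
        using L \<open>L \<le> \<alpha>\<^sup>2 / s\<close> \<open>\<alpha>\<^sup>2 / s > 0\<close> by (intro mult_left_mono mult_mono) auto
      also have "\<dots> = exp (s / 24 - s / 2) * (\<alpha>\<^sup>2 / s * exp (\<alpha>\<^sup>2 / s))"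
      proof -
        have "exp (s / 24 - s / 2) = exp (s / 24) * exp (- s / 2)" by (simp flip: exp_add)
        thus ?thesis by (simp only: mult_ac)
      qed
      also have "\<dots> \<le> 1 * (B * exp B)"
        using s \<open>\<alpha>\<^sup>2 / s \<le> B\<close> \<open>\<alpha>\<^sup>2 / s > 0\<close> by (intro mult_mono) auto
      finally have "exp (s / 24) * (exp L - 1) \<le> B * exp B" by simp
      thus "exp (\<mu> / 2) * (exp (s / 24) * (exp L - 1)) \<le> exp (\<mu> / 2) * (B * exp B)"
        by (rule mult_left_mono) simp
    qed (use log_partition_nonneg[OF s] in \<open>auto simp: L_def\<close>)
    finally show ?thesis by simp
  qed
  have int: "((\<lambda>\<theta>. F \<theta> - of_real \<kappa> * f \<theta>) has_integral (2 * of_real pi * of_nat (num_partitions n) - of_real \<kappa> * I)) {-pi..pi}"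
    by (intro has_integral_diff has_integral_mult_right F_int I)
  have "norm (2 * of_real pi * of_nat (num_partitions n) - of_real \<kappa> * I) \<le> exp (\<mu> / 2) * (B * exp B) * Henstock_Kurzweil_Integration.content {-pi..pi}"
  proof (rule has_integral_bound_real[OF _ finite.emptyI int])
    show "0 \<le> exp (\<mu> / 2) * (B * exp B)" using pos by (simp add: B_def \<mu>_def)
  qed (use pointwise in blast)
  hence E1: "norm (2 * of_real pi * of_nat (num_partitions n) - of_real \<kappa> * I) \<le> exp (\<mu> / 2) * (B * exp B) * (2 * pi)"
    by simp
  \<comment> \<open>Here 28 is 2 * 2 * (3 + 4), from crude bounds for the exponential of the small
    term, the fourth root and sqrt pi \<alpha>.\<close>
  have E2: "norm (I - of_real (sqrt pi * mc / x)) \<le> 28 * exp (\<mu> / 2) / x"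
  proof -
    have "\<alpha>\<^sup>2 * y / (y\<^sup>2 + pi\<^sup>2) \<le> \<alpha>\<^sup>2 * y / pi\<^sup>2"
      using pos by (intro divide_left_mono mult_nonneg_nonneg mult_pos_pos add_pos_pos) auto
    also have "\<dots> = y / 6" by (simp add: \<alpha>2)
    finally have "exp (\<alpha> * \<beta> + \<alpha>\<^sup>2 * y / (y\<^sup>2 + pi\<^sup>2)) \<le> exp (\<mu> / 2 + 1 / 6)"
      using y1 by (simp add: \<mu>_def)
    also have "\<dots> = exp (1 / 6) * exp (\<mu> / 2)" by (simp add: exp_add)
    also have "exp (1 / 6) \<le> (2::real)"
      using exp_bound[of "1/6"] by (simp add: power2_eq_square)
    finally have 1: "exp (\<alpha> * \<beta> + \<alpha>\<^sup>2 * y / (y\<^sup>2 + pi\<^sup>2)) \<le> 2 * exp (\<mu> / 2)" by simp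
    have "y\<^sup>2 + pi\<^sup>2 \<le> 1 * 1 + 4 * 4"
      unfolding power2_eq_square using y1 pos pi_less_4 by (intro add_mono mult_mono) auto
    hence "sqrt (y\<^sup>2 + pi\<^sup>2) \<le> 9" by (intro real_le_lsqrt) auto
    hence "sqrt (sqrt (y\<^sup>2 + pi\<^sup>2)) \<le> sqrt 9" by (rule real_sqrt_le_mono)
    moreover have "sqrt 9 = 3" by (rule real_sqrt_unique) auto
    ultimately have 2: "sqrt (sqrt (y\<^sup>2 + pi\<^sup>2)) \<le> 3" by (simp only:)
    have "sqrt pi \<le> 2" using pi_less_4 by (intro real_le_lsqrt) auto
    hence 3: "sqrt pi * \<alpha> \<le> 2 * 2" using \<alpha> by (intro mult_mono) auto
    have "2 * exp (\<alpha> * \<beta> + \<alpha>\<^sup>2 * y / (y\<^sup>2 + pi\<^sup>2)) * (sqrt (sqrt (y\<^sup>2 + pi\<^sup>2)) + sqrt pi * \<alpha>) \<le>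
        2 * (2 * exp (\<mu> / 2)) * (3 + 4)"
      using 1 2 3[simplified] pos by (intro mult_mono add_mono) auto
    thus ?thesis using I_bound pos by (elim order_trans) (intro divide_right_mono, auto)
  qed
  have \<kappa>: "\<kappa> > 0" "\<kappa> \<le> 1 / 2" "\<kappa> * sqrt pi = 1 / sqrt 2"
  proof -
    have "2 \<le> sqrt (2 * pi)" using pi_ge_two by (intro real_le_rsqrt) auto
    thus "\<kappa> \<le> 1 / 2" unfolding \<kappa>_def by (intro divide_left_mono) auto
  qed (simp_all add: \<kappa>_def real_sqrt_mult)
  have "norm (2 * complex_of_real pi * of_nat (num_partitions n) - of_real (\<kappa> * (sqrt pi * mc / x)))
      \<le> norm (2 * of_real pi * of_nat (num_partitions n) - of_real \<kappa> * I) + norm (of_real \<kappa> * (I - of_real (sqrt pi * mc / x)))"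
    by (rule order_trans[OF _ norm_triangle_ineq]) (simp add: algebra_simps)
  also have "\<dots> \<le> exp (\<mu> / 2) * (B * exp B) * (2 * pi) + \<kappa> * (28 * exp (\<mu> / 2) / x)"
    using E1 E2 \<kappa> unfolding norm_mult by (intro add_mono mult_mono) auto
  \<comment> \<open>The bounds \<kappa> <= 1/2 and x >= 4 reduce 28 to 7/2, which is below 2 pi and
    so amounts to one unit after division by 2 pi.\<close>
  also have "\<kappa> * (28 * exp (\<mu> / 2) / x) \<le> 1 / 2 * (28 * exp (\<mu> / 2) / 4)"
    using \<kappa> x by (intro mult_mono divide_left_mono) auto
  also have "2 * complex_of_real pi * of_nat (num_partitions n) - of_real (\<kappa> * (sqrt pi * mc / x)) =
      of_real (2 * pi * num_partitions n - \<kappa> * (sqrt pi * mc / x))" by simp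
  also have "\<kappa> * (sqrt pi * mc / x) = 2 * pi * (mc / (2 * sqrt 2 * pi * x))"
    using \<kappa>(3) by (simp add: mult.assoc[symmetric])
  also have "2 * pi * num_partitions n - 2 * pi * (mc / (2 * sqrt 2 * pi * x)) = 2 * pi * (num_partitions n - mc / (2 * sqrt 2 * pi * x))"
    by (simp only: right_diff_distrib)
  finally have "2 * pi * \<bar>num_partitions n - mc / (2 * sqrt 2 * pi * x)\<bar> \<le> exp (\<mu> / 2) * (B * exp B) * (2 * pi) + 7 / 2 * exp (\<mu> / 2)"
    unfolding norm_of_real abs_mult by simp
  also have "7 / 2 * exp (\<mu> / 2) \<le> 2 * pi * exp (\<mu> / 2)" using pi_ge_two by (intro mult_right_mono) auto
  finally have "2 * pi * \<bar>num_partitions n - mc / (2 * sqrt 2 * pi * x)\<bar> \<le> 2 * pi * (exp (\<mu> / 2) * (B * exp B + 1))"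
    by (simp add: algebra_simps)
  hence main: "\<bar>num_partitions n - mc / (2 * sqrt 2 * pi * x)\<bar> \<le> exp (\<mu> / 2) * (B * exp B + 1)"
    by (simp only: mult_le_cancel_left_pos pi_gt_zero zero_less_mult_iff zero_less_numeral simp_thms)
  have "mc / (2 * sqrt 2 * pi * x) = exp \<mu> * (\<alpha> - 1 / (2 * \<beta>)) / (2 * sqrt 2 * pi * x)
     - exp (- \<mu>) * (\<alpha> + 1 / (2 * \<beta>)) / (2 * sqrt 2 * pi * x)"
    unfolding mc_def main_const_def \<mu>_def by (simp add: diff_divide_distrib)
  moreover have "0 \<le> exp (- \<mu>) * (\<alpha> + 1 / (2 * \<beta>)) / (2 * sqrt 2 * pi * x)"
    using pos by (intro divide_nonneg_nonneg mult_nonneg_nonneg add_nonneg_nonneg) auto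
  moreover have "exp (- \<mu>) * (\<alpha> + 1 / (2 * \<beta>)) / (2 * sqrt 2 * pi * x) \<le> exp (\<mu> / 2)"
  proof -
    have "\<mu> > 0" using pos by (simp add: \<mu>_def)
    have "1 / (2 * \<beta>) \<le> 1 / 4" using \<beta> by simp
    hence "\<alpha> + 1 / (2 * \<beta>) \<le> 2 + 1" using \<alpha> by linarith
    hence "exp (- \<mu>) * (\<alpha> + 1 / (2 * \<beta>)) \<le> 1 * (2 + 1)"
      using \<open>\<mu> > 0\<close> pos by (intro mult_mono) auto
    moreover have "2 * 1 * 2 * 4 \<le> 2 * sqrt 2 * pi * x"
      using pi_ge_two x by (intro mult_mono) auto
    ultimately have "exp (- \<mu>) * (\<alpha> + 1 / (2 * \<beta>)) / (2 * sqrt 2 * pi * x) \<le> 3 / 16"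
      using pos by (intro frac_le) auto
    also have "\<dots> \<le> 1" by simp
    also have "1 \<le> exp (\<mu> / 2)" using \<open>\<mu> > 0\<close> by simp
    finally show ?thesis .
  qed
  ultimately have "\<bar>num_partitions n - exp \<mu> * (\<alpha> - 1 / (2 * \<beta>)) / (2 * sqrt 2 * pi * x)\<bar> \<le>
      exp (\<mu> / 2) * (B * exp B + 1) + exp (\<mu> / 2)" using main by linarith
  thus ?thesis by (simp add: algebra_simps)
qed

section \<open>Numerical constants and the relative error\<close>

text \<open>24 terms of the Basel series reach 8/5, a lower bound for
  \<open>hr_alpha\<^sup>2\<close> from which the later constants are derived.\<close>

lemma pi_squared_ge: "pi\<^sup>2 \<ge> 48 / 5"
proof -
  have "(\<Sum>m<24. 1 / (real m + 1) ^ 2) \<le> pi\<^sup>2 / 6"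
    using sum_le_suminf[OF sums_summable[OF inverse_squares_sums'], of "{..<24}"] sums_unique[OF inverse_squares_sums']
    by simp
  moreover have "(\<Sum>m<24. 1 / (real m + 1) ^ 2) \<ge> 8 / 5"
    by (simp add: eval_nat_numeral)
  ultimately show ?thesis by simp
qed

lemma exp_4_ge: "exp (4::real) \<ge> 53"
proof -
  have "(53::real) \<le> (1 + 1 / 8 + (1 / 8)\<^sup>2 / 2) ^ 32" by (simp add: power_divide field_simps)
  also have "\<dots> \<le> exp (1 / 8) ^ 32"
    by (intro power_mono exp_lower_Taylor_quadratic) auto
  also have "\<dots> = exp 4" by (simp flip: exp_of_nat_mult)
  finally show ?thesis .
qed

text \<open>Intended for z = \<mu> / 16 with \<mu> >= 66, hence the bound 33 / 8.\<close>

lemma exp_ge_13_mult: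
  fixes z :: real
  assumes "z \<ge> 33 / 8"
  shows "exp z \<ge> 13 * z"
proof -
  have "13 * z \<le> 53 * (1 + (z - 4))" using assms by simp
  also have "\<dots> \<le> exp 4 * exp (z - 4)"
    using exp_4_ge assms by (intro mult_mono exp_ge_add_one_self) auto
  also have "\<dots> = exp z" by (simp flip: exp_add)
  finally show ?thesis .
qed

definition hr_alpha :: real where "hr_alpha = pi / sqrt 6"

definition hr_mu :: "real \<Rightarrow> real" where "hr_mu x = 2 * hr_alpha * sqrt x"

text \<open>The exponentially dominant half of the first term of Rademacher's series for p, with x =
  n - 1 / 24.\<close>

definition hr_main :: "real \<Rightarrow> real" where
  "hr_main x = exp (hr_mu x) * (hr_alpha - 1 / (2 * sqrt x)) / (2 * sqrt 2 * pi * x)"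

lemma hr_alpha_squared: "hr_alpha\<^sup>2 = pi\<^sup>2 / 6"
  by (simp add: hr_alpha_def power_divide)

lemma hr_alpha_bounds: "5 / 4 \<le> hr_alpha" "hr_alpha \<le> 2" "8 / 5 \<le> hr_alpha\<^sup>2"
proof -
  show sq: "8 / 5 \<le> hr_alpha\<^sup>2" using pi_squared_ge by (simp add: hr_alpha_squared)
  have "hr_alpha \<ge> 0" by (simp add: hr_alpha_def)
  moreover have "(5 / 4)\<^sup>2 \<le> hr_alpha\<^sup>2" using sq by (simp add: power2_eq_square)
  ultimately show "5 / 4 \<le> hr_alpha" by (rule power2_le_imp_le[rotated])
  have "2 \<le> sqrt 6" by (rule real_le_rsqrt) simp
  thus "hr_alpha \<le> 2" using pi_less_4 by (simp add: hr_alpha_def pos_divide_le_eq)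
qed

text \<open>In terms of \<mu> the main term is c (1 - 1 / \<mu>) exp \<mu> / \<mu>^2 with c = sqrt 2
  \<alpha>^3 / pi. Here c^2 = pi^4 / 108, so c is about 0.95.\<close>

lemma hr_main_ge:
  assumes "x > 0" "hr_mu x \<ge> 66"
  shows "hr_main x \<ge> 9 / 10 * exp (hr_mu x) / (hr_mu x)\<^sup>2"
proof -
  define \<mu> where "\<mu> = hr_mu x"
  define a where "a = hr_alpha"
  have a: "a > 0" using hr_alpha_bounds by (simp add: a_def)
  define c where "c = sqrt 2 * a ^ 3 / pi"
  have \<mu>: "\<mu> \<ge> 66" using assms by (simp add: \<mu>_def)
  have "92 / 100 \<le> c"
  proof (rule power2_le_imp_le)
    have "c\<^sup>2 = 2 * (a\<^sup>2) ^ 3 / pi\<^sup>2" by (simp add: c_def power_mult_distrib power_divide flip: power_mult)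
    also have "\<dots> = (pi\<^sup>2)\<^sup>2 / 108" unfolding a_def hr_alpha_squared by (simp add: field_simps eval_nat_numeral)
    also have "\<dots> \<ge> (48 / 5)\<^sup>2 / 108" using pi_squared_ge by (intro divide_right_mono power_mono) auto
    finally have "c\<^sup>2 \<ge> (48 / 5)\<^sup>2 / 108" .
    thus "(92 / 100)\<^sup>2 \<le> c\<^sup>2" by (simp add: power2_eq_square)
  qed (use a in \<open>simp add: c_def\<close>)
  moreover have "65 / 66 \<le> 1 - 1 / \<mu>" using \<mu> by (simp add: field_simps)
  ultimately have "92 / 100 * (65 / 66) \<le> c * (1 - 1 / \<mu>)" by (intro mult_mono) auto
  moreover have "9 / 10 \<le> 92 / 100 * (65 / 66 :: real)" by simp
  ultimately have "9 / 10 \<le> c * (1 - 1 / \<mu>)" by (rule order_trans[rotated])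
  hence "9 / 10 * (exp \<mu> / \<mu>\<^sup>2) \<le> c * (1 - 1 / \<mu>) * (exp \<mu> / \<mu>\<^sup>2)"
    by (rule mult_right_mono) simp
  also have "\<dots> = hr_main x"
  proof -
    define b where "b = sqrt x"
    have b: "b > 0" "x = b\<^sup>2" using assms(1) by (simp_all add: b_def)
    have \<mu>b: "\<mu> = 2 * a * b" by (simp add: \<mu>_def hr_mu_def a_def b_def)
    have "hr_main x = exp \<mu> * (a - 1 / (2 * b)) / (2 * sqrt 2 * pi * b\<^sup>2)"
      by (simp add: hr_main_def \<mu>_def[symmetric] a_def[symmetric] b_def[symmetric] b(2)[symmetric])
    also have "\<dots> = (1 / (2 * sqrt 2)) * (exp \<mu> * (a - 1 / (2 * b)) / (pi * b\<^sup>2))"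
      by simp
    also have "1 / (2 * sqrt 2) = sqrt 2 / 4" by (simp add: field_simps)
    also have "(sqrt 2 / 4) * (exp \<mu> * (a - 1 / (2 * b)) / (pi * b\<^sup>2)) = c * (1 - 1 / \<mu>) * (exp \<mu> / \<mu>\<^sup>2)"
      unfolding c_def \<mu>b using a b by (simp add: field_simps eval_nat_numeral)
    finally show ?thesis ..
  qed
  finally show ?thesis by (simp add: \<mu>_def)
qed

text \<open>The radius is r = exp (-z). Then r / (1 - r^2) is 1 / (2 sinh z), at most 1 / (2 z), and
  r / (1 - r) is at most 1 / z.\<close>

lemma abs_crank_diff_exp_le:
  assumes "n \<ge> 2" "z > 0"
  shows "\<bar>real_of_int (crank_diff n)\<bar> \<le> exp (n * z + 1 / (2 * z)) * (1 + 2 / z)"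
proof -
  define r where "r = exp (-z)"
  have r: "0 < r" "r < 1" using assms by (simp_all add: r_def)
  have r1: "r / (1 - r) \<le> 1 / z"
  proof -
    have "z * r \<le> 1 - r"
    proof -
      have "(z + 1) * r \<le> exp z * r" using exp_ge_add_one_self[of z] r by (intro mult_right_mono) (auto simp: add.commute)
      thus ?thesis by (simp add: r_def algebra_simps flip: exp_add)
    qed
    thus ?thesis using r assms by (simp add: field_simps)
  qed
  have r2: "r / (1 - r\<^sup>2) \<le> 1 / (2 * z)"
  proof -
    have "(2 * z) * exp (2 * z / 2) \<le> exp (2 * z) - 1" using assms by (intro exp_diff_ge) auto
    hence "(2 * z * exp z) * r\<^sup>2 \<le> (exp (2 * z) - 1) * r\<^sup>2" by (intro mult_right_mono) auto
    moreover have E: "exp z * r = 1" "exp (2 * z) * r\<^sup>2 = 1"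
      by (simp_all add: r_def power2_eq_square flip: exp_add)
    moreover have "(2 * z * exp z) * r\<^sup>2 = 2 * z * (exp z * r) * r" by (simp add: power2_eq_square)
    moreover have "(exp (2 * z) - 1) * r\<^sup>2 = 1 - r\<^sup>2" unfolding left_diff_distrib E by simp
    ultimately have "2 * z * r \<le> 1 - r\<^sup>2" by simp
    moreover have "r\<^sup>2 < 1" using r by (simp add: power_less_one_iff)
    ultimately show ?thesis using assms by (simp add: field_simps)
  qed
  have "r ^ n = exp (- (n * z))" by (simp add: r_def flip: exp_of_nat_mult)
  have "\<bar>real_of_int (crank_diff n)\<bar> = (\<bar>real_of_int (crank_diff n)\<bar> * r ^ n) * exp (n * z)"
    unfolding \<open>r ^ n = exp (- (n * z))\<close> by (simp flip: exp_add)
  also have "\<dots> \<le> ((1 + 2 * (r / (1 - r))) * exp (r / (1 - r\<^sup>2))) * exp (n * z)"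
    using abs_crank_diff_le[OF assms(1) r] by (intro mult_right_mono) auto
  also have "\<dots> \<le> ((1 + 2 * (1 / z)) * exp (1 / (2 * z))) * exp (n * z)"
    using r1 r2 r assms by (intro mult_right_mono mult_mono) auto
  finally show ?thesis by (simp add: exp_add mult_ac)
qed

text \<open>The error for p has exponent 5/8 \<mu>, the crank difference 9/16 \<mu>. The gap of 3/8
  \<mu> to the main term pays for the polynomial factors once \<mu> >= 66. The relative error
  \<mu>^(-3) matches the order x^(-3/2) of the concavity gain.\<close>

lemma crank_count_approx:
  fixes n :: nat and x \<mu> :: real
  defines "x \<equiv> real n - 1 / 24"
  defines "\<mu> \<equiv> hr_mu x"
  assumes n: "n \<ge> 5" and \<mu>: "\<mu> \<ge> 66"
  shows "\<bar>real (num_partitions n) - hr_main x\<bar> + \<bar>real_of_int (crank_diff n)\<bar> \<le> hr_main x / \<mu> ^ 3"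
proof -
  define a where "a = hr_alpha"
  define b where "b = sqrt x"
  define y where "y = a / b"
  define B where "B = y / 24 + \<mu> / 8"
  have a: "5 / 4 \<le> a" "a \<le> 2" "8 / 5 \<le> a\<^sup>2" using hr_alpha_bounds by (simp_all add: a_def)
  have x: "x \<ge> 4" using n by (simp add: x_def)
  have b: "b \<ge> 2" "b\<^sup>2 = x" using x by (auto simp: b_def intro!: real_le_rsqrt)
  have y: "0 < y" "y \<le> 1" using a b by (simp_all add: y_def)
  have \<mu>b: "\<mu> = 2 * a * b" by (simp add: \<mu>_def hr_mu_def a_def b_def)
  have xy: "x * y = \<mu> / 2"
    using b unfolding b(2)[symmetric] y_def \<mu>b by (simp add: power2_eq_square)
  have p: "\<bar>real (num_partitions n) - hr_main x\<bar> \<le> exp (\<mu> / 2) * (B * exp B + 2)"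
    using num_partitions_approx[OF n]
    unfolding hr_main_def \<mu>_def hr_mu_def B_def y_def a_def b_def x_def hr_alpha_def .
  \<comment> \<open>Here 1 / y = \<mu> / (2 \<alpha>^2) and \<alpha>^2 >= 8/5.\<close>
  have inv_y: "1 / y \<le> 5 / 16 * \<mu>"
  proof -
    have "(8 / 5) * b \<le> a\<^sup>2 * b" using a b by (intro mult_right_mono) auto
    thus ?thesis using a b by (simp add: y_def \<mu>b field_simps power2_eq_square)
  qed
  \<comment> \<open>The choice z = y / 2 is close to 1 / sqrt (2 n), the minimiser of n z + 1 / (2
    z). It gives \<mu> / 4 + y / 48 + 1 / y, and 1/4 + 5/16 = 9/16.\<close>
  have c: "\<bar>real_of_int (crank_diff n)\<bar> \<le> exp (9 / 16 * \<mu> + y / 48) * (1 + 5 / 4 * \<mu>)"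
  proof -
    have "\<bar>real_of_int (crank_diff n)\<bar> \<le> exp (n * (y / 2) + 1 / (2 * (y / 2))) * (1 + 2 / (y / 2))"
      using n y by (intro abs_crank_diff_exp_le) auto
    also have "n * (y / 2) = \<mu> / 4 + y / 48"
      using xy by (simp add: x_def algebra_simps)
    also have "exp (\<mu> / 4 + y / 48 + 1 / (2 * (y / 2))) * (1 + 2 / (y / 2)) \<le> exp (9 / 16 * \<mu> + y / 48) * (1 + 5 / 4 * \<mu>)"
      using inv_y y by (intro mult_mono) auto
    finally show ?thesis .
  qed
  have small: "exp (y / 24) \<le> 11 / 10" "exp (y / 48) \<le> 11 / 10"
  proof -
    have "exp (1 / 24) \<le> (11 / 10 :: real)"
      using exp_bound[of "1/24"] by (simp add: power2_eq_square)
    moreover have "exp (y / 24) \<le> exp (1 / 24)" "exp (y / 48) \<le> exp (1 / 24)" using y by simp_all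
    ultimately show "exp (y / 24) \<le> 11 / 10" "exp (y / 48) \<le> 11 / 10" by linarith+
  qed
  have decay: "exp (- \<mu> / 16) \<le> 1 / 50" "exp (- \<mu> / 8) \<le> 1 / 50"
  proof -
    have "exp 4 \<le> exp (\<mu> / 16)" "exp 4 \<le> exp (\<mu> / 8)" using \<mu> by simp_all
    hence "50 \<le> exp (\<mu> / 16)" "50 \<le> exp (\<mu> / 8)" using exp_4_ge by linarith+
    hence "inverse (exp (\<mu> / 16)) \<le> inverse 50" "inverse (exp (\<mu> / 8)) \<le> inverse 50"
      by (intro le_imp_inverse_le; simp)+
    thus "exp (- \<mu> / 16) \<le> 1 / 50" "exp (- \<mu> / 8) \<le> 1 / 50"
      by (simp_all add: exp_minus inverse_eq_divide)
  qed
  have e1: "exp (\<mu> / 2) * (B * exp B + 2) = exp (5 / 8 * \<mu>) * (B * exp (y / 24) + 2 * exp (- \<mu> / 8))"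
  proof -
    have "exp (\<mu> / 2) * exp B = exp (5 / 8 * \<mu>) * exp (y / 24)"
      by (simp add: B_def flip: exp_add)
    moreover have "exp (\<mu> / 2) = exp (5 / 8 * \<mu>) * exp (- \<mu> / 8)"
      by (simp flip: exp_add)
    ultimately show ?thesis by (simp add: algebra_simps)
  qed
  have e2: "exp (9 / 16 * \<mu> + y / 48) * (1 + 5 / 4 * \<mu>) = exp (5 / 8 * \<mu>) * (exp (- \<mu> / 16) * exp (y / 48) * (1 + 5 / 4 * \<mu>))"
    by (simp flip: exp_add mult.assoc)
  have "B * exp (y / 24) + 2 * exp (- \<mu> / 8) + exp (- \<mu> / 16) * exp (y / 48) * (1 + 5 / 4 * \<mu>) \<le>
      (1 / 24 + \<mu> / 8) * (11 / 10) + 2 * (1 / 50) + (1 / 50) * (11 / 10) * (1 + 5 / 4 * \<mu>)"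
    using small decay \<mu> y by (intro add_mono mult_mono) (auto simp: B_def)
  also have "\<dots> \<le> \<mu> / 4" using \<mu> by (simp add: field_simps)
  finally have "exp (5 / 8 * \<mu>) * (B * exp (y / 24) + 2 * exp (- \<mu> / 8) + exp (- \<mu> / 16) * exp (y / 48) * (1 + 5 / 4 * \<mu>))
      \<le> exp (5 / 8 * \<mu>) * (\<mu> / 4)" by (rule mult_left_mono) simp
  moreover have "\<bar>real (num_partitions n) - hr_main x\<bar> + \<bar>real_of_int (crank_diff n)\<bar> \<le>
      exp (5 / 8 * \<mu>) * (B * exp (y / 24) + 2 * exp (- \<mu> / 8)) + exp (5 / 8 * \<mu>) * (exp (- \<mu> / 16) * exp (y / 48) * (1 + 5 / 4 * \<mu>))"
    using p c unfolding e1 e2 by (rule add_mono)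
  ultimately have "\<bar>real (num_partitions n) - hr_main x\<bar> + \<bar>real_of_int (crank_diff n)\<bar> \<le> exp (5 / 8 * \<mu>) * (\<mu> / 4)"
    unfolding distrib_left[symmetric] by (rule order_trans[rotated])
  also have "\<dots> \<le> hr_main x / \<mu> ^ 3"
  proof -
    \<comment> \<open>The sixth power is needed for \<mu> * \<mu>^2 * \<mu>^3, and 10/36 is 1/4
      divided by 9/10; (13/16)^6 is just above it.\<close>
    have "13 * (\<mu> / 16) \<le> exp (\<mu> / 16)" using \<mu> by (intro exp_ge_13_mult) simp
    hence "(13 * (\<mu> / 16)) ^ 6 \<le> exp (\<mu> / 16) ^ 6" using \<mu> by (intro power_mono) auto
    also have "exp (\<mu> / 16) ^ 6 = exp (3 / 8 * \<mu>)" by (simp flip: exp_of_nat_mult)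
    finally have "(13 / 16) ^ 6 * \<mu> ^ 6 \<le> exp (3 / 8 * \<mu>)" by (simp add: power_mult_distrib power_divide)
    moreover have "(10 / 36) * \<mu> ^ 6 \<le> (13 / 16) ^ 6 * \<mu> ^ 6"
      by (intro mult_right_mono) (simp_all add: power_divide)
    ultimately have "(10 / 36) * \<mu> ^ 6 \<le> exp (3 / 8 * \<mu>)" by linarith
    hence "exp (5 / 8 * \<mu>) * ((10 / 36) * \<mu> ^ 6) \<le> exp (5 / 8 * \<mu>) * exp (3 / 8 * \<mu>)"
      by (intro mult_left_mono) auto
    also have "\<dots> = exp \<mu>" by (simp flip: exp_add)
    finally have "exp (5 / 8 * \<mu>) * (\<mu> / 4) \<le> 9 / 10 * exp \<mu> / \<mu>\<^sup>2 / \<mu> ^ 3"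
      using \<mu> by (simp add: field_simps eval_nat_numeral)
    also have "\<dots> \<le> hr_main x / \<mu> ^ 3"
      using hr_main_ge[of x] x \<mu> by (intro divide_right_mono) (auto simp: \<mu>_def)
    finally show ?thesis .
  qed
  finally show ?thesis .
qed

section \<open>Log-concavity of the main term and of its perturbation\<close>

text \<open>The gain comes from the concave square root in the exponent: sqrt (x - 1) + sqrt (x + 1)
  <= 2 sqrt x - 1 / (4 x sqrt x). The factor \<alpha> - 1 / (2 sqrt x) is log-concave since 1 / sqrt
  x is convex. Only 1 / x is log-convex; its exact loss 1 - 1 / x^2 is kept on the left.\<close>

lemma hr_main_log_concave:
  assumes x: "x \<ge> 100"
  shows "hr_main (x - 1) * hr_main (x + 1) * (1 - 1 / x\<^sup>2) \<le> exp (- (hr_alpha / (2 * (x * sqrt x)))) * (hr_main x)\<^sup>2"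
proof -
  define a where "a = hr_alpha"
  have a: "5 / 4 \<le> a" using hr_alpha_bounds by (simp add: a_def)
  define u where "u = sqrt (x - 1)"
  define v where "v = sqrt x"
  define w where "w = sqrt (x + 1)"
  have sq: "u\<^sup>2 = x - 1" "v\<^sup>2 = x" "w\<^sup>2 = x + 1" using x by (simp_all add: u_def v_def w_def)
  have ge: "u \<ge> 9" "v \<ge> 10" "w \<ge> 10" using x unfolding u_def v_def w_def by (auto intro!: real_le_rsqrt)
  have uw_le: "u * w \<le> v\<^sup>2 - 1 / (2 * v\<^sup>2)"
  proof (rule power2_le_imp_le)
    have "(u * w)\<^sup>2 = x\<^sup>2 - 1" unfolding power_mult_distrib sq by (simp add: power2_eq_square algebra_simps)
    also have "\<dots> \<le> (x - 1 / (2 * x))\<^sup>2" using x by (simp add: power2_eq_square field_simps)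
    finally show "(u * w)\<^sup>2 \<le> (v\<^sup>2 - 1 / (2 * v\<^sup>2))\<^sup>2" unfolding sq .
    show "0 \<le> v\<^sup>2 - 1 / (2 * v\<^sup>2)" unfolding sq using x by (simp add: field_simps) (metis mult_mono' order_trans mult_1 one_le_numeral zero_le_one)
  qed
  have sum_le: "u + w \<le> 2 * v - 1 / (4 * v ^ 3)"
  proof (rule power2_le_imp_le)
    have "(u + w)\<^sup>2 = 2 * v\<^sup>2 + 2 * (u * w)" using sq by (simp add: power2_sum)
    also have "\<dots> \<le> 4 * v\<^sup>2 - 1 / v\<^sup>2" using uw_le by simp
    also have "\<dots> \<le> (2 * v - 1 / (4 * v ^ 3))\<^sup>2"
      using ge by (simp add: power2_eq_square power3_eq_cube field_simps)
    finally show "(u + w)\<^sup>2 \<le> (2 * v - 1 / (4 * v ^ 3))\<^sup>2" .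
    have "1 / (4 * v ^ 3) \<le> 1" using ge by (simp add: field_simps) (metis one_le_power order_trans one_le_numeral mult_left_mono mult_1_right zero_le_numeral)
    thus "0 \<le> 2 * v - 1 / (4 * v ^ 3)" using ge by linarith
  qed
  have inv_ge: "2 / v \<le> 1 / u + 1 / w"
  proof -
    have "u * w \<le> v\<^sup>2" using uw_le ge by (smt (verit) zero_le_divide_1_iff zero_le_power2 mult_nonneg_nonneg)
    have "2 * (u * w) \<le> v * (u + w)"
    proof (rule power2_le_imp_le)
      have "(2 * (u * w))\<^sup>2 = 4 * (u * w) * (u * w)" by (simp add: power2_eq_square)
      also have "\<dots> \<le> 4 * v\<^sup>2 * (u * w)" using \<open>u * w \<le> v\<^sup>2\<close> ge by (intro mult_right_mono) auto
      also have "\<dots> \<le> v\<^sup>2 * (u + w)\<^sup>2"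
      proof -
        have "4 * (u * w) \<le> (u + w)\<^sup>2" using zero_le_power2[of "u - w"] by (simp add: power2_diff power2_sum)
        hence "v\<^sup>2 * (4 * (u * w)) \<le> v\<^sup>2 * (u + w)\<^sup>2" by (intro mult_left_mono) auto
        thus ?thesis by (simp add: mult_ac)
      qed
      finally show "(2 * (u * w))\<^sup>2 \<le> (v * (u + w))\<^sup>2" by (simp add: power_mult_distrib)
    qed (use ge in auto)
    thus ?thesis using ge by (simp add: field_simps)
  qed
  have prod_le: "(a - 1 / (2 * u)) * (a - 1 / (2 * w)) \<le> (a - 1 / (2 * v))\<^sup>2"
  proof -
    define p where "p = a - 1 / (2 * u)"
    define q where "q = a - 1 / (2 * w)"
    have "1 / (2 * u) \<le> 1" "1 / (2 * w) \<le> 1" using ge by simp_all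
    hence pq: "p \<ge> 0" "q \<ge> 0" using a by (simp_all add: p_def q_def)
    have "p * q \<le> ((p + q) / 2)\<^sup>2"
      using zero_le_power2[of "p - q"] by (simp add: power2_eq_square field_simps)
    also have "(p + q) / 2 \<le> a - 1 / (2 * v)" using inv_ge by (simp add: p_def q_def field_simps)
    hence "((p + q) / 2)\<^sup>2 \<le> (a - 1 / (2 * v))\<^sup>2" using pq by (intro power_mono) auto
    finally show ?thesis by (simp add: p_def q_def)
  qed
  define K where "K = 2 * sqrt 2 * pi"
  have K: "K > 0" by (simp add: K_def)
  have h: "hr_main (x - 1) = exp (2 * a * u) * (a - 1 / (2 * u)) / (K * (x - 1))"
    "hr_main x = exp (2 * a * v) * (a - 1 / (2 * v)) / (K * x)"
    "hr_main (x + 1) = exp (2 * a * w) * (a - 1 / (2 * w)) / (K * (x + 1))"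
    by (simp_all add: hr_main_def hr_mu_def a_def u_def v_def w_def K_def)
  have "hr_main (x - 1) * hr_main (x + 1) * (1 - 1 / x\<^sup>2) =
      exp (2 * a * (u + w)) * ((a - 1 / (2 * u)) * (a - 1 / (2 * w))) / (K * x)\<^sup>2"
  proof -
    define d where "d = 1 - 1 / x\<^sup>2"
    have "1 < x\<^sup>2" using x by (intro one_less_power) auto
    hence d: "d \<noteq> 0" by (simp add: d_def)
    have eq: "(x - 1) * (x + 1) = x\<^sup>2 * d" using x by (simp add: d_def power2_eq_square field_simps)
    have "hr_main (x - 1) * hr_main (x + 1) = exp (2 * a * (u + w)) * ((a - 1 / (2 * u)) * (a - 1 / (2 * w))) / (K\<^sup>2 * ((x - 1) * (x + 1)))"
      unfolding h by (simp add: distrib_left exp_add power2_eq_square mult_ac)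
    thus ?thesis
      unfolding eq d_def[symmetric] using d by (simp add: power_mult_distrib)
  qed
  also have "\<dots> \<le> exp (2 * a * (2 * v - 1 / (4 * v ^ 3))) * (a - 1 / (2 * v))\<^sup>2 / (K * x)\<^sup>2"
  proof (intro divide_right_mono mult_mono prod_le)
    have "1 / (2 * u) \<le> 1" "1 / (2 * w) \<le> 1" using ge by simp_all
    thus "0 \<le> (a - 1 / (2 * u)) * (a - 1 / (2 * w))" using a by (intro mult_nonneg_nonneg) auto
  qed (use sum_le a in auto)
  also have "2 * a * (2 * v - 1 / (4 * v ^ 3)) = - (a / (2 * (x * v))) + 2 * (2 * a * v)"
    using ge unfolding sq(2)[symmetric] by (simp add: field_simps eval_nat_numeral)
  also have "exp (- (a / (2 * (x * v))) + 2 * (2 * a * v)) * (a - 1 / (2 * v))\<^sup>2 / (K * x)\<^sup>2 =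
      exp (- (a / (2 * (x * v)))) * (hr_main x)\<^sup>2"
    unfolding h(2) exp_add exp_double by (simp add: power_mult_distrib power_divide)
  finally show ?thesis by (simp add: a_def v_def)
qed

text \<open>A relative error e in each of the values costs at most the factor ((1 + e) / (1 - e))^2
  <= exp (6 e), and the factor 1 / x of the main term costs exp (1 / (x^2 - 1)). Both together must
  stay within the gain \<alpha> / (2 x sqrt x).\<close>

theorem crank_counts_turan_large:
  fixes n :: nat and \<sigma> :: real
  assumes n: "n \<ge> 700" and \<sigma>: "\<sigma> = 1 \<or> \<sigma> = -1"
  defines "Z \<equiv> (\<lambda>m. real (num_partitions m) + \<sigma> * real_of_int (crank_diff m))"
  shows "Z (n - 1) * Z (n + 1) \<le> (Z n)\<^sup>2"
proof -
  define x where "x = real n - 1 / 24"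
  have x: "x \<ge> 699" using n by (simp add: x_def)
  define v where "v = sqrt x"
  define u where "u = sqrt (x - 1)"
  have sq: "v\<^sup>2 = x" "u\<^sup>2 = x - 1" using x by (simp_all add: v_def u_def)
  have v: "v \<ge> 26" using x unfolding v_def by (intro real_le_rsqrt) auto
  have uv: "u \<ge> 99 / 100 * v"
  proof (rule power2_le_imp_le)
    show "(99 / 100 * v)\<^sup>2 \<le> u\<^sup>2" using x unfolding power_mult_distrib sq by (simp add: power2_eq_square)
  qed (use x in \<open>simp add: u_def\<close>)
  define a where "a = hr_alpha"
  have a: "5 / 4 \<le> a" "8 / 5 \<le> a\<^sup>2" using hr_alpha_bounds by (simp_all add: a_def)
  define e where "e = 1 / hr_mu (x - 1) ^ 3"
  have mu: "hr_mu (x - 1) \<ge> 66"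
  proof (rule power2_le_imp_le)
    have "66\<^sup>2 \<le> 4 * (8 / 5) * (x - 1)" using x by simp
    also have "\<dots> \<le> 4 * a\<^sup>2 * (x - 1)" using a x by (intro mult_right_mono) auto
    also have "\<dots> = (hr_mu (x - 1))\<^sup>2" using x by (simp add: hr_mu_def power_mult_distrib a_def)
    finally show "66\<^sup>2 \<le> (hr_mu (x - 1))\<^sup>2" .
    show "0 \<le> hr_mu (x - 1)" using a x by (simp add: hr_mu_def a_def)
  qed
  have e0: "e > 0" using mu by (simp add: e_def)
  \<comment> \<open>For e > 0 the bound 1/3 is exactly what (1 + 3 e) (1 - e) >= 1 + e
    requires.\<close>
  have e_small: "e \<le> 1 / 3"
  proof -
    have "3 \<le> hr_mu (x - 1) ^ 1" using mu by simp
    also have "\<dots> \<le> hr_mu (x - 1) ^ 3" using mu by (intro power_increasing) auto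
    finally have "3 \<le> hr_mu (x - 1) ^ 3" .
    thus ?thesis using mu unfolding e_def by (intro divide_left_mono) auto
  qed
  have h_pos: "hr_main z \<ge> 0" if "z \<ge> 4" for z
  proof -
    have "2 \<le> sqrt z" using that by (intro real_le_rsqrt) auto
    hence "1 / (2 * sqrt z) \<le> 1 / 1" using that by (intro divide_left_mono) auto
    hence "0 \<le> hr_alpha - 1 / (2 * sqrt z)" using a unfolding a_def by linarith
    thus ?thesis unfolding hr_main_def using that by (intro divide_nonneg_nonneg mult_nonneg_nonneg) auto
  qed
  have approx: "\<bar>Z m - hr_main (real m - 1 / 24)\<bar> \<le> e * hr_main (real m - 1 / 24)" if m: "m \<ge> n - 1" for m
  proof -
    define z where "z = real m - 1 / 24"
    have z: "z \<ge> x - 1" using m n by (simp add: z_def x_def)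
    have "hr_mu (x - 1) \<le> hr_mu z" using z a by (simp add: hr_mu_def a_def mult_left_mono)
    hence mz: "66 \<le> hr_mu z" "1 / hr_mu z ^ 3 \<le> e"
      using mu unfolding e_def by (auto intro!: divide_left_mono power_mono mult_pos_pos zero_less_power)
    have "\<bar>Z m - hr_main z\<bar> \<le> \<bar>real (num_partitions m) - hr_main z\<bar> + \<bar>real_of_int (crank_diff m)\<bar>"
      using \<sigma> by (auto simp: Z_def)
    also have "\<dots> \<le> hr_main z / hr_mu z ^ 3"
      using crank_count_approx[of m] m n mz(1) by (simp add: z_def)
    also have "\<dots> = (1 / hr_mu z ^ 3) * hr_main z" by simp
    also have "\<dots> \<le> e * hr_main z" using mz h_pos[of z] z x by (intro mult_right_mono) auto
    finally show ?thesis by (simp add: z_def)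
  qed
  have eqs: "real (n - 1) - 1 / 24 = x - 1" "real (n + 1) - 1 / 24 = x + 1" "real n - 1 / 24 = x"
    using n by (simp_all add: x_def of_nat_diff)
  define h where "h = hr_main"
  have hp: "h (x - 1) \<ge> 0" "h x \<ge> 0" "h (x + 1) \<ge> 0" using h_pos x by (simp_all add: h_def)
  have Zm: "\<bar>Z (n - 1) - h (x - 1)\<bar> \<le> e * h (x - 1)" using approx[of "n - 1"] unfolding eqs h_def by simp
  have Z0: "\<bar>Z n - h x\<bar> \<le> e * h x" using approx[of n] unfolding eqs h_def by simp
  have Zp: "\<bar>Z (n + 1) - h (x + 1)\<bar> \<le> e * h (x + 1)" using approx[of "n + 1"] unfolding eqs h_def by simp
  \<comment> \<open>With v = sqrt x, the product 8 (125/64) (97/100) exceeds 15, so 6 e is at most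
    (2/5) / v^3. The other loss is at most (1/10) / v^3, and the sum (1/2) / v^3 is within the gain
    because \<alpha> >= 1.\<close>
  have "6 * e + 1 / (x\<^sup>2 - 1) \<le> a / (2 * (x * v))"
  proof -
    have "hr_mu (x - 1) = 2 * a * u" by (simp add: hr_mu_def a_def u_def)
    have "125 / 64 \<le> a ^ 3" using power_mono[OF a(1), of 3] by (simp add: power_divide)
    moreover have "97 / 100 * v ^ 3 \<le> u ^ 3"
    proof -
      have "97 / 100 * v ^ 3 \<le> (99 / 100) ^ 3 * v ^ 3" using v by (intro mult_right_mono) (simp_all add: power_divide)
      also have "\<dots> = (99 / 100 * v) ^ 3" by (simp only: power_mult_distrib)
      also have "\<dots> \<le> u ^ 3" using uv v by (intro power_mono) auto
      finally show ?thesis .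
    qed
    ultimately have "8 * (125 / 64) * (97 / 100 * v ^ 3) \<le> 8 * a ^ 3 * u ^ 3"
      using v a by (intro mult_mono) auto
    moreover have "15 * v ^ 3 \<le> 8 * (125 / 64) * (97 / 100 * v ^ 3)" using v by simp
    ultimately have "15 * v ^ 3 \<le> 8 * a ^ 3 * u ^ 3" by linarith
    also have "\<dots> = hr_mu (x - 1) ^ 3" unfolding \<open>hr_mu (x - 1) = 2 * a * u\<close> by (simp add: power_mult_distrib)
    finally have "e \<le> 1 / (15 * v ^ 3)" unfolding e_def using v mu by (intro divide_left_mono mult_pos_pos zero_less_power) auto
    moreover have "1 / (x\<^sup>2 - 1) \<le> (1 / 10) / v ^ 3"
    proof -
      have "v ^ 3 \<ge> 1" using v by (intro one_le_power) auto
      have "26 * v ^ 3 \<le> v * v ^ 3" using v by (intro mult_right_mono) auto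
      also have "v * v ^ 3 = x\<^sup>2" unfolding sq(1)[symmetric] by (simp add: eval_nat_numeral)
      finally have 10: "10 * v ^ 3 \<le> x\<^sup>2 - 1" using \<open>v ^ 3 \<ge> 1\<close> by linarith
      have "0 < 10 * v ^ 3" using \<open>v ^ 3 \<ge> 1\<close> by linarith
      with 10 have "1 / (x\<^sup>2 - 1) \<le> 1 / (10 * v ^ 3)" by (intro frac_le) simp_all
      thus ?thesis by simp
    qed
    ultimately have "6 * e + 1 / (x\<^sup>2 - 1) \<le> 6 * (1 / (15 * v ^ 3)) + (1 / 10) / v ^ 3" by simp
    also have "\<dots> = (1 / 2) / v ^ 3" by (simp add: field_simps)
    also have "\<dots> \<le> (a / 2) / v ^ 3" using a v by (intro divide_right_mono) auto
    also have "\<dots> = a / (2 * (x * v))" unfolding sq(1)[symmetric] by (simp add: eval_nat_numeral mult_ac)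
    finally show ?thesis .
  qed
  hence D: "exp (6 * e + 1 / (x\<^sup>2 - 1)) * exp (- (a / (2 * (x * v)))) \<le> 1"
    by (simp flip: exp_add)
  have "(1 + e)\<^sup>2 \<le> exp (6 * e) * (1 - e)\<^sup>2"
  proof -
    have "1 + e \<le> exp (3 * e) * (1 - e)"
    proof -
      have "1 + e \<le> (1 + 3 * e) * (1 - e)" using e0 e_small by (simp add: algebra_simps)
      also have "\<dots> \<le> exp (3 * e) * (1 - e)" using e_small exp_ge_add_one_self[of "3 * e"] by (intro mult_right_mono) auto
      finally show ?thesis .
    qed
    hence "(1 + e)\<^sup>2 \<le> (exp (3 * e) * (1 - e))\<^sup>2" using e0 by (intro power_mono) auto
    also have "\<dots> = exp (6 * e) * (1 - e)\<^sup>2" by (simp add: power_mult_distrib flip: exp_double)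
    finally show ?thesis .
  qed
  have x2: "x\<^sup>2 > 1" using x by (intro one_less_power) auto
  have "1 \<le> (1 - 1 / x\<^sup>2) * exp (1 / (x\<^sup>2 - 1))"
  proof -
    have "1 = (1 - 1 / x\<^sup>2) * (1 + 1 / (x\<^sup>2 - 1))"
    proof -
      have "x\<^sup>2 - 1 \<noteq> 0" "x\<^sup>2 \<noteq> 0" using x2 by linarith+
      thus ?thesis by (simp add: divide_simps)
    qed
    also have "\<dots> \<le> (1 - 1 / x\<^sup>2) * exp (1 / (x\<^sup>2 - 1))"
      using x2 by (intro mult_left_mono exp_ge_add_one_self) (simp add: divide_le_eq)
    finally show ?thesis .
  qed
  hence "h (x - 1) * h (x + 1) * 1 \<le> h (x - 1) * h (x + 1) * ((1 - 1 / x\<^sup>2) * exp (1 / (x\<^sup>2 - 1)))"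
    using hp by (intro mult_left_mono) auto
  also have "\<dots> = (h (x - 1) * h (x + 1) * (1 - 1 / x\<^sup>2)) * exp (1 / (x\<^sup>2 - 1))" by simp
  also have "\<dots> \<le> (exp (- (a / (2 * (x * v)))) * (h x)\<^sup>2) * exp (1 / (x\<^sup>2 - 1))"
    using hr_main_log_concave[of x] x by (intro mult_right_mono) (auto simp: a_def v_def h_def)
  finally have hh: "h (x - 1) * h (x + 1) \<le> exp (- (a / (2 * (x * v)))) * (h x)\<^sup>2 * exp (1 / (x\<^sup>2 - 1))" by simp
  have "Z (n - 1) * Z (n + 1) \<le> (h (x - 1) * (1 + e)) * (h (x + 1) * (1 + e))"
  proof (rule mult_mono)
    show "Z (n - 1) \<le> h (x - 1) * (1 + e)" using Zm by (simp add: algebra_simps)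
    show "Z (n + 1) \<le> h (x + 1) * (1 + e)" using Zp by (simp add: algebra_simps)
    show "0 \<le> h (x - 1) * (1 + e)" using hp e0 by simp
    have "e * h (x + 1) \<le> 1 * h (x + 1)" using e_small hp by (intro mult_right_mono) auto
    thus "0 \<le> Z (n + 1)" using Zp by linarith
  qed
  also have "\<dots> = (h (x - 1) * h (x + 1)) * (1 + e)\<^sup>2" by (simp add: power2_eq_square)
  also have "\<dots> \<le> (exp (- (a / (2 * (x * v)))) * (h x)\<^sup>2 * exp (1 / (x\<^sup>2 - 1))) * (exp (6 * e) * (1 - e)\<^sup>2)"
    by (rule mult_mono[OF hh \<open>(1 + e)\<^sup>2 \<le> exp (6 * e) * (1 - e)\<^sup>2\<close>]) simp_all
  also have "\<dots> = (exp (6 * e + 1 / (x\<^sup>2 - 1)) * exp (- (a / (2 * (x * v))))) * (h x * (1 - e))\<^sup>2"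
    by (simp add: exp_add power_mult_distrib)
  also have "\<dots> \<le> 1 * (h x * (1 - e))\<^sup>2" by (intro mult_right_mono D) auto
  also have "\<dots> \<le> 1 * (Z n)\<^sup>2"
  proof (intro mult_left_mono power_mono)
    show "h x * (1 - e) \<le> Z n" using Z0 by (simp add: algebra_simps)
    show "0 \<le> h x * (1 - e)" using hp e_small by simp
  qed auto
  finally show ?thesis by simp
qed

section \<open>The Turan inequality for small indices\<close>

text \<open>Codes for series with coefficients 0, 1 and -1 and long gaps. \<open>Zero8\<close> skips
  eight zero coefficients in one step, which shortens the symbolic evaluation.\<close>

datatype sparse_coeff = Zero8 | Zero1 | Plus | Minus

primrec sparse_fps :: "sparse_coeff list \<Rightarrow> int fps" where
  "sparse_fps [] = 0"
| "sparse_fps (c # cs) = (case c of Zero8 \<Rightarrow> fps_X ^ 8 * sparse_fps cs | Zero1 \<Rightarrow> fps_X * sparse_fps cs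
     | Plus \<Rightarrow> 1 + fps_X * sparse_fps cs | Minus \<Rightarrow> - 1 + fps_X * sparse_fps cs)"

fun zeros :: "nat \<Rightarrow> sparse_coeff list" where
  "zeros (Suc (Suc (Suc (Suc (Suc (Suc (Suc (Suc n)))))))) = Zero8 # zeros n"
| "zeros (Suc n) = Zero1 # zeros n"
| "zeros 0 = []"

lemma sparse_fps_zeros: "sparse_fps (zeros n @ cs) = fps_X ^ n * sparse_fps cs"
  by (induction n rule: zeros.induct) (simp_all add: mult.assoc eval_nat_numeral)

text \<open>Seven and not eight, because the pattern match on \<open>Zero8\<close> in
  \<open>sparse_conv\<close> has already removed the head.\<close>

fun drop7 :: "'a list \<Rightarrow> 'a list" where
  "drop7 (_ # _ # _ # _ # _ # _ # _ # xs) = xs"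
| "drop7 _ = []"

lemma drop7_eq: "drop7 xs = drop 7 xs"
  by (cases xs rule: drop7.cases) (simp_all add: eval_nat_numeral)

text \<open>The entries met with coefficient 1 and those met with -1 are added up separately in a
  and b; a single subtraction comes at the end.\<close>

fun sparse_conv :: "sparse_coeff list \<Rightarrow> int list \<Rightarrow> int \<Rightarrow> int \<Rightarrow> int" where
  "sparse_conv [] xs a b = a - b"
| "sparse_conv (c # cs) [] a b = a - b"
| "sparse_conv (Zero8 # cs) (x # xs) a b = sparse_conv cs (drop7 xs) a b"
| "sparse_conv (Zero1 # cs) (x # xs) a b = sparse_conv cs xs a b"
| "sparse_conv (Plus # cs) (x # xs) a b = sparse_conv cs xs (a + x) b"
| "sparse_conv (Minus # cs) (x # xs) a b = sparse_conv cs xs a (b + x)"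

lemma sum_nth_shift:
  fixes f :: "int fps"
  shows "(\<Sum>i<length xs. fps_nth (fps_X ^ k * f) i * xs ! i) = (\<Sum>i<length (drop k xs). fps_nth f i * drop k xs ! i)"
proof -
  have "(\<Sum>i<length xs. fps_nth (fps_X ^ k * f) i * xs ! i) = (\<Sum>i\<in>{k..<length xs}. fps_nth f (i - k) * xs ! i)"
    by (rule sum.mono_neutral_cong_right) (auto simp: fps_X_power_mult_nth)
  also have "\<dots> = (\<Sum>i<length (drop k xs). fps_nth f i * drop k xs ! i)"
    by (rule sum.reindex_bij_witness[of _ "\<lambda>i. i + k" "\<lambda>i. i - k"]) (auto simp: add.commute)
  finally show ?thesis .
qed

lemma sparse_conv_eq:
  "sparse_conv cs xs a b = a - b + (\<Sum>i<length xs. fps_nth (sparse_fps cs) i * xs ! i)"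
proof (induction cs xs a b rule: sparse_conv.induct)
  case (3 cs x xs a b)
  show ?case using 3 sum_nth_shift[of 8 "sparse_fps cs" "x # xs"]
    by (simp add: drop7_eq)
next
  case (4 cs x xs a b)
  show ?case using 4 sum_nth_shift[of 1 "sparse_fps cs" "x # xs"] by simp
next
  case (5 cs x xs a b)
  have "(\<Sum>i<length (x # xs). fps_nth (1 + fps_X * sparse_fps cs) i * (x # xs) ! i) =
      (\<Sum>i<length (x # xs). fps_nth 1 i * (x # xs) ! i) + (\<Sum>i<length (x # xs). fps_nth (fps_X ^ 1 * sparse_fps cs) i * (x # xs) ! i)"
    by (simp only: fps_add_nth distrib_right sum.distrib power_one_right)
  also have "(\<Sum>i<length (x # xs). fps_nth 1 i * (x # xs) ! i) = x"
    by (simp add: sum.lessThan_Suc_shift del: sum.lessThan_Suc)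
  finally show ?case using 5 unfolding sum_nth_shift by simp
next
  case (6 cs x xs a b)
  have "(\<Sum>i<length (x # xs). fps_nth (- 1 + fps_X * sparse_fps cs) i * (x # xs) ! i) =
      - (\<Sum>i<length (x # xs). fps_nth 1 i * (x # xs) ! i) + (\<Sum>i<length (x # xs). fps_nth (fps_X ^ 1 * sparse_fps cs) i * (x # xs) ! i)"
    by (simp only: fps_add_nth fps_neg_nth distrib_right sum.distrib power_one_right sum_negf mult_minus_left)
  also have "(\<Sum>i<length (x # xs). fps_nth 1 i * (x # xs) ! i) = x"
    by (simp add: sum.lessThan_Suc_shift del: sum.lessThan_Suc)
  finally show ?case using 6 unfolding sum_nth_shift by simp
qed simp_all

text \<open>The coefficients are listed from the highest index down to index 0.\<close>

fun descending :: "(nat \<Rightarrow> 'a) \<Rightarrow> nat \<Rightarrow> 'a list" where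
  "descending f 0 = [f 0]"
| "descending f (Suc n) = f (Suc n) # descending f n"

lemma length_descending [simp]: "length (descending f n) = Suc n"
  by (induction n) auto

lemma nth_descending: "i \<le> n \<Longrightarrow> descending f n ! i = f (n - i)"
proof (induction n arbitrary: i)
  case (Suc n)
  thus ?case by (cases i) auto
qed simp

text \<open>With the newest coefficient at the head, the convolution runs down the codes and the
  known values in parallel. The list \<open>h # hs\<close> holds the right-hand side of the
  recurrence in ascending order.\<close>

primrec sparse_recurrence :: "sparse_coeff list \<Rightarrow> int list \<Rightarrow> int list \<Rightarrow> int list" where
  "sparse_recurrence cs [] xs = xs"
| "sparse_recurrence cs (h # hs) xs = sparse_recurrence cs hs (sparse_conv cs xs h 0 # xs)"

text \<open>With g the coded series, (1 - X g) f = h makes coefficient m + 1 of f the sum of that of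
  h and of coefficient m of g f, which involves known values only.\<close>

lemma sparse_recurrence_eq:
  assumes "fps_eq_upto (m + length hs) ((1 - fps_X * sparse_fps cs) * f) h"
    and "\<And>i. i < length hs \<Longrightarrow> hs ! i = fps_nth h (m + Suc i)"
  shows "sparse_recurrence cs hs (descending (fps_nth f) m) = descending (fps_nth f) (m + length hs)"
  using assms
proof (induction hs arbitrary: m)
  case (Cons h0 hs)
  have "fps_nth ((1 - fps_X * sparse_fps cs) * f) (Suc m) = fps_nth h (Suc m)"
    using Cons.prems(1) by (simp add: fps_eq_upto_def)
  moreover have "(1 - fps_X * sparse_fps cs) * f = f - fps_X * (sparse_fps cs * f)"
    by (simp add: algebra_simps)
  ultimately have "fps_nth f (Suc m) = fps_nth h (Suc m) + fps_nth (sparse_fps cs * f) m" by simp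
  also have "fps_nth (sparse_fps cs * f) m = (\<Sum>i<Suc m. fps_nth (sparse_fps cs) i * descending (fps_nth f) m ! i)"
    unfolding fps_mult_nth atMost_atLeast0[symmetric] lessThan_Suc_atMost
    by (intro sum.cong refl) (simp add: nth_descending)
  also have "fps_nth h (Suc m) = h0" using Cons.prems(2)[of 0] by simp
  finally have "sparse_conv cs (descending (fps_nth f) m) h0 0 = fps_nth f (Suc m)"
    by (simp add: sparse_conv_eq)
  hence "sparse_recurrence cs (h0 # hs) (descending (fps_nth f) m) =
      sparse_recurrence cs hs (descending (fps_nth f) (Suc m))" by simp
  also have "\<dots> = descending (fps_nth f) (Suc m + length hs)"
    by (rule Cons.IH) (use Cons.prems(1) Cons.prems(2)[of "Suc _"] in \<open>simp_all\<close>)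
  finally show ?case by simp
qed simp

fun sign_code :: "bool \<Rightarrow> sparse_coeff" where
  "sign_code True = Plus" | "sign_code False = Minus"

lemma sparse_fps_sign: "sparse_fps (sign_code s # cs) = (if s then 1 else - 1) + fps_X * sparse_fps cs"
  by (cases s) auto

text \<open>The two exponents belonging to index \<open>Suc k\<close> follow the previous exponent at distance \<open>2k+1\<close>
  and \<open>k+1\<close>, both scaled by \<open>Suc m\<close>; the flag is the sign.\<close>

primrec pent_codes :: "nat \<Rightarrow> bool \<Rightarrow> nat \<Rightarrow> nat \<Rightarrow> sparse_coeff list" where
  "pent_codes m s k 0 = []"
| "pent_codes m s k (Suc n) = zeros (k + k + m * (k + k + 1)) @ sign_code s # zeros (k + m * (k + 1)) @ sign_code s
     # pent_codes m (\<not> s) (Suc k) n"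

text \<open>The power of X in front places the codes just behind the second, scaled exponent of
  index k.\<close>

lemma sparse_fps_pent_codes:
  "fps_X ^ Suc (Suc m * (k\<^sup>2 + triangle k)) * sparse_fps (pent_codes m s k n) =
   (\<Sum>j<n. (if s then 1 else - 1) * (-1) ^ j * (fps_X ^ (Suc m * ((Suc (k + j))\<^sup>2 + triangle (k + j)))
      + fps_X ^ (Suc m * ((Suc (k + j))\<^sup>2 + triangle (Suc (k + j))))))"
proof (induction n arbitrary: s k)
  case (Suc n)
  let ?X = "fps_X :: int fps"
  let ?\<sigma> = "if s then 1 else - 1 :: int fps"
  define e0 where "e0 = Suc (Suc m * (k\<^sup>2 + triangle k))"
  define g1 where "g1 = k + k + m * (k + k + 1)"
  define g2 where "g2 = k + m * (k + 1)"
  define e1 where "e1 = Suc m * ((Suc k)\<^sup>2 + triangle k)"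
  define e2 where "e2 = Suc m * ((Suc k)\<^sup>2 + triangle (Suc k))"
  have e: "e0 + g1 = e1" "Suc e1 + g2 = e2" "Suc e2 = Suc (Suc m * ((Suc k)\<^sup>2 + triangle (Suc k)))"
    unfolding e0_def e1_def e2_def g1_def g2_def by (simp_all add: power2_eq_square algebra_simps)
  have "?X ^ e0 * sparse_fps (pent_codes m s k (Suc n)) =
      ?\<sigma> * ?X ^ (e0 + g1) + ?\<sigma> * ?X ^ (Suc (e0 + g1) + g2)
       + ?X ^ Suc (Suc (e0 + g1) + g2) * sparse_fps (pent_codes m (\<not> s) (Suc k) n)"
    unfolding pent_codes.simps sparse_fps_zeros sparse_fps_sign
    by (simp add: g1_def g2_def power_add algebra_simps)
  also have "?X ^ Suc (Suc (e0 + g1) + g2) * sparse_fps (pent_codes m (\<not> s) (Suc k) n) =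
      (\<Sum>j<n. (if \<not> s then 1 else - 1) * (-1) ^ j * (?X ^ (Suc m * ((Suc (Suc k + j))\<^sup>2 + triangle (Suc k + j)))
      + ?X ^ (Suc m * ((Suc (Suc k + j))\<^sup>2 + triangle (Suc (Suc k + j))))))"
    unfolding e by (rule Suc.IH)
  also have "\<dots> = (\<Sum>j<n. ?\<sigma> * (-1) ^ Suc j * (?X ^ (Suc m * ((Suc (k + Suc j))\<^sup>2 + triangle (k + Suc j)))
      + ?X ^ (Suc m * ((Suc (k + Suc j))\<^sup>2 + triangle (Suc (k + Suc j))))))"
    by (intro sum.cong refl) simp
  also have "?\<sigma> * ?X ^ (e0 + g1) + ?\<sigma> * ?X ^ (Suc (e0 + g1) + g2) + \<dots> =
      (\<Sum>j<Suc n. ?\<sigma> * (-1) ^ j * (?X ^ (Suc m * ((Suc (k + j))\<^sup>2 + triangle (k + j)))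
      + ?X ^ (Suc m * ((Suc (k + j))\<^sup>2 + triangle (Suc (k + j))))))"
    unfolding e sum.lessThan_Suc_shift unfolding e1_def e2_def by (simp add: algebra_simps)
  finally show ?case by (simp add: e0_def)
qed simp

text \<open>Consecutive squares are 2k + 1 apart, so 2k zeros lie between them; the flag is the
  sign.\<close>

primrec square_codes :: "bool \<Rightarrow> nat \<Rightarrow> nat \<Rightarrow> sparse_coeff list" where
  "square_codes s k 0 = []"
| "square_codes s k (Suc n) = zeros (k + k) @ sign_code s # square_codes (\<not> s) (Suc k) n"

lemma sparse_fps_square_codes:
  "fps_X ^ Suc (k\<^sup>2) * sparse_fps (square_codes s k n) =
   (\<Sum>j<n. (if s then 1 else - 1) * (-1) ^ j * fps_X ^ ((Suc (k + j))\<^sup>2))"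
proof (induction n arbitrary: s k)
  case (Suc n)
  let ?X = "fps_X :: int fps"
  let ?\<sigma> = "if s then 1 else - 1 :: int fps"
  have e: "Suc (k\<^sup>2) + (k + k) = (Suc k)\<^sup>2" by (simp add: power2_eq_square)
  have "?X ^ Suc (k\<^sup>2) * sparse_fps (square_codes s k (Suc n)) =
      ?\<sigma> * ?X ^ (Suc (k\<^sup>2) + (k + k)) + ?X ^ Suc (Suc (k\<^sup>2) + (k + k)) * sparse_fps (square_codes (\<not> s) (Suc k) n)"
    unfolding square_codes.simps sparse_fps_zeros sparse_fps_sign by (simp add: power_add algebra_simps)
  also have "?X ^ Suc (Suc (k\<^sup>2) + (k + k)) * sparse_fps (square_codes (\<not> s) (Suc k) n) =
      (\<Sum>j<n. (if \<not> s then 1 else - 1) * (-1) ^ j * ?X ^ ((Suc (Suc k + j))\<^sup>2))"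
    unfolding e by (rule Suc.IH)
  also have "\<dots> = (\<Sum>j<n. ?\<sigma> * (-1) ^ Suc j * ?X ^ ((Suc (k + Suc j))\<^sup>2))"
    by (intro sum.cong refl) simp
  also have "?\<sigma> * ?X ^ (Suc (k\<^sup>2) + (k + k)) + \<dots> = (\<Sum>j<Suc n. ?\<sigma> * (-1) ^ j * ?X ^ ((Suc (k + j))\<^sup>2))"
    unfolding e sum.lessThan_Suc_shift by simp
  finally show ?case .
qed simp

section \<open>Comparison of leading binary digits\<close>

definition half :: "int \<Rightarrow> int" where "half x = x div 2"

text \<open>On positive binary numerals halving just drops the last digit, without a general
  division.\<close>

lemma half_code [code]:
  "half 0 = 0" "half (Int.Pos Num.One) = 0" "half (Int.Pos (Num.Bit0 m)) = Int.Pos m"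
  "half (Int.Pos (Num.Bit1 m)) = Int.Pos m" "half (Int.Neg m) = Int.Neg m div 2"
  by (simp_all add: half_def)

primrec shift_down :: "nat \<Rightarrow> int \<Rightarrow> int" where
  "shift_down 0 x = x"
| "shift_down (Suc k) x = shift_down k (half x)"

lemma shift_down_eq: "shift_down k x = x div 2 ^ k"
  by (induction k arbitrary: x) (simp_all add: half_def zdiv_zmult2_eq)

lemma shift_down_bounds: "shift_down k x * 2 ^ k \<le> x" "x \<le> (shift_down k x + 1) * 2 ^ k"
proof -
  have "0 \<le> x mod 2 ^ k" "x mod 2 ^ k < 2 ^ k" by simp_all
  moreover have "x = x div 2 ^ k * 2 ^ k + x mod 2 ^ k" by (rule div_mult_mod_eq[symmetric])
  ultimately show "shift_down k x * 2 ^ k \<le> x" "x \<le> (shift_down k x + 1) * 2 ^ k"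
    unfolding shift_down_eq distrib_right by linarith+
qed

text \<open>Twice either crank count lies between p - |a| and p + |a|, so one test settles both. Low
  digits are cut off by a shift chosen per index: l is rounded down, u0 and u2 are rounded
  up.\<close>

fun turan_approx :: "nat list \<Rightarrow> int list \<Rightarrow> int list \<Rightarrow> bool" where
  "turan_approx (k # ks) (p2 # p1 # p0 # ps) (a2 # a1 # a0 # as) =
     (let l = shift_down k (p1 - \<bar>a1\<bar>);
          u2 = shift_down k (p2 + \<bar>a2\<bar>) + 1;
          u0 = shift_down k (p0 + \<bar>a0\<bar>) + 1
      in if 0 \<le> l \<and> u2 * u0 \<le> l * l then turan_approx ks (p1 # p0 # ps) (a1 # a0 # as) else False)"
| "turan_approx ks ps as = (ks = [])"

lemma descending_Cons: "\<exists>xs. descending f n = f n # xs"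
  by (cases n) auto

definition within_counts :: "(nat \<Rightarrow> int) \<Rightarrow> (nat \<Rightarrow> int) \<Rightarrow> (nat \<Rightarrow> int) \<Rightarrow> bool" where
  "within_counts p a X \<longleftrightarrow> X = (\<lambda>i. p i + a i) \<or> X = (\<lambda>i. p i - a i)"

lemma turan_approx_step:
  fixes X0 X1 X2 l u0 u2 :: int
  assumes "0 \<le> l" "u2 * u0 \<le> l * l" "l * 2 ^ k \<le> X1" "X2 \<le> u2 * 2 ^ k" "X0 \<le> u0 * 2 ^ k" "0 \<le> X0" "0 \<le> X2"
  shows "X2 * X0 \<le> X1\<^sup>2"
proof -
  have "X2 * X0 \<le> (u2 * 2 ^ k) * (u0 * 2 ^ k)"
    using assms by (intro mult_mono) auto
  also have "\<dots> = (u2 * u0) * (2 ^ k * 2 ^ k)" by (simp only: mult_ac)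
  also have "\<dots> \<le> (l * l) * (2 ^ k * 2 ^ k)" using assms by (intro mult_right_mono) auto
  also have "\<dots> = (l * 2 ^ k)\<^sup>2" by (simp add: power2_eq_square mult_ac)
  also have "\<dots> \<le> X1\<^sup>2" using assms by (intro power_mono) auto
  finally show ?thesis .
qed

text \<open>The lists begin at index n + 1, so the first shift tests index n and each further shift
  the next lower index.\<close>

lemma turan_approx_sound:
  assumes "turan_approx ks (descending p (Suc n)) (descending a (Suc n))" "length ks + 2 \<le> n"
    and X: "within_counts p a X" "\<And>i. i \<ge> 2 \<Longrightarrow> X i \<ge> 0"
  shows "\<forall>m. n - length ks < m \<and> m \<le> n \<longrightarrow> X (m + 1) * X (m - 1) \<le> (X m)\<^sup>2"
  using assms(1,2)
proof (induction ks arbitrary: n)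
  case Nil
  thus ?case by simp
next
  case (Cons k ks)
  then obtain n' where n': "n = Suc n'" by (cases n) auto
  obtain xs ys where xs: "descending p n' = p n' # xs" "descending a n' = a n' # ys"
    using descending_Cons by metis
  define l where "l = shift_down k (p (Suc n') - \<bar>a (Suc n')\<bar>)"
  define u2 where "u2 = shift_down k (p (Suc (Suc n')) + \<bar>a (Suc (Suc n'))\<bar>) + 1"
  define u0 where "u0 = shift_down k (p n' + \<bar>a n'\<bar>) + 1"
  have eval: "turan_approx (k # ks) (descending p (Suc n)) (descending a (Suc n)) =
      (if 0 \<le> l \<and> u2 * u0 \<le> l * l then turan_approx ks (descending p n) (descending a n) else False)"
    unfolding n' by (simp add: xs l_def u2_def u0_def Let_def)
  hence ok: "0 \<le> l" "u2 * u0 \<le> l * l" and rest: "turan_approx ks (descending p (Suc n')) (descending a (Suc n'))"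
    using Cons.prems(1) n' by (auto split: if_splits)
  have IH: "\<forall>m. n' - length ks < m \<and> m \<le> n' \<longrightarrow> X (m + 1) * X (m - 1) \<le> (X m)\<^sup>2"
    by (rule Cons.IH[OF rest]) (use Cons.prems(2) n' in simp)
  have bounds: "X i \<le> p i + \<bar>a i\<bar>" "p i - \<bar>a i\<bar> \<le> X i" for i
    using X(1) by (auto simp: within_counts_def)
  have "X (n + 1) * X (n - 1) \<le> (X n)\<^sup>2"
  proof (rule turan_approx_step[OF ok])
    show "l * 2 ^ k \<le> X n" unfolding n' l_def by (rule order_trans[OF shift_down_bounds(1) bounds(2)])
    show "X (n + 1) \<le> u2 * 2 ^ k" unfolding n' u2_def using order_trans[OF bounds(1) shift_down_bounds(2)] by simp
    show "X (n - 1) \<le> u0 * 2 ^ k" unfolding n' u0_def using order_trans[OF bounds(1) shift_down_bounds(2)] by simp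
  qed (use X(2) Cons.prems(2) in auto)
  thus ?case using IH n' by (auto simp: le_Suc_eq)
qed

primrec decode :: "sparse_coeff list \<Rightarrow> int list" where
  "decode [] = []"
| "decode (c # cs) = (case c of Zero8 \<Rightarrow> [0, 0, 0, 0, 0, 0, 0, 0] | Zero1 \<Rightarrow> [0] | Plus \<Rightarrow> [1] | Minus \<Rightarrow> [- 1]) @ decode cs"

lemma nth_decode: "fps_nth (sparse_fps cs) i = (if i < length (decode cs) then decode cs ! i else 0)"
proof (induction cs arbitrary: i)
  case (Cons c cs)
  have 8: "[0, 0, 0, 0, 0, 0, 0, 0] = replicate 8 (0::int)" by (simp add: eval_nat_numeral)
  show ?case
  proof (cases c)
    case Zero8
    thus ?thesis unfolding decode.simps sparse_coeff.case 8
      by (auto simp: Cons.IH nth_append fps_X_power_mult_nth)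
  qed (use Cons.IH in \<open>cases i; auto simp: nth_append\<close>)+
qed simp

text \<open>Multiplication by 1 + 2 X g with g the coded series. The factor X is implicit: for entry
  m the convolution starts at the tail, that is at index m - 1.\<close>

fun theta_conv :: "sparse_coeff list \<Rightarrow> int list \<Rightarrow> int list" where
  "theta_conv cs [] = []"
| "theta_conv cs (x # xs) = (x + 2 * sparse_conv cs xs 0 0) # theta_conv cs xs"

lemma theta_conv_eq:
  "theta_conv cs (descending (fps_nth f) n) = descending (fps_nth ((1 + 2 * (fps_X * sparse_fps cs)) * f)) n"
proof -
  define h where "h = (1 + 2 * (fps_X * sparse_fps cs)) * f"
  have "h = f + fps_const 2 * (fps_X * (sparse_fps cs * f))"
    by (simp add: h_def algebra_simps flip: numeral_fps_const)
  hence h: "fps_nth h m = fps_nth f m + 2 * (if m = 0 then 0 else fps_nth (sparse_fps cs * f) (m - 1))" for m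
    by (simp only: fps_add_nth fps_mult_left_const_nth fps_X_mult_nth)
  have "theta_conv cs (descending (fps_nth f) n) = descending (fps_nth h) n"
  proof (induction n)
    case 0
    show ?case by (simp add: h sparse_conv_eq)
  next
    case (Suc n)
    have "fps_nth (sparse_fps cs * f) n = (\<Sum>i<Suc n. fps_nth (sparse_fps cs) i * descending (fps_nth f) n ! i)"
      unfolding fps_mult_nth atMost_atLeast0[symmetric] lessThan_Suc_atMost
      by (intro sum.cong refl) (simp add: nth_descending)
    thus ?case using Suc by (simp add: h sparse_conv_eq)
  qed
  thus ?thesis by (simp only: h_def)
qed

section \<open>Truncated series and the table of values\<close>

lemma sum_1_upto: "(\<Sum>k=1..K. g k) = (\<Sum>j<K. g (Suc j))"
  by (rule sum.reindex_bij_witness[of _ Suc "\<lambda>k. k - 1"]) auto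

text \<open>For k > K both exponents exceed N. The form with plus is used for a right-hand side, the
  form with minus for the factor 1 - X g of a recurrence.\<close>

lemma pent_upto_truncate:
  assumes "K \<le> N" "N < (Suc K)\<^sup>2 + triangle K"
  shows "fps_eq_upto N (pent_fps N) (1 + fps_X * sparse_fps (pent_codes 0 False 0 K))"
    and "fps_eq_upto N (pent_fps N) (1 - fps_X * sparse_fps (pent_codes 0 True 0 K))"
proof -
  let ?X = "fps_X :: int fps"
  let ?f = "\<lambda>k. (-1) ^ k * (?X ^ (k\<^sup>2 + triangle (k - 1)) + ?X ^ (k\<^sup>2 + triangle k))"
  have big: "N < k\<^sup>2 + triangle (k - 1)" "N < k\<^sup>2 + triangle k" if "k > K" for k
  proof -
    have mono: "triangle i \<le> triangle j" if "i \<le> j" for i j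
      using that by (induction rule: dec_induct) auto
    have "(Suc K)\<^sup>2 \<le> k\<^sup>2" "triangle K \<le> triangle (k - 1)" "triangle (k - 1) \<le> triangle k"
      using that by (auto intro!: power_mono mono)
    thus "N < k\<^sup>2 + triangle (k - 1)" "N < k\<^sup>2 + triangle k" using assms(2) by linarith+
  qed
  have split: "(\<Sum>k=1..N. ?f k) = (\<Sum>k=1..K. ?f k) + (\<Sum>k\<in>{K<..N}. ?f k)"
    using assms(1) by (subst sum.union_disjoint[symmetric]) (auto intro!: sum.cong)
  have "fps_eq_upto N (\<Sum>k\<in>{K<..N}. ?f k) (\<Sum>k\<in>{K<..N}. 0)"
  proof (rule fps_eq_upto_sum)
    fix k assume "k \<in> {K<..N}"
    hence "fps_eq_upto N (?X ^ (k\<^sup>2 + triangle (k - 1)) * (-1) ^ k + ?X ^ (k\<^sup>2 + triangle k) * (-1) ^ k) (0 + 0)"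
      using big by (intro fps_eq_upto_add fps_eq_upto_X_power) auto
    thus "fps_eq_upto N (?f k) 0" by (simp add: algebra_simps)
  qed
  hence K: "fps_eq_upto N (pent_fps N) (1 + (\<Sum>k=1..K. ?f k))"
    unfolding pent_fps_def split by (simp add: fps_eq_upto_def)
  have reindex: "(\<Sum>k=1..K. ?f k) = (\<Sum>j<K. - ((-1) ^ j * (?X ^ ((Suc j)\<^sup>2 + triangle j) + ?X ^ ((Suc j)\<^sup>2 + triangle (Suc j)))))"
    unfolding sum_1_upto by (intro sum.cong refl) simp
  have "?X * sparse_fps (pent_codes 0 False 0 K) = (\<Sum>k=1..K. ?f k)"
    using sparse_fps_pent_codes[of 0 0 False K] unfolding reindex by simp
  moreover have "?X * sparse_fps (pent_codes 0 True 0 K) = - (\<Sum>k=1..K. ?f k)"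
    using sparse_fps_pent_codes[of 0 0 True K] unfolding reindex by (simp add: sum_negf)
  ultimately show "fps_eq_upto N (pent_fps N) (1 + ?X * sparse_fps (pent_codes 0 False 0 K))"
      "fps_eq_upto N (pent_fps N) (1 - ?X * sparse_fps (pent_codes 0 True 0 K))"
    using K by simp_all
qed

lemma pent2_upto_truncate:
  assumes "K \<le> N" "N < 2 * ((Suc K)\<^sup>2 + triangle K)"
  shows "fps_eq_upto N (pent2_fps N) (1 - fps_X * sparse_fps (pent_codes 1 True 0 K))"
proof -
  let ?X = "fps_X :: int fps"
  let ?f = "\<lambda>k. (-1) ^ k * (?X ^ (2 * (k\<^sup>2 + triangle (k - 1))) + ?X ^ (2 * (k\<^sup>2 + triangle k)))"
  have big: "N < 2 * (k\<^sup>2 + triangle (k - 1))" "N < 2 * (k\<^sup>2 + triangle k)" if "k > K" for k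
  proof -
    have mono: "triangle i \<le> triangle j" if "i \<le> j" for i j
      using that by (induction rule: dec_induct) auto
    have "(Suc K)\<^sup>2 \<le> k\<^sup>2" "triangle K \<le> triangle (k - 1)" "triangle (k - 1) \<le> triangle k"
      using that by (auto intro!: power_mono mono)
    hence a: "(Suc K)\<^sup>2 + triangle K \<le> k\<^sup>2 + triangle (k - 1)" and b: "(Suc K)\<^sup>2 + triangle K \<le> k\<^sup>2 + triangle k"
      by linarith+
    show "N < 2 * (k\<^sup>2 + triangle (k - 1))" by (rule less_le_trans[OF assms(2) mult_le_mono2[OF a]])
    show "N < 2 * (k\<^sup>2 + triangle k)" by (rule less_le_trans[OF assms(2) mult_le_mono2[OF b]])
  qed
  have split: "(\<Sum>k=1..N. ?f k) = (\<Sum>k=1..K. ?f k) + (\<Sum>k\<in>{K<..N}. ?f k)"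
    using assms(1) by (subst sum.union_disjoint[symmetric]) (auto intro!: sum.cong)
  have "fps_eq_upto N (\<Sum>k\<in>{K<..N}. ?f k) (\<Sum>k\<in>{K<..N}. 0)"
  proof (rule fps_eq_upto_sum)
    fix k assume "k \<in> {K<..N}"
    hence "fps_eq_upto N (?X ^ (2 * (k\<^sup>2 + triangle (k - 1))) * (-1) ^ k + ?X ^ (2 * (k\<^sup>2 + triangle k)) * (-1) ^ k) (0 + 0)"
      using big by (intro fps_eq_upto_add fps_eq_upto_X_power) auto
    thus "fps_eq_upto N (?f k) 0" by (simp add: algebra_simps)
  qed
  hence K: "fps_eq_upto N (pent2_fps N) (1 + (\<Sum>k=1..K. ?f k))"
    unfolding pent2_fps_def split by (simp add: fps_eq_upto_def)
  have reindex: "(\<Sum>k=1..K. ?f k) = (\<Sum>j<K. - ((-1) ^ j * (?X ^ (2 * ((Suc j)\<^sup>2 + triangle j)) + ?X ^ (2 * ((Suc j)\<^sup>2 + triangle (Suc j))))))"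
    unfolding sum_1_upto by (intro sum.cong refl) simp
  have two: "Suc 1 = 2" by simp
  have "?X * sparse_fps (pent_codes 1 True 0 K) = - (\<Sum>k=1..K. ?f k)"
    using sparse_fps_pent_codes[of 1 0 True K] unfolding reindex two by (simp add: sum_negf)
  thus ?thesis using K by simp
qed

lemma theta_upto_truncate:
  assumes "K \<le> N" "N < (Suc K)\<^sup>2"
  shows "fps_eq_upto N (theta_fps N) (1 + 2 * (fps_X * sparse_fps (square_codes False 0 K)))"
proof -
  let ?X = "fps_X :: int fps"
  let ?f = "\<lambda>k. (-1) ^ k * ?X ^ (k\<^sup>2)"
  have split: "(\<Sum>k=1..N. ?f k) = (\<Sum>k=1..K. ?f k) + (\<Sum>k\<in>{K<..N}. ?f k)"
    using assms(1) by (subst sum.union_disjoint[symmetric]) (auto intro!: sum.cong)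
  have "fps_eq_upto N (\<Sum>k\<in>{K<..N}. ?f k) (\<Sum>k\<in>{K<..N}. 0)"
  proof (rule fps_eq_upto_sum)
    fix k assume "k \<in> {K<..N}"
    hence "(Suc K)\<^sup>2 \<le> k\<^sup>2" by (intro power_mono) auto
    hence "fps_eq_upto N (?X ^ (k\<^sup>2) * (-1) ^ k) 0"
      using assms(2) by (intro fps_eq_upto_X_power) linarith
    thus "fps_eq_upto N (?f k) 0" by (simp only: mult.commute)
  qed
  hence "fps_eq_upto N ((\<Sum>k=1..K. ?f k) + (\<Sum>k\<in>{K<..N}. ?f k)) ((\<Sum>k=1..K. ?f k) + (\<Sum>k\<in>{K<..N}. 0))"
    by (intro fps_eq_upto_add fps_eq_upto_refl)
  hence "fps_eq_upto N (theta_fps N) (1 + 2 * (\<Sum>k=1..K. ?f k))"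
    unfolding theta_fps_def split by (intro fps_eq_upto_add fps_eq_upto_mult fps_eq_upto_refl) simp
  moreover have "?X * sparse_fps (square_codes False 0 K) = (\<Sum>k=1..K. ?f k)"
  proof -
    have "(\<Sum>k=1..K. ?f k) = (\<Sum>j<K. - ((-1) ^ j * ?X ^ ((Suc j)\<^sup>2)))"
      unfolding sum_1_upto by (intro sum.cong refl) simp
    thus ?thesis using sparse_fps_square_codes[of 0 False K] by simp
  qed
  ultimately show ?thesis by (simp only:)
qed

text \<open>The first list is p by Euler's recurrence. The second is the odd product, from (q^2;q^2)
  (q;q^2) = (q;q), multiplied by the theta series. Both recurrences start from the constant
  coefficient 1.\<close>

definition crank_table_ok :: "nat \<Rightarrow> nat \<Rightarrow> nat \<Rightarrow> nat \<Rightarrow> nat list \<Rightarrow> bool" where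
  "crank_table_ok N K1 K2 K3 ks \<longleftrightarrow>
     turan_approx ks (sparse_recurrence (pent_codes 0 True 0 K1) (replicate N 0) [1])
        (theta_conv (square_codes False 0 K3)
          (sparse_recurrence (pent_codes 1 True 0 K2) (take N (decode (pent_codes 0 False 0 K1) @ replicate N 0)) [1]))"

lemma fps_eq_upto_mult_left:
  "fps_eq_upto N f g \<Longrightarrow> fps_eq_upto N (g * h) k \<Longrightarrow> fps_eq_upto N (f * h) k"
  using fps_eq_upto_trans[OF fps_eq_upto_mult[OF _ fps_eq_upto_refl]] by blast

lemma descending_cong: "(\<And>i. i \<le> n \<Longrightarrow> f i = g i) \<Longrightarrow> descending f n = descending g n"
  by (induction n) auto

theorem crank_table_sound:
  assumes ok: "crank_table_ok (Suc n) K1 K2 K3 ks"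
    and K: "K1 \<le> Suc n" "Suc n < (Suc K1)\<^sup>2 + triangle K1" "K2 \<le> Suc n" "Suc n < 2 * ((Suc K2)\<^sup>2 + triangle K2)"
      "K3 \<le> Suc n" "Suc n < (Suc K3)\<^sup>2"
    and len: "length ks + 2 \<le> n"
    and X: "within_counts (fps_nth partition_fps) (fps_nth crank_gf) X" "\<And>i. i \<ge> 2 \<Longrightarrow> X i \<ge> 0"
    and m: "n - length ks < m" "m \<le> n"
  shows "X (m + 1) * X (m - 1) \<le> (X m)\<^sup>2"
proof -
  define N where "N = Suc n"
  have p0: "fps_nth partition_fps 0 = 1"
    using partition_recurrence[of 0] by (simp add: fps_eq_upto_def pent_fps_def)
  have b0: "fps_nth (qpoch_odd N) 0 = 1"
    by (simp add: qpoch_odd_def fps_prod_nth')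
  have P: "sparse_recurrence (pent_codes 0 True 0 K1) (replicate N 0) [1] = descending (fps_nth partition_fps) N"
  proof -
    have "fps_eq_upto N ((1 - fps_X * sparse_fps (pent_codes 0 True 0 K1)) * partition_fps) 1"
      by (rule fps_eq_upto_mult_left[OF fps_eq_upto_sym[OF pent_upto_truncate(2)] partition_recurrence])
         (use K in \<open>simp_all add: N_def\<close>)
    from sparse_recurrence_eq[of 0 "replicate N 0", simplified, OF this] show ?thesis
      by (simp add: p0)
  qed
  have B: "sparse_recurrence (pent_codes 1 True 0 K2) (take N (decode (pent_codes 0 False 0 K1) @ replicate N 0)) [1] =
      descending (fps_nth (qpoch_odd N)) N"
  proof -
    \<comment> \<open>Padding with zeros and cutting yields exactly N entries, the pentagonal
      coefficients of index 1 to N.\<close>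
    define hs where "hs = take N (decode (pent_codes 0 False 0 K1) @ replicate N 0)"
    have hs: "length hs = N" by (simp add: hs_def)
    have rec: "fps_eq_upto (0 + length hs) ((1 - fps_X * sparse_fps (pent_codes 1 True 0 K2)) * qpoch_odd N) (pent_fps N)"
      unfolding hs add_0
      by (rule fps_eq_upto_mult_left[OF fps_eq_upto_sym[OF pent2_upto_truncate] qpoch_odd_recurrence])
         (use K in \<open>simp_all add: N_def\<close>)
    have "hs ! i = fps_nth (pent_fps N) (0 + Suc i)" if "i < length hs" for i
    proof -
      have "fps_nth (pent_fps N) (Suc i) = fps_nth (1 + fps_X * sparse_fps (pent_codes 0 False 0 K1)) (Suc i)"
        using pent_upto_truncate(1)[of K1 N] K that hs by (simp add: fps_eq_upto_def N_def)
      also have "\<dots> = fps_nth (sparse_fps (pent_codes 0 False 0 K1)) i" by simp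
      also have "\<dots> = hs ! i" unfolding nth_decode using that hs by (simp add: hs_def nth_append)
      finally show ?thesis by simp
    qed
    from sparse_recurrence_eq[OF rec this] show ?thesis
      unfolding hs_def[symmetric] by (simp add: b0 hs)
  qed
  have A: "theta_conv (square_codes False 0 K3) (descending (fps_nth (qpoch_odd N)) N) = descending (fps_nth crank_gf) N"
    unfolding theta_conv_eq
  proof (rule descending_cong)
    fix i assume i: "i \<le> N"
    have "fps_eq_upto N ((1 + 2 * (fps_X * sparse_fps (square_codes False 0 K3))) * qpoch_odd N) (theta_fps N * qpoch_odd N)"
      by (intro fps_eq_upto_mult fps_eq_upto_sym[OF theta_upto_truncate] fps_eq_upto_refl)
         (use K in \<open>simp_all add: N_def\<close>)
    also have "fps_eq_upto N (theta_fps N * qpoch_odd N) crank_gf"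
      by (rule fps_eq_upto_sym[OF crank_gf_upto_theta]) (simp add: N_def)
    finally show "fps_nth ((1 + 2 * (fps_X * sparse_fps (square_codes False 0 K3))) * qpoch_odd N) i = fps_nth crank_gf i"
      using i by (simp add: fps_eq_upto_def)
  qed
  have "turan_approx ks (descending (fps_nth partition_fps) (Suc n)) (descending (fps_nth crank_gf) (Suc n))"
    using ok unfolding crank_table_ok_def N_def[symmetric] P B A .
  from turan_approx_sound[OF this len X] m show ?thesis by blast
qed

text \<open>One shift for each of the 606 indices from 699 down to 94, falling with the size of p.
  The last 26 indices, 94 to 119, are tested without discarding digits.\<close>

definition crank_shifts :: "nat list" where
  "crank_shifts = replicate 60 65 @ replicate 60 61 @ replicate 60 56 @ replicate 60 52 @ replicate 60 47
     @ replicate 60 42 @ replicate 60 36 @ replicate 60 30 @ replicate 60 23 @ replicate 40 18 @ replicate 26 0"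

text \<open>The values 21, 15 and 26 are the least numbers of terms for which all omitted exponents
  exceed 700.\<close>

lemma crank_table_700: "crank_table_ok 700 21 15 26 crank_shifts"
  by code_simp

lemma crank_counts_turan_small:
  assumes X: "within_counts (fps_nth partition_fps) (fps_nth crank_gf) X" "\<And>i. i \<ge> 2 \<Longrightarrow> X i \<ge> 0"
    and m: "94 \<le> m" "m \<le> 699"
  shows "X (m + 1) * X (m - 1) \<le> (X m)\<^sup>2"
proof (rule crank_table_sound[of 699 21 15 26 crank_shifts])
  show "crank_table_ok (Suc 699) 21 15 26 crank_shifts" using crank_table_700 by simp
  have "triangle 21 = 231" "triangle 15 = 120" by (simp_all add: triangle_def)
  thus "Suc 699 < (Suc 21)\<^sup>2 + triangle 21" "Suc 699 < 2 * ((Suc 15)\<^sup>2 + triangle 15)" by simp_all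
  have "length crank_shifts = 606" by (simp add: crank_shifts_def)
  thus "length crank_shifts + 2 \<le> 699" "699 - length crank_shifts < m" using m by simp_all
qed (use X m in simp_all)

lemma turan_double:
  fixes a b c :: nat
  assumes "(2 * int a) * (2 * int b) \<le> (2 * int c)\<^sup>2"
  shows "b * a \<le> c\<^sup>2"
proof -
  have "int (b * a) \<le> int (c\<^sup>2)" using assms by (simp add: power2_eq_square mult.commute)
  thus ?thesis by (simp only: of_nat_le_iff)
qed

lemma crank_counts_turan:
  assumes "n \<ge> 94"
  shows "M\<^sub>0 (n - 1) * M\<^sub>0 (n + 1) \<le> (M\<^sub>0 n)\<^sup>2" "M\<^sub>1 (n - 1) * M\<^sub>1 (n + 1) \<le> (M\<^sub>1 n)\<^sup>2"
proof -
  let ?p = "fps_nth partition_fps" and ?a = "fps_nth crank_gf"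
  have sum: "int (card (partitions i)) = int (M\<^sub>0 i) + int (M\<^sub>1 i)" for i
    using M_sum[of i] by linarith
  have X: "?p i + ?a i = 2 * int (M\<^sub>0 i)" "?p i - ?a i = 2 * int (M\<^sub>1 i)" if "i \<ge> 2" for i
    using that sum[of i] by (simp_all add: partition_fps_def crank_gf_def crank_diff_def)
  have Z: "real (num_partitions i) + 1 * real_of_int (crank_diff i) = 2 * real (M\<^sub>0 i)"
      "real (num_partitions i) + (- 1) * real_of_int (crank_diff i) = 2 * real (M\<^sub>1 i)" for i
    unfolding num_partitions_def M_sum[symmetric] by (simp_all add: crank_diff_def)
  show "M\<^sub>0 (n - 1) * M\<^sub>0 (n + 1) \<le> (M\<^sub>0 n)\<^sup>2" "M\<^sub>1 (n - 1) * M\<^sub>1 (n + 1) \<le> (M\<^sub>1 n)\<^sup>2"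
  proof -
    consider "n \<le> 699" | "n \<ge> 700" by linarith
    hence "M\<^sub>0 (n - 1) * M\<^sub>0 (n + 1) \<le> (M\<^sub>0 n)\<^sup>2 \<and> M\<^sub>1 (n - 1) * M\<^sub>1 (n + 1) \<le> (M\<^sub>1 n)\<^sup>2"
    proof cases
      case 1
      have "(?p (n + 1) + ?a (n + 1)) * (?p (n - 1) + ?a (n - 1)) \<le> (?p n + ?a n)\<^sup>2"
        by (rule crank_counts_turan_small[OF _ _ assms 1]) (simp_all add: within_counts_def X)
      moreover have "(?p (n + 1) - ?a (n + 1)) * (?p (n - 1) - ?a (n - 1)) \<le> (?p n - ?a n)\<^sup>2"
        by (rule crank_counts_turan_small[OF _ _ assms 1]) (simp_all add: within_counts_def X)
      moreover have "2 \<le> n + 1" "2 \<le> n - 1" "2 \<le> n" using assms by simp_all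
      ultimately show ?thesis using turan_double by (simp only: X)
    next
      case 2
      have real_case: "a * b \<le> c\<^sup>2" if "(2 * real a) * (2 * real b) \<le> (2 * real c)\<^sup>2" for a b c :: nat
      proof -
        have "real (a * b) \<le> real (c\<^sup>2)" using that by (simp add: power2_eq_square)
        thus ?thesis by (simp only: of_nat_le_iff)
      qed
      show ?thesis
        using real_case crank_counts_turan_large[OF 2, of 1] crank_counts_turan_large[OF 2, of "-1"]
        unfolding Z by simp
    qed
    thus "M\<^sub>0 (n - 1) * M\<^sub>0 (n + 1) \<le> (M\<^sub>0 n)\<^sup>2" "M\<^sub>1 (n - 1) * M\<^sub>1 (n + 1) \<le> (M\<^sub>1 n)\<^sup>2" by simp_all
  qed
qed

text \<open>\<open>log_concave_from N\<close> begins its inequalities at N + 1, so both sequences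
  are covered by the inequalities for n >= 94.\<close>

theorem theorem1p4:
  shows "(\<forall>M \<in> {M\<^sub>0, M\<^sub>1}. \<forall>n \<ge> 94. (M n)\<^sup>2 \<ge> M (n - 1) * M (n + 1))
    \<and> log_concave_from 94 M\<^sub>0 \<and> log_concave_from 93 M\<^sub>1"
  using crank_counts_turan by (simp add: log_concave_from_def)

end
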